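(* Let $k\ge1$ be an integer and let $r\in H^k_\theta(\Sigma)$ satisfy $\|r\|_\infty=\sup_{\theta}|r(\theta)|<1$. Then the potential $q=\{q_n\}_{n=-\infty}^{\infty}$ reconstructed from $r$ belongs to $l^{2,k}$.
   Context: $l^{2,k}$ is the space of complex sequences with $\sum_{n\in\mathbb Z}(1+n^2)^k|q_n|^2<\infty$. $\Sigma=\{z=e^{i\theta}:\theta\in[-\pi,\pi]\}$ is the unit circle, oriented clockwise, with $+$ side $D_+=\{|z|>1\}$ and $-$ side $D_-=\{|z|<1\}$; functions on $\Sigma$ are written as functions of $z$ or of $\theta$. $H^k_\theta(\Sigma)=\{f\in L^2_\theta(\Sigma):\partial_\theta^\alpha f\in L^2_\theta(\Sigma),\ \alpha=1,\dots,k\}$ (periodic Sobolev space). Reconstruction of the potential. For $n\in\mathbb Z$, let $M(z,n)$ be the $2\times2$ matrix solution of the Riemann–Hilbert problem: $M(\cdot,n)$ is holomorphic on $\mathbb C\setminus\Sigma$; $M(z,n)=I+\mathcal O(z^{-1})$ as $z\to\infty$; and on $\Sigma$ the boundary values from $D_\pm$ satisfy $$M_+(z,n)=M_-(z,n)\begin{pmatrix}1-|r(z)|^2&-\overline{r(z)}z^{2n}\\ r(z)z^{-2n}&1\end{pmatrix}.$$ Explicitly, set $$w_-(z,n)=\begin{pmatrix}0&-\overline{r(z)}z^{2n}\\0&0\end{pmatrix},\quad w_+(z,n)=\begin{pmatrix}0&0\\ r(z)z^{-2n}&0\end{pmatrix},\quad w=w_++w_-,$$ $C_\pm f(z)=\lim_{\epsilon\to\pm0}\frac1{2\pi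 i}\int_\Sigma\frac{f(\zeta)}{\zeta-(1+\epsilon)z}\,d\zeta$ for $z\in\Sigma$, and $C_wf=C_+(fw_-)+C_-(fw_+)$ (acting on $2\times 2$ matrix valued $L^2$ functions on $\Sigma$). When $\|r\|_\infty<1$, $I-C_w$ is invertible on $L^2_\theta(\Sigma)$ and $$M(z,n)=I+\frac1{2\pi i}\int_\Sigma\frac{[(I-C_w)^{-1}I](\zeta,n)\,w(\zeta,n)}{\zeta-z}\,d\zeta .$$ The reconstructed potential is $$q_n=\lim_{z\to0}\frac{[M(z,n+1)]_{1,2}}{z}=\frac1{2\pi i}\int_\Sigma z^{-2}\big[((I-C_w)^{-1}I)\,w\big]_{1,2}(z,n+1)\,dz .$$ *)

theory Defs
  imports "HOL-Analysis.Analysis"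
begin

text \<open>
  A function on the unit circle is a function \<open>f :: complex \<Rightarrow> 'a\<close> of which only the values
  \<open>f (cis \<theta>)\<close> matter. Elements of \<open>L\<^sup>2\<close> are represented by actual functions; equality in
  \<open>L\<^sup>2\<close> is equality almost everywhere in \<open>\<theta>\<close>.
\<close>

abbreviation arc :: "real measure" where
  "arc \<equiv> lebesgue_on {-pi..pi}"

definition L2_circle :: "(complex \<Rightarrow> complex) set" where
  "L2_circle = {f. (\<lambda>\<theta>. f (cis \<theta>)) \<in> borel_measurable arc
                 \<and> integrable arc (\<lambda>\<theta>. (norm (f (cis \<theta>)))\<^sup>2)}"

text \<open>
  Smooth periodic test functions, given together with all their derivatives:
  \<open>\<phi> j\<close> is the \<open>j\<close>-th derivative of \<open>\<phi> 0\<close>.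
\<close>

definition test_function :: "(nat \<Rightarrow> real \<Rightarrow> complex) \<Rightarrow> bool" where
  "test_function \<phi> \<longleftrightarrow>
     (\<forall>t. \<phi> 0 (t + 2 * pi) = \<phi> 0 t) \<and>
     (\<forall>j t. (\<phi> j has_vector_derivative \<phi> (Suc j) t) (at t))"

definition weak_derivative ::
    "nat \<Rightarrow> (complex \<Rightarrow> complex) \<Rightarrow> (complex \<Rightarrow> complex) \<Rightarrow> bool" where
  "weak_derivative \<alpha> f g \<longleftrightarrow>
     (\<forall>\<phi>. test_function \<phi> \<longrightarrow>
        (LINT \<theta>|arc. f (cis \<theta>) * \<phi> \<alpha> \<theta>) =
        (- 1) ^ \<alpha> * (LINT \<theta>|arc. g (cis \<theta>) * \<phi> 0 \<theta>))"

definition sobolev_circle :: "nat \<Rightarrow> (complex \<Rightarrow> complex) set" where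
  "sobolev_circle k =
     {f \<in> L2_circle. \<forall>\<alpha>\<in>{1..k}. \<exists>g\<in>L2_circle. weak_derivative \<alpha> f g}"

definition weighted_l2 :: "nat \<Rightarrow> (int \<Rightarrow> complex) set" where
  "weighted_l2 k =
     {q. (\<lambda>n. (1 + (real_of_int n)\<^sup>2) ^ k * (norm (q n))\<^sup>2) summable_on UNIV}"

text \<open>The circle is oriented clockwise, which accounts for the minus sign.\<close>

definition circle_integral :: "(complex \<Rightarrow> complex) \<Rightarrow> complex" where
  "circle_integral f = - (LINT \<theta>|arc. f (cis \<theta>) * (\<i> * cis \<theta>))"

definition cauchy_integral :: "(complex \<Rightarrow> complex) \<Rightarrow> complex \<Rightarrow> complex" where
  "cauchy_integral f z = 1 / (2 * pi * \<i>) * circle_integral (\<lambda>\<zeta>. f \<zeta> / (\<zeta> - z))"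

text \<open>
  The operators \<open>C\<^sub>+\<close>, \<open>C\<^sub>-\<close> and \<open>C\<^sub>w\<close> are given by their graphs:
  \<open>cauchy_plus f g\<close> means that the limit defining \<open>C\<^sub>+ f\<close> exists and equals \<open>g\<close> almost
  everywhere on the circle. The outside of the circle is the \<open>+\<close> side.
\<close>

definition cauchy_plus :: "(complex \<Rightarrow> complex) \<Rightarrow> (complex \<Rightarrow> complex) \<Rightarrow> bool" where
  "cauchy_plus f g \<longleftrightarrow>
     (AE \<theta> in arc. ((\<lambda>\<epsilon>. cauchy_integral f (of_real (1 + \<epsilon>) * cis \<theta>))
                      \<longlongrightarrow> g (cis \<theta>)) (at_right 0))"

definition cauchy_minus :: "(complex \<Rightarrow> complex) \<Rightarrow> (complex \<Rightarrow> complex) \<Rightarrow> bool" where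
  "cauchy_minus f g \<longleftrightarrow>
     (AE \<theta> in arc. ((\<lambda>\<epsilon>. cauchy_integral f (of_real (1 + \<epsilon>) * cis \<theta>))
                      \<longlongrightarrow> g (cis \<theta>)) (at_left 0))"

type_synonym cmat = "complex ^ 2 ^ 2"

definition w_minus :: "(complex \<Rightarrow> complex) \<Rightarrow> int \<Rightarrow> complex \<Rightarrow> cmat" where
  "w_minus r n z = vector [vector [0, - cnj (r z) * z powi (2 * n)],
                           vector [0, 0]]"

definition w_plus :: "(complex \<Rightarrow> complex) \<Rightarrow> int \<Rightarrow> complex \<Rightarrow> cmat" where
  "w_plus r n z = vector [vector [0, 0],
                          vector [r z * z powi (- 2 * n), 0]]"

definition w_full :: "(complex \<Rightarrow> complex) \<Rightarrow> int \<Rightarrow> complex \<Rightarrow> cmat" where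
  "w_full r n z = w_plus r n z + w_minus r n z"

definition L2_circle_mat :: "(complex \<Rightarrow> cmat) set" where
  "L2_circle_mat = {F. \<forall>i j. (\<lambda>z. F z $ i $ j) \<in> L2_circle}"

definition C_w :: "(complex \<Rightarrow> complex) \<Rightarrow> int \<Rightarrow> (complex \<Rightarrow> cmat) \<Rightarrow> (complex \<Rightarrow> cmat) \<Rightarrow> bool"
  where
  "C_w r n F G \<longleftrightarrow>
     (\<exists>A B. (\<forall>i j. cauchy_plus (\<lambda>z. (F z ** w_minus r n z) $ i $ j) (\<lambda>z. A z $ i $ j)) \<and>
            (\<forall>i j. cauchy_minus (\<lambda>z. (F z ** w_plus r n z) $ i $ j) (\<lambda>z. B z $ i $ j)) \<and>
            (AE \<theta> in arc. G (cis \<theta>) = A (cis \<theta>) + B (cis \<theta>)))"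

text \<open>
  \<open>resolvent r n G\<close> represents \<open>(I - C\<^sub>w)\<^sup>-\<^sup>1 G\<close>: an \<open>L\<^sup>2\<close> function \<open>F\<close> with
  \<open>C\<^sub>w F = F - G\<close>. For \<open>\<parallel>r\<parallel>\<^sub>\<infinity> < 1\<close> it exists and is unique almost everywhere.
\<close>

definition resolvent ::
    "(complex \<Rightarrow> complex) \<Rightarrow> int \<Rightarrow> (complex \<Rightarrow> cmat) \<Rightarrow> complex \<Rightarrow> cmat" where
  "resolvent r n G = (SOME F. F \<in> L2_circle_mat \<and> C_w r n F (\<lambda>z. F z - G z))"

definition RH_density :: "(complex \<Rightarrow> complex) \<Rightarrow> int \<Rightarrow> complex \<Rightarrow> cmat" where
  "RH_density r n z = resolvent r n (\<lambda>_. mat 1) z ** w_full r n z"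

definition RH_solution :: "(complex \<Rightarrow> complex) \<Rightarrow> complex \<Rightarrow> int \<Rightarrow> cmat" where
  "RH_solution r z n =
     mat 1 + (\<chi> i j. cauchy_integral (\<lambda>\<zeta>. RH_density r n \<zeta> $ i $ j) z)"

text \<open>
  The potential is defined by the integral formula, which makes sense for every \<open>r\<close>.
  The limit of \<open>M\<^sub>1\<^sub>2(z, n + 1) / z\<close> at \<open>z = 0\<close> exists only if \<open>M\<^sub>1\<^sub>2(0, n + 1) = 0\<close>
  (as is the case for odd \<open>r\<close>); it then has the same value, see
  \<open>reconstructed_potential_eq_limit\<close> below.
\<close>

definition reconstructed_potential :: "(complex \<Rightarrow> complex) \<Rightarrow> int \<Rightarrow> complex" where
  "reconstructed_potential r n =
     1 / (2 * pi * \<i>) * circle_integral (\<lambda>z. z powi (- 2) * RH_density r (n + 1) z $ 1 $ 2)"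

lemma cauchy_integral_quotient_limit:
  assumes int: "integrable arc (\<lambda>\<theta>. f (cis \<theta>))"
    and lim: "((\<lambda>z. cauchy_integral f z / z) \<longlongrightarrow> L) (at 0)"
  shows "1 / (2 * pi * \<i>) * circle_integral (\<lambda>z. z powi (- 2) * f z) = L"
proof -
  define c where "c = 1 / (2 * pi * \<i>) * circle_integral (\<lambda>z. z powi (- 2) * f z)"
  define K where "K = (LINT \<theta>|arc. norm (f (cis \<theta>)))"
  have intg: "integrable arc (\<lambda>\<theta>. f (cis \<theta>) * g (cis \<theta>))"
    if g: "continuous_on (sphere 0 1) g" for g
  proof -
    have "continuous_on {-pi..pi} (\<lambda>\<theta>. g (cis \<theta>))"
      by (rule continuous_on_compose2[OF g]) (auto intro!: continuous_intros)
    then have gm: "(\<lambda>\<theta>. g (cis \<theta>)) \<in> borel_measurable arc"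
      by (intro continuous_imp_measurable_on_sets_lebesgue) auto
    have "compact (g ` sphere 0 1)"
      by (rule compact_continuous_image[OF g]) auto
    then obtain B where B: "\<And>z. z \<in> sphere 0 1 \<Longrightarrow> norm (g z) \<le> B"
      by (meson bounded_iff compact_imp_bounded imageI)
    show ?thesis
    proof (rule Bochner_Integration.integrable_bound[where f = "\<lambda>\<theta>. B * norm (f (cis \<theta>))"])
      show "integrable arc (\<lambda>\<theta>. B * norm (f (cis \<theta>)))"
        using int by auto
      show "(\<lambda>\<theta>. f (cis \<theta>) * g (cis \<theta>)) \<in> borel_measurable arc"
        using gm int by auto
      have "norm (f (cis \<theta>)) * norm (g (cis \<theta>)) \<le> \<bar>B * norm (f (cis \<theta>))\<bar>" for \<theta>
      proof -
        have "norm (g (cis \<theta>)) \<le> B" using B by auto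
        then have "norm (f (cis \<theta>)) * norm (g (cis \<theta>)) \<le> norm (f (cis \<theta>)) * B"
          by (intro mult_left_mono) auto
        also have "\<dots> \<le> \<bar>B * norm (f (cis \<theta>))\<bar>" by (simp add: mult.commute)
        finally show ?thesis .
      qed
      then show "AE \<theta> in arc. norm (f (cis \<theta>) * g (cis \<theta>)) \<le> norm (B * norm (f (cis \<theta>)))"
        by (auto simp: norm_mult)
    qed
  qed
  have expand: "norm (cauchy_integral f z - cauchy_integral f 0 - z * c) \<le> (norm z)\<^sup>2 * K"
    if z: "norm z \<le> 1/2" for z
  proof -
    have ne: "cis \<theta> - z \<noteq> 0" for \<theta>
    proof
      assume "cis \<theta> - z = 0"
      then have "z = cis \<theta>" by simp
      then show False using z by simp
    qed
    have ne': "\<zeta> \<noteq> z" if "norm \<zeta> = 1" for \<zeta> using that z by auto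
    have c1: "continuous_on (sphere 0 1) (\<lambda>\<zeta>. \<i> * \<zeta> / (\<zeta> - z))"
      using ne' by (intro continuous_intros) auto
    have c2: "continuous_on (sphere 0 1) (\<lambda>\<zeta>. \<i> * \<zeta> / \<zeta>)"
      by (intro continuous_intros) auto
    have c3: "continuous_on (sphere 0 1) (\<lambda>\<zeta>. z * (\<i> * \<zeta> / \<zeta>\<^sup>2))"
      by (intro continuous_intros) auto
    have c4: "continuous_on (sphere 0 1) (\<lambda>\<zeta>. z\<^sup>2 * (\<i> / (\<zeta> * (\<zeta> - z))))"
      using ne' by (intro continuous_intros) auto
    have eq: "cauchy_integral f z - cauchy_integral f 0 - z * c =
          - (1 / (2 * pi * \<i>)) * (LINT \<theta>|arc. f (cis \<theta>) * (z\<^sup>2 * (\<i> / (cis \<theta> * (cis \<theta> - z)))))"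
    proof -
      have "(LINT \<theta>|arc. f (cis \<theta>) * (z\<^sup>2 * (\<i> / (cis \<theta> * (cis \<theta> - z))))) =
         (LINT \<theta>|arc. (f (cis \<theta>) * (\<i> * cis \<theta> / (cis \<theta> - z)) - f (cis \<theta>) * (\<i> * cis \<theta> / cis \<theta>))
                       - f (cis \<theta>) * (z * (\<i> * cis \<theta> / (cis \<theta>)\<^sup>2)))"
      proof (intro Bochner_Integration.integral_cong refl)
        fix \<theta>
        have "a * (z\<^sup>2 * (\<i> / (b * (b - z)))) =
           (a * (\<i> * b / (b - z)) - a * (\<i> * b / b)) - a * (z * (\<i> * b / b\<^sup>2))"
          if "b \<noteq> 0" "b - z \<noteq> 0" for a b :: complex
          using that by (simp add: divide_simps) (simp add: algebra_simps power2_eq_square)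
        then show "f (cis \<theta>) * (z\<^sup>2 * (\<i> / (cis \<theta> * (cis \<theta> - z)))) =
          (f (cis \<theta>) * (\<i> * cis \<theta> / (cis \<theta> - z)) - f (cis \<theta>) * (\<i> * cis \<theta> / cis \<theta>))
                       - f (cis \<theta>) * (z * (\<i> * cis \<theta> / (cis \<theta>)\<^sup>2))"
          using ne by auto
      qed
      also have "\<dots> = (LINT \<theta>|arc. f (cis \<theta>) * (\<i> * cis \<theta> / (cis \<theta> - z)))
           - (LINT \<theta>|arc. f (cis \<theta>) * (\<i> * cis \<theta> / cis \<theta>))
           - (LINT \<theta>|arc. f (cis \<theta>) * (z * (\<i> * cis \<theta> / (cis \<theta>)\<^sup>2)))"
        using intg[OF c1] intg[OF c2] intg[OF c3] by (subst Bochner_Integration.integral_diff; simp)+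
      also have "(LINT \<theta>|arc. f (cis \<theta>) * (z * (\<i> * cis \<theta> / (cis \<theta>)\<^sup>2))) =
          z * (LINT \<theta>|arc. cis \<theta> powi (- 2) * f (cis \<theta>) * (\<i> * cis \<theta>))"
      proof -
        have "(LINT \<theta>|arc. f (cis \<theta>) * (z * (\<i> * cis \<theta> / (cis \<theta>)\<^sup>2))) =
              (LINT \<theta>|arc. z * (cis \<theta> powi (- 2) * f (cis \<theta>) * (\<i> * cis \<theta>)))"
          by (intro Bochner_Integration.integral_cong refl)
             (simp add: power_int_minus field_simps)
        then show ?thesis by simp
      qed
      finally have "(LINT \<theta>|arc. f (cis \<theta>) * (z\<^sup>2 * (\<i> / (cis \<theta> * (cis \<theta> - z))))) =
           (LINT \<theta>|arc. f (cis \<theta>) * (\<i> * cis \<theta> / (cis \<theta> - z)))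
           - (LINT \<theta>|arc. f (cis \<theta>) * (\<i> * cis \<theta> / cis \<theta>))
           - z * (LINT \<theta>|arc. cis \<theta> powi (- 2) * f (cis \<theta>) * (\<i> * cis \<theta>))" .
      moreover have "cauchy_integral f y =
          - (1 / (2 * pi * \<i>)) * (LINT \<theta>|arc. f (cis \<theta>) * (\<i> * cis \<theta> / (cis \<theta> - y)))" for y
        unfolding cauchy_integral_def circle_integral_def by simp
      from this[of z] this[of 0]
      have "cauchy_integral f z =
          - (1 / (2 * pi * \<i>)) * (LINT \<theta>|arc. f (cis \<theta>) * (\<i> * cis \<theta> / (cis \<theta> - z)))"
        "cauchy_integral f 0 =
          - (1 / (2 * pi * \<i>)) * (LINT \<theta>|arc. f (cis \<theta>) * (\<i> * cis \<theta> / cis \<theta>))"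
        by (simp_all only: diff_0_right)
      moreover have "c = - (1 / (2 * pi * \<i>)) *
          (LINT \<theta>|arc. cis \<theta> powi (- 2) * f (cis \<theta>) * (\<i> * cis \<theta>))"
        unfolding c_def circle_integral_def by simp
      ultimately show ?thesis
        by (simp only: right_diff_distrib mult.assoc mult.left_commute[of z])
    qed
    have "norm (LINT \<theta>|arc. f (cis \<theta>) * (z\<^sup>2 * (\<i> / (cis \<theta> * (cis \<theta> - z)))))
        \<le> (LINT \<theta>|arc. 2 * (norm z)\<^sup>2 * norm (f (cis \<theta>)))"
    proof (rule Bochner_Integration.integral_norm_bound_integral)
      show "integrable arc (\<lambda>\<theta>. f (cis \<theta>) * (z\<^sup>2 * (\<i> / (cis \<theta> * (cis \<theta> - z)))))"
        by (rule intg[OF c4])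
      show "integrable arc (\<lambda>\<theta>. 2 * (norm z)\<^sup>2 * norm (f (cis \<theta>)))"
        using int by auto
      fix \<theta>
      have "1/2 \<le> norm (cis \<theta> - z)"
        using norm_triangle_ineq2[of "cis \<theta>" z] z by simp
      then have "1 / norm (cis \<theta> - z) \<le> 2"
        by (simp add: divide_simps)
      then have "(norm (f (cis \<theta>)) * (norm z)\<^sup>2) * (1 / norm (cis \<theta> - z)) \<le> (norm (f (cis \<theta>)) * (norm z)\<^sup>2) * 2"
        by (intro mult_left_mono) auto
      then show "norm (f (cis \<theta>) * (z\<^sup>2 * (\<i> / (cis \<theta> * (cis \<theta> - z))))) \<le> 2 * (norm z)\<^sup>2 * norm (f (cis \<theta>))"
        by (simp add: norm_mult norm_divide norm_power mult_ac)
    qed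
    also have "\<dots> = 2 * (norm z)\<^sup>2 * K" by (simp add: K_def)
    finally have bd: "norm (LINT \<theta>|arc. f (cis \<theta>) * (z\<^sup>2 * (\<i> / (cis \<theta> * (cis \<theta> - z)))))
        \<le> 2 * (norm z)\<^sup>2 * K" .
    have "norm (- (1 / (2 * pi * \<i>))) = 1 / (2 * pi)"
      by (simp add: norm_divide norm_mult)
    then have "norm (cauchy_integral f z - cauchy_integral f 0 - z * c) \<le>
        1 / (2 * pi) * (2 * (norm z)\<^sup>2 * K)"
      unfolding eq norm_mult using bd by (simp only: mult_left_mono pi_ge_zero zero_le_divide_1_iff
          zero_le_mult_iff zero_le_numeral simp_thms)
    also have "\<dots> \<le> 1 * ((norm z)\<^sup>2 * K)"
    proof -
      have "1 / pi \<le> 1" using pi_ge_two by (simp add: divide_simps)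
      moreover have "K \<ge> 0" by (simp add: K_def)
      ultimately have "1 / pi * ((norm z)\<^sup>2 * K) \<le> 1 * ((norm z)\<^sup>2 * K)"
        by (intro mult_right_mono) auto
      then show ?thesis by simp
    qed
    finally show ?thesis by simp
  qed
  have ev: "\<forall>\<^sub>F z in at 0. norm (z::complex) \<le> 1/2 \<and> z \<noteq> 0"
    unfolding eventually_at by (rule exI[of _ "1/2"]) auto
  have q0: "((\<lambda>z. (cauchy_integral f z - cauchy_integral f 0 - z * c) / z) \<longlongrightarrow> 0) (at 0)"
  proof (rule Lim_null_comparison[where g = "\<lambda>z. norm z * K"])
    show "\<forall>\<^sub>F z in at 0. norm ((cauchy_integral f z - cauchy_integral f 0 - z * c) / z) \<le> norm z * K"
      using ev by eventually_elim
        (use expand in \<open>auto simp: norm_divide divide_simps power2_eq_square mult_ac\<close>)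
    show "((\<lambda>z::complex. norm z * K) \<longlongrightarrow> 0) (at 0)"
      by (auto intro!: tendsto_eq_intros)
  qed
  have "((\<lambda>z. cauchy_integral f z / z - (cauchy_integral f z - cauchy_integral f 0 - z * c) / z)
           \<longlongrightarrow> L - 0) (at 0)"
    by (intro tendsto_diff lim q0)
  then have 1: "((\<lambda>z. cauchy_integral f 0 / z + c) \<longlongrightarrow> L) (at 0)"
    unfolding diff_0_right
  proof (rule Lim_transform_eventually)
    show "\<forall>\<^sub>F z in at 0. cauchy_integral f z / z - (cauchy_integral f z - cauchy_integral f 0 - z * c) / z
            = cauchy_integral f 0 / z + c"
      using ev by eventually_elim (auto simp: field_simps)
  qed
  then have "((\<lambda>z. (cauchy_integral f 0 / z + c) * z - c * z) \<longlongrightarrow> L * 0 - c * 0) (at 0)"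
    by (intro tendsto_intros)
  moreover have "\<forall>\<^sub>F z in at 0. (cauchy_integral f 0 / z + c) * z - c * z = cauchy_integral f 0"
    using ev by eventually_elim (auto simp: field_simps)
  ultimately have "((\<lambda>z::complex. cauchy_integral f 0) \<longlongrightarrow> 0) (at 0)"
    by (simp add: tendsto_cong)
  then have "cauchy_integral f 0 = 0"
    by (simp add: tendsto_const_iff)
  with 1 have "((\<lambda>z::complex. c) \<longlongrightarrow> L) (at 0)" by simp
  then show ?thesis
    by (simp add: tendsto_const_iff c_def)
qed

lemma reconstructed_potential_eq_limit:
  assumes "integrable arc (\<lambda>\<theta>. RH_density r (n + 1) (cis \<theta>) $ 1 $ 2)"
    and "((\<lambda>z. RH_solution r z (n + 1) $ 1 $ 2 / z) \<longlongrightarrow> L) (at 0)"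
  shows "reconstructed_potential r n = L"
  unfolding reconstructed_potential_def
  by (rule cauchy_integral_quotient_limit)
     (use assms in \<open>simp_all add: RH_solution_def mat_def\<close>)

end

theory Submission
  imports Defs "HOL-Real_Asymp.Real_Asymp"
begin

text \<open>
  In Fourier coefficients \<open>C\<^sub>+\<close> is the projection \<open>P\<^sub>-\<close> onto negative frequencies and \<open>C\<^sub>-\<close> is
  \<open>- P\<^sub>+\<close>, where \<open>P\<^sub>+\<close> projects onto nonnegative frequencies. With \<open>R = r z\<^bsup>-2N\<^esup>\<close>, \<open>N = n + 1\<close>, the
  first row \<open>(f, g)\<close> of the resolvent solves \<open>f = 1 - P\<^sub>+(R g)\<close>, \<open>g = - P\<^sub>-(R\<^sup>* f)\<close>, and \<open>q\<^sub>n\<close> is the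
  coefficient of \<open>z\<close> in \<open>R\<^sup>* f\<close>, where the star is complex conjugation. This is a contraction on
  \<open>\<ell>\<^sup>2\<close>, and since \<open>r\<close> is in \<open>H\<^sup>1\<close> its commutator with \<open>d/d\<theta>\<close> maps \<open>\<ell>\<^sup>1\<close> to \<open>\<ell>\<^sup>2\<close>; so its solution is
  in \<open>H\<^sup>1\<close>, and all boundary values exist pointwise.

  For \<open>n \<ge> 0\<close> the difference between \<open>q\<^sub>n\<close> and the conjugate of the coefficient \<open>2n + 1\<close> of \<open>r\<close>
  is quadratic in the tail of the coefficients of \<open>r\<close>. For \<open>n < 0\<close> that tail is not small, and one
  passes to the complementary unknowns \<open>e = g + R\<^sup>* f\<close>, \<open>x = f + R g\<close>. With \<open>u = 1 / (1 - \<bar>r\<bar>\<^sup>2)\<close> they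
  satisfy \<open>P\<^sub>+(u e) = P\<^sub>+(u R\<^sup>* x)\<close> and \<open>P\<^sub>-(u x) = P\<^sub>-(u R e)\<close>, whose right-hand sides only involve high
  coefficients of \<open>u\<close> times the conjugate of \<open>r\<close>, a function that is again in \<open>H\<^sup>k\<close>. Now \<open>q\<^sub>n\<close> is the
  coefficient of \<open>z\<close> in \<open>e\<close>; pairing with the solution \<open>v\<close> of \<open>P\<^sub>+(u v) = z\<close> and replacing \<open>x\<close> by the
  solution \<open>y\<close> of \<open>P\<^sub>-(u y) = 0\<close>, neither of which depends on \<open>n\<close>, gives the leading term.
\<close>

section \<open>Square summable and summable families\<close>

text \<open>\<open>resolvent\<close> picks some solution, so existence has to be paired with a proof
  that every square integrable solution obeys the Fourier equations; the estimates are then made for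
  an arbitrary solution.

  The regularity is borderline: for \<open>r\<close> in H^1 the derivative of \<open>r\<close> is
  only square integrable, so the commutator need not be bounded on l2. It costs an l1 norm of the
  unknown. Interpolation bounds that by a large multiple of the l2 norm plus a small multiple of the
  H^1 norm, and the gap 1 - \<kappa> absorbs the small part.

  For the decay an error of order |n|^(-k-1) is enough: the weight |n|^k leaves 1/|n|, which is
  square summable. The quadratic error for n \<ge> 0 has order |n|^(-2k). For n < 0 an l2 tail gives
  |n|^(-k), and two l1 tails of order |n|^(-1/2), one from estimating \<open>e\<close> and one from
  the error in replacing \<open>x\<close>, supply the remaining power.

  \<open>u\<close> may be far from 1, but it lies between 1 and \<open>U\<close> = 1 / (1 -
  \<kappa>^2), so \<open>u / U\<close> is within \<kappa>^2 of 1 and half-line equations with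
  \<open>u\<close> are contractive again.\<close>

text \<open>
  Norm bounds are phrased through finite partial sums, so that they survive pointwise limits.
\<close>

definition l2_le :: "('a \<Rightarrow> complex) \<Rightarrow> real \<Rightarrow> bool" where
  "l2_le a C \<longleftrightarrow> (\<forall>F. finite F \<longrightarrow> L2_set (\<lambda>i. norm (a i)) F \<le> C)"

definition l1_le :: "('a \<Rightarrow> complex) \<Rightarrow> real \<Rightarrow> bool" where
  "l1_le a C \<longleftrightarrow> (\<forall>F. finite F \<longrightarrow> (\<Sum>i\<in>F. norm (a i)) \<le> C)"

lemma l2_leI: "(\<And>F. finite F \<Longrightarrow> L2_set (\<lambda>i. norm (a i)) F \<le> C) \<Longrightarrow> l2_le a C"
  by (simp add: l2_le_def)

lemma l2_leD: "l2_le a C \<Longrightarrow> finite F \<Longrightarrow> L2_set (\<lambda>i. norm (a i)) F \<le> C"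
  by (simp add: l2_le_def)

lemma l1_leI: "(\<And>F. finite F \<Longrightarrow> (\<Sum>i\<in>F. norm (a i)) \<le> C) \<Longrightarrow> l1_le a C"
  by (simp add: l1_le_def)

lemma l1_leD: "l1_le a C \<Longrightarrow> finite F \<Longrightarrow> (\<Sum>i\<in>F. norm (a i)) \<le> C"
  by (simp add: l1_le_def)

lemma l2_le_nonneg: "l2_le a C \<Longrightarrow> 0 \<le> C"
  using l2_leD[of a C "{}"] by simp

lemma l2_le_norm: "l2_le a C \<Longrightarrow> norm (a i) \<le> C"
  using l2_leD[of a C "{i}"] by simp

lemma l2_le_mono:
  assumes "l2_le b C" "\<And>i. norm (a i) \<le> norm (b i)" "C \<le> D"
  shows "l2_le a D"
proof (rule l2_leI)
  fix F :: "'a set" assume "finite F"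
  have "L2_set (\<lambda>i. norm (a i)) F \<le> L2_set (\<lambda>i. norm (b i)) F"
    using assms by (intro L2_set_mono) auto
  then show "L2_set (\<lambda>i. norm (a i)) F \<le> D"
    using l2_leD[OF assms(1) \<open>finite F\<close>] assms(3) by simp
qed

lemma l1_le_mono:
  assumes "l1_le b C" "\<And>i. norm (a i) \<le> norm (b i)" "C \<le> D"
  shows "l1_le a D"
proof (rule l1_leI)
  fix F :: "'a set" assume "finite F"
  have "(\<Sum>i\<in>F. norm (a i)) \<le> (\<Sum>i\<in>F. norm (b i))"
    using assms by (intro sum_mono) auto
  then show "(\<Sum>i\<in>F. norm (a i)) \<le> D"
    using l1_leD[OF assms(1) \<open>finite F\<close>] assms(3) by simp
qed

lemma l2_le_add:
  assumes "l2_le a A" "l2_le b B"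
  shows "l2_le (\<lambda>i. a i + b i) (A + B)"
proof (rule l2_leI)
  fix F :: "'a set" assume F: "finite F"
  have "L2_set (\<lambda>i. norm (a i + b i)) F \<le> L2_set (\<lambda>i. norm (a i) + norm (b i)) F"
    by (intro L2_set_mono norm_triangle_ineq) auto
  also have "\<dots> \<le> L2_set (\<lambda>i. norm (a i)) F + L2_set (\<lambda>i. norm (b i)) F"
    by (rule L2_set_triangle_ineq)
  finally show "L2_set (\<lambda>i. norm (a i + b i)) F \<le> A + B"
    using l2_leD[OF assms(1) F] l2_leD[OF assms(2) F] by simp
qed

lemma l1_le_add:
  assumes "l1_le a A" "l1_le b B"
  shows "l1_le (\<lambda>i. a i + b i) (A + B)"
proof (rule l1_leI)
  fix F :: "'a set" assume F: "finite F"
  have "(\<Sum>i\<in>F. norm (a i + b i)) \<le> (\<Sum>i\<in>F. norm (a i)) + (\<Sum>i\<in>F. norm (b i))"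
    unfolding sum.distrib[symmetric] by (intro sum_mono norm_triangle_ineq)
  then show "(\<Sum>i\<in>F. norm (a i + b i)) \<le> A + B"
    using l1_leD[OF assms(1) F] l1_leD[OF assms(2) F] by simp
qed

lemma l2_le_cmult:
  assumes "l2_le a A"
  shows "l2_le (\<lambda>i. c * a i) (norm c * A)"
proof (rule l2_leI)
  fix F :: "'a set" assume F: "finite F"
  have "L2_set (\<lambda>i. norm (c * a i)) F = norm c * L2_set (\<lambda>i. norm (a i)) F"
    by (simp add: norm_mult L2_set_right_distrib)
  then show "L2_set (\<lambda>i. norm (c * a i)) F \<le> norm c * A"
    using l2_leD[OF assms F] by (simp add: mult_left_mono)
qed

lemma l2_le_diff:
  assumes "l2_le a A" "l2_le b B"
  shows "l2_le (\<lambda>i. a i - b i) (A + B)"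
  using l2_le_add[OF assms(1) l2_le_cmult[OF assms(2), of "- 1"]] by simp

lemma l2_le_lim:
  assumes "\<And>n. l2_le (a n) C" "\<And>i. ((\<lambda>n. a n i) \<longlongrightarrow> b i) F" "F \<noteq> bot"
  shows "l2_le b C"
proof (rule l2_leI)
  fix G :: "'b set" assume G: "finite G"
  have "((\<lambda>n. L2_set (\<lambda>i. norm (a n i)) G) \<longlongrightarrow> L2_set (\<lambda>i. norm (b i)) G) F"
    unfolding L2_set_def by (intro tendsto_intros assms)
  then show "L2_set (\<lambda>i. norm (b i)) G \<le> C"
    by (rule tendsto_upperbound) (use assms l2_leD[OF assms(1) G] in auto)
qed

lemma l2_le_reindex:
  assumes "l2_le a A" "inj g"
  shows "l2_le (\<lambda>i. a (g i)) A"
proof (rule l2_leI)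
  fix F :: "'b set" assume F: "finite F"
  have "L2_set (\<lambda>i. norm (a (g i))) F = L2_set (\<lambda>i. norm (a i)) (g ` F)"
    using assms(2) by (simp add: L2_set_def sum.reindex inj_on_subset[of g UNIV])
  then show "L2_set (\<lambda>i. norm (a (g i))) F \<le> A"
    using l2_leD[OF assms(1), of "g ` F"] F by simp
qed

lemma l1_le_reindex:
  assumes "l1_le a A" "inj g"
  shows "l1_le (\<lambda>i. a (g i)) A"
proof (rule l1_leI)
  fix F :: "'b set" assume F: "finite F"
  have "(\<Sum>i\<in>F. norm (a (g i))) = (\<Sum>i\<in>g ` F. norm (a i))"
    using assms(2) by (simp add: sum.reindex inj_on_subset[of g UNIV])
  then show "(\<Sum>i\<in>F. norm (a (g i))) \<le> A"
    using l1_leD[OF assms(1), of "g ` F"] F by simp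
qed

lemma l2_le_mult:
  assumes "l2_le a A" "l2_le b B"
  shows "l1_le (\<lambda>i. a i * b i) (A * B)"
proof (rule l1_leI)
  fix F :: "'a set" assume F: "finite F"
  have "(\<Sum>i\<in>F. norm (a i * b i)) \<le> L2_set (\<lambda>i. norm (a i)) F * L2_set (\<lambda>i. norm (b i)) F"
    using L2_set_mult_ineq[of "\<lambda>i. norm (a i)" "\<lambda>i. norm (b i)" F] by (simp add: norm_mult)
  also have "\<dots> \<le> A * B"
    using l2_leD[OF assms(1) F] l2_leD[OF assms(2) F] l2_le_nonneg[OF assms(1)]
    by (intro mult_mono) auto
  finally show "(\<Sum>i\<in>F. norm (a i * b i)) \<le> A * B" .
qed

lemma l1_le_imp_l2_le:
  assumes "l1_le a A"
  shows "l2_le a A"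
proof (rule l2_leI)
  fix F :: "'a set" assume F: "finite F"
  have "L2_set (\<lambda>i. norm (a i)) F \<le> (\<Sum>i\<in>F. norm (a i))"
    by (rule L2_set_le_sum) auto
  then show "L2_set (\<lambda>i. norm (a i)) F \<le> A"
    using l1_leD[OF assms F] by simp
qed

lemma l1_le_abs_summable:
  assumes "l1_le a A"
  shows "(\<lambda>i. norm (a i)) summable_on S"
proof -
  have "(\<lambda>i. norm (a i)) summable_on UNIV"
    by (rule nonneg_bdd_above_summable_on) (use assms in \<open>auto simp: l1_le_def bdd_above_def\<close>)
  then show ?thesis
    by (rule summable_on_subset_banach) auto
qed

lemma l1_le_infsum_norm:
  assumes "l1_le a A"
  shows "(\<Sum>\<^sub>\<infinity>i. norm (a i)) \<le> A"
  by (rule infsum_le_finite_sums[OF l1_le_abs_summable[OF assms]]) (rule l1_leD[OF assms])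

lemma l1_le_norm_infsum:
  assumes "l1_le a A"
  shows "norm (\<Sum>\<^sub>\<infinity>i. a i) \<le> A"
  using norm_infsum_bound[OF l1_le_abs_summable[OF assms, of UNIV]] l1_le_infsum_norm[OF assms] by linarith

lemma abs_summable_l1_le:
  assumes "(\<lambda>i. norm (a i)) summable_on UNIV"
  shows "l1_le a (\<Sum>\<^sub>\<infinity>i. norm (a i))"
  by (rule l1_leI) (use assms in \<open>auto intro!: finite_sum_le_infsum\<close>)

lemma l1_le_cmult:
  assumes "l1_le a A"
  shows "l1_le (\<lambda>i. c * a i) (norm c * A)"
proof (rule l1_leI)
  fix F :: "'a set" assume F: "finite F"
  have "(\<Sum>i\<in>F. norm (c * a i)) = norm c * (\<Sum>i\<in>F. norm (a i))"
    by (simp add: norm_mult sum_distrib_left)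
  then show "(\<Sum>i\<in>F. norm (c * a i)) \<le> norm c * A"
    using l1_leD[OF assms F] by (simp add: mult_left_mono)
qed

lemma l1_le_mult_bounded:
  assumes "l1_le a A" "\<And>i. norm (b i) \<le> B"
  shows "l1_le (\<lambda>i. a i * b i) (A * B)"
proof (rule l1_leI)
  fix F :: "'a set" assume F: "finite F"
  have "0 \<le> B" using assms(2) norm_ge_zero order_trans by blast
  have "(\<Sum>i\<in>F. norm (a i * b i)) \<le> (\<Sum>i\<in>F. norm (a i) * B)"
    unfolding norm_mult by (intro sum_mono mult_left_mono assms) auto
  also have "\<dots> \<le> A * B"
    unfolding sum_distrib_right[symmetric]
    by (intro mult_right_mono l1_leD[OF assms(1) F] \<open>0 \<le> B\<close>)
  finally show "(\<Sum>i\<in>F. norm (a i * b i)) \<le> A * B" .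
qed

text \<open>Minkowski's inequality for infinitely many columns: finitely many are added by the
  triangle inequality, and the bound survives the limit over finite sets of columns.\<close>

lemma l2_le_infsum:
  assumes sum: "\<And>m. (\<lambda>j. norm (t m j)) summable_on UNIV"
    and col: "\<And>j. l2_le (\<lambda>m. t m j) (c j)"
    and bd: "\<And>J. finite J \<Longrightarrow> (\<Sum>j\<in>J. c j) \<le> C"
  shows "l2_le (\<lambda>m. \<Sum>\<^sub>\<infinity>j. t m j) C"
\<comment> \<open>The default 0 for infinite \<open>J\<close> is there because
  \<open>l2_le_lim\<close> wants the bound at every index of the net, while the filter only sees
  finite sets.\<close>
proof (rule l2_le_lim[where a = "\<lambda>J m. if finite J then \<Sum>j\<in>J. t m j else 0" and F = "finite_subsets_at_top UNIV"])
  have *: "l2_le (\<lambda>m. \<Sum>j\<in>J. t m j) (\<Sum>j\<in>J. c j)" if "finite J" for J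
    using that
  proof (induction J)
    case empty
    show ?case by (simp add: l2_le_def L2_set_constant)
  next
    case (insert j J)
    then show ?case using l2_le_add[OF col[of j] insert.IH] by simp
  qed
  have C0: "0 \<le> C" using bd[of "{}"] by simp
  show "l2_le (\<lambda>m. if finite J then \<Sum>j\<in>J. t m j else 0) C" for J
  proof (cases "finite J")
    case True
    then show ?thesis using l2_le_mono[OF *[OF True] _ bd[OF True]] by simp
  next
    case False
    then show ?thesis using C0 by (simp add: l2_le_def L2_set_constant)
  qed
  fix m
  have "((\<lambda>J. \<Sum>j\<in>J. t m j) \<longlongrightarrow> (\<Sum>\<^sub>\<infinity>j. t m j)) (finite_subsets_at_top UNIV)"
    by (rule infsum_tendsto[OF abs_summable_summable[OF sum]])
  then show "((\<lambda>J. if finite J then \<Sum>j\<in>J. t m j else 0) \<longlongrightarrow> (\<Sum>\<^sub>\<infinity>j. t m j)) (finite_subsets_at_top UNIV)"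
    by (rule Lim_transform_eventually) (rule eventually_finite_subsets_at_top_weakI, simp)
qed simp

lemma inj_int_shift [simp]:
  "inj (\<lambda>j::int. m - j)" "inj (\<lambda>j::int. m + j)" "inj (\<lambda>j::int. j + m)" "inj (\<lambda>j::int. j - m)"
  "inj (\<lambda>j::int. - j)"
  by (auto intro: injI)

text \<open>Young's inequality for l1 * l2. A kernel dominated by the convolution kernel is enough,
  so that truncated and weighted kernels fall under it.\<close>

lemma
  fixes t :: "int \<Rightarrow> int \<Rightarrow> complex"
  assumes \<phi>: "l1_le \<phi> A" and a: "l2_le a B"
    and t: "\<And>m j. norm (t m j) \<le> norm (\<phi> (m - j)) * norm (a j)"
  shows young_l1_l2: "l2_le (\<lambda>m. \<Sum>\<^sub>\<infinity>j. t m j) (A * B)"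
    and young_l1_l2_summable: "(\<lambda>j. norm (t m j)) summable_on UNIV"
proof -
  have B: "0 \<le> B" using l2_le_nonneg[OF a] .
  have l1: "l1_le (\<lambda>j. t m j) (A * B)" for m
    by (rule l1_le_mono[OF l1_le_mult_bounded[OF l1_le_reindex[OF \<phi>, of "\<lambda>j. m - j"] l2_le_norm[OF a]]])
       (use t in \<open>auto simp: norm_mult\<close>)
  then show "(\<lambda>j. norm (t m j)) summable_on UNIV" by (rule l1_le_abs_summable)
  \<comment> \<open>Indexing by the difference i = m - j turns the sum into a superposition of
    translates of \<open>a\<close> with coefficients of size \<open>\<phi> i\<close>, to which
    Minkowski applies.\<close>
  have eq: "(\<Sum>\<^sub>\<infinity>j. t m j) = (\<Sum>\<^sub>\<infinity>i. t m (m - i))" for m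
    by (rule infsum_reindex_bij_betw[symmetric])
       (auto intro!: bij_betwI[of _ _ _ "\<lambda>i. m - i"])
  show "l2_le (\<lambda>m. \<Sum>\<^sub>\<infinity>j. t m j) (A * B)"
    unfolding eq
  proof (rule l2_le_infsum[where c = "\<lambda>i. norm (\<phi> i) * B"])
    fix m show "(\<lambda>i. norm (t m (m - i))) summable_on UNIV"
      by (rule l1_le_abs_summable[OF l1_le_reindex[OF l1]]) simp
  next
    fix i
    show "l2_le (\<lambda>m. t m (m - i)) (norm (\<phi> i) * B)"
      by (rule l2_le_mono[OF l2_le_cmult[OF l2_le_reindex[OF a, of "\<lambda>m. m - i"], of "\<phi> i"]])
         (use t in \<open>auto simp: norm_mult intro: order_trans[OF t]\<close>)
  next
    fix J :: "int set" assume "finite J"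
    then show "(\<Sum>i\<in>J. norm (\<phi> i) * B) \<le> A * B"
      unfolding sum_distrib_right[symmetric] using l1_leD[OF \<phi>] B by (intro mult_right_mono) auto
  qed
qed

text \<open>Here the columns are already dominated by translates of \<open>\<phi>\<close>, weighted
  by the summable sequence \<open>a\<close>, so Minkowski applies without reindexing.\<close>

lemma
  fixes t :: "int \<Rightarrow> int \<Rightarrow> complex"
  assumes \<phi>: "l2_le \<phi> A" and a: "l1_le a B"
    and t: "\<And>m j. norm (t m j) \<le> norm (\<phi> (m - j)) * norm (a j)"
  shows young_l2_l1: "l2_le (\<lambda>m. \<Sum>\<^sub>\<infinity>j. t m j) (A * B)"
    and young_l2_l1_summable: "(\<lambda>j. norm (t m j)) summable_on UNIV"
proof -
  have A: "0 \<le> A" using l2_le_nonneg[OF \<phi>] .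
  have l1: "l1_le (\<lambda>j. t m j) (B * A)" for m
    by (rule l1_le_mono[OF l1_le_mult_bounded[OF a, of "\<lambda>j. \<phi> (m - j)"]])
       (use t l2_le_norm[OF \<phi>] in \<open>auto simp: norm_mult mult.commute\<close>)
  then show "(\<lambda>j. norm (t m j)) summable_on UNIV" by (rule l1_le_abs_summable)
  show "l2_le (\<lambda>m. \<Sum>\<^sub>\<infinity>j. t m j) (A * B)"
  proof (rule l2_le_infsum[where c = "\<lambda>j. norm (a j) * A"])
    fix m show "(\<lambda>j. norm (t m j)) summable_on UNIV"
      by (rule l1_le_abs_summable[OF l1])
  next
    fix j
    show "l2_le (\<lambda>m. t m j) (norm (a j) * A)"
      by (rule l2_le_mono[OF l2_le_cmult[OF l2_le_reindex[OF \<phi>, of "\<lambda>m. m - j"], of "a j"]])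
         (use t in \<open>auto simp: norm_mult mult.commute intro: order_trans[OF t]\<close>)
  next
    fix J :: "int set" assume "finite J"
    then have "(\<Sum>j\<in>J. norm (a j)) * A \<le> B * A"
      using l1_leD[OF a] A by (intro mult_right_mono) auto
    then show "(\<Sum>j\<in>J. norm (a j) * A) \<le> A * B"
      unfolding sum_distrib_right by (simp only: mult.commute)
  qed
qed

section \<open>Weights, their tails and an interpolation inequality\<close>

definition wt :: "int \<Rightarrow> real" where
  "wt m = 1 + \<bar>of_int m\<bar>"

lemma wt_ge_1: "1 \<le> wt m" and wt_pos [simp]: "0 < wt m" and wt_nonneg [simp]: "0 \<le> wt m"
  and wt_nz [simp]: "wt m \<noteq> 0"
  by (auto simp: wt_def)

lemma wt_add: "wt (m + n) \<le> wt m + wt n"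
  by (simp add: wt_def)

lemma wt_minus [simp]: "wt (- m) = wt m"
  by (simp add: wt_def)

definition sob :: "nat \<Rightarrow> (int \<Rightarrow> complex) \<Rightarrow> bool" where
  "sob k a \<longleftrightarrow> (\<exists>C. l2_le (\<lambda>m. of_real (wt m ^ k) * a m) C)"

text \<open>Comparison with a telescoping series. The subtracted last term makes the induction on
  \<open>p\<close> close; the 2 pays for the first summand, which is at most 1 / (1 + M).\<close>

lemma sum_inverse_squares:
  "(\<Sum>j = M..<Suc M + p. 1 / (1 + real j)\<^sup>2) \<le> 2 / (1 + real M) - 1 / (1 + real (M + p))"
proof (induction p)
  case 0
  have "1 / (1 + real M)\<^sup>2 \<le> 1 / (1 + real M)"
    by (simp add: power2_eq_square divide_simps)
  then show ?case by (simp add: field_simps)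
next
  case (Suc p)
  have "1 / (1 + real (Suc (M + p)))\<^sup>2 \<le> 1 / (1 + real (M + p)) - 1 / (1 + real (Suc (M + p)))"
    by (simp add: divide_simps power2_eq_square)
  with Suc.IH show ?case by simp
qed

text \<open>Both signs together contribute at most 4 / (1 + M) to the sum of squares, and the bound
  is the root of that.\<close>

lemma l2_le_wt_tail:
  "l2_le (\<lambda>m. of_real (if int M \<le> \<bar>m\<bar> then 1 / wt m else 0)) (2 / sqrt (1 + real M))"
proof (rule l2_leI)
  fix F :: "int set" assume F: "finite F"
  define h where "h = (\<lambda>m. (if int M \<le> \<bar>m\<bar> then 1 / wt m else 0)\<^sup>2)"
  obtain p where p: "F \<subseteq> {- int (M + p)..int (M + p)}"
  proof -
    have "bdd_above (abs ` F)" using F by simp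
    then obtain q where q: "\<And>m. m \<in> F \<Longrightarrow> \<bar>m\<bar> \<le> q" by (auto simp: bdd_above_def)
    have "F \<subseteq> {- int (M + nat q)..int (M + nat q)}"
    proof
      fix m assume "m \<in> F"
      with q have "\<bar>m\<bar> \<le> q" by blast
      then show "m \<in> {- int (M + nat q)..int (M + nat q)}" by simp arith
    qed
    then show ?thesis by (rule that)
  qed
  have eq: "h m = (if int M \<le> \<bar>m\<bar> then 1 / (1 + real (nat \<bar>m\<bar>))\<^sup>2 else 0)" for m
    by (simp add: h_def wt_def power_divide)
  have S: "sum h {m. int M \<le> \<bar>m\<bar> \<and> \<bar>m\<bar> \<le> int (M + p)} \<le> 2 * (\<Sum>j = M..<Suc M + p. 1 / (1 + real j)\<^sup>2)"
  proof -
    have "{m. int M \<le> \<bar>m\<bar> \<and> \<bar>m\<bar> \<le> int (M + p)} \<subseteq> int ` {M..<Suc M + p} \<union> (\<lambda>j. - int j) ` {M..<Suc M + p}"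
      (is "_ \<subseteq> ?A \<union> ?B")
    proof
      fix m assume m: "m \<in> {m. int M \<le> \<bar>m\<bar> \<and> \<bar>m\<bar> \<le> int (M + p)}"
      show "m \<in> ?A \<union> ?B"
      proof (cases "0 \<le> m")
        case True
        then have "m \<in> ?A" using m by (intro image_eqI[of _ _ "nat m"]) auto
        then show ?thesis by (rule UnI1)
      next
        case False
        then have "m \<in> ?B" using m by (intro image_eqI[of _ _ "nat (- m)"]) auto
        then show ?thesis by (rule UnI2)
      qed
    qed
    then have "sum h {m. int M \<le> \<bar>m\<bar> \<and> \<bar>m\<bar> \<le> int (M + p)} \<le> sum h (?A \<union> ?B)"
      by (intro sum_mono2) (auto simp: h_def)
    also have "\<dots> \<le> sum h ?A + sum h ?B"
      by (subst sum_Un) (auto simp: h_def intro!: sum_nonneg)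
    also have "\<dots> = (\<Sum>j = M..<Suc M + p. 1 / (1 + real j)\<^sup>2) + (\<Sum>j = M..<Suc M + p. 1 / (1 + real j)\<^sup>2)"
      by (intro arg_cong2[where f = "(+)"]; subst sum.reindex) (auto simp: eq inj_on_def intro!: sum.cong)
    finally show ?thesis by simp
  qed
  have "sum h F = sum h {m \<in> F. int M \<le> \<bar>m\<bar>}"
    using F by (intro sum.mono_neutral_right) (auto simp: h_def)
  also have "\<dots> \<le> sum h {m. int M \<le> \<bar>m\<bar> \<and> \<bar>m\<bar> \<le> int (M + p)}"
  proof (rule sum_mono2)
    show "finite {m. int M \<le> \<bar>m\<bar> \<and> \<bar>m\<bar> \<le> int (M + p)}"
      by (rule finite_subset[of _ "{- int (M + p)..int (M + p)}"]) auto
    show "{m \<in> F. int M \<le> \<bar>m\<bar>} \<subseteq> {m. int M \<le> \<bar>m\<bar> \<and> \<bar>m\<bar> \<le> int (M + p)}"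
      using p by (auto simp: subset_iff abs_le_iff dest!: bspec)
  qed (auto simp: h_def)
  also have "\<dots> \<le> 2 * (2 / (1 + real M))"
    using S sum_inverse_squares[of M p] by (smt (verit) divide_nonneg_nonneg of_nat_0_le_iff)
  finally have "sum h F \<le> (2 / sqrt (1 + real M))\<^sup>2"
    by (simp add: power_divide)
  then have "sqrt (sum h F) \<le> 2 / sqrt (1 + real M)"
    by (intro real_le_lsqrt sum_nonneg) (auto simp: h_def)
  then show "L2_set (\<lambda>m. norm (complex_of_real (if int M \<le> \<bar>m\<bar> then 1 / wt m else 0))) F \<le> 2 / sqrt (1 + real M)"
    by (simp add: L2_set_def h_def)
qed

text \<open>Cauchy-Schwarz against the tail of \<open>1 / wt\<close>. The gain of (1 + M)^(-1/2)
  drives both the absorption in \<open>solution_exists\<close> and the error terms for negative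
  n.\<close>

lemma l1_le_tail:
  assumes a: "l2_le (\<lambda>m. of_real (wt m) * a m) C"
    and supp: "\<And>m. \<bar>m\<bar> < int M \<Longrightarrow> a m = 0"
  shows "l1_le a (2 / sqrt (1 + real M) * C)"
proof (rule l1_le_mono[OF l2_le_mult[OF l2_le_wt_tail[of M] a]])
  fix m show "norm (a m) \<le> norm (complex_of_real (if int M \<le> \<bar>m\<bar> then 1 / wt m else 0) * (of_real (wt m) * a m))"
    using supp[of m] by (auto simp: norm_mult norm_divide)
qed simp

lemma l1_le_of_wt:
  assumes "l2_le (\<lambda>m. of_real (wt m) * a m) C"
  shows "l1_le a (2 * C)"
  using l1_le_tail[OF assms, of 0] by simp

text \<open>Cauchy-Schwarz against the indicator of the low frequencies, of which there are at most
  2 M + 1.\<close>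

lemma l1_le_head:
  assumes a: "l2_le a C"
  shows "l1_le (\<lambda>m::int. if \<bar>m\<bar> < int M then a m else 0) (sqrt (2 * real M + 1) * C)"
proof (rule l1_le_mono[OF l2_le_mult[OF _ a]])
  show "l2_le (\<lambda>m::int. if \<bar>m\<bar> < int M then 1 else 0) (sqrt (2 * real M + 1))"
  proof (rule l2_leI)
    fix F :: "int set" assume F: "finite F"
    have "(\<Sum>m\<in>F. (norm (if \<bar>m\<bar> < int M then 1 else 0 :: complex))\<^sup>2) = (\<Sum>m\<in>{m\<in>F. \<bar>m\<bar> < int M}. 1)"
      using F by (intro sum.mono_neutral_cong_right) auto
    also have "\<dots> = real (card {m\<in>F. \<bar>m\<bar> < int M})" by simp
    also have "\<dots> \<le> real (card {- int M..int M})"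
      by (intro of_nat_mono card_mono) auto
    also have "\<dots> = 2 * real M + 1" by simp
    finally show "L2_set (\<lambda>m. norm (if \<bar>m\<bar> < int M then 1 else 0 :: complex)) F \<le> sqrt (2 * real M + 1)"
      unfolding L2_set_def by (rule real_sqrt_le_mono)
  qed
qed auto

text \<open>Low frequencies are controlled by their number, high ones by the derivative. What
  matters is that the factor in front of \<open>D\<close> tends to 0 as \<open>M\<close> grows, at
  the price of a large factor in front of \<open>A\<close>.\<close>

lemma l1_le_interpolate:
  assumes a: "l2_le a A" and Da: "l2_le (\<lambda>m. of_int m * a m) D"
  shows "l1_le a (sqrt (2 * real M + 1) * A + 2 / sqrt (1 + real M) * (A + D))"
proof -
  let ?t = "\<lambda>m. if \<bar>m\<bar> < int M then 0 else a m"
  \<comment> \<open>The sign of \<open>m\<close> makes \<open>a m\<close> and \<open>m * a m\<close>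
    add up without cancellation to \<open>wt m * a m\<close>.\<close>
  have Da': "l2_le (\<lambda>m. (if m \<ge> 0 then 1 else - 1) * (of_int m * a m)) D"
    by (rule l2_le_mono[OF Da]) (auto simp: norm_mult)
  have "l2_le (\<lambda>m. of_real (wt m) * a m) (A + D)"
  proof (rule l2_le_mono[OF l2_le_add[OF a Da']])
    show "norm (of_real (wt m) * a m) \<le> norm (a m + (if m \<ge> 0 then 1 else - 1) * (of_int m * a m))" for m
      by (rule eq_refl, rule arg_cong[where f = norm]) (auto simp: wt_def algebra_simps)
  qed simp
  then have "l2_le (\<lambda>m. of_real (wt m) * ?t m) (A + D)"
    by (rule l2_le_mono) auto
  then have t: "l1_le ?t (2 / sqrt (1 + real M) * (A + D))"
    by (rule l1_le_tail) auto
  show ?thesis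
    by (rule l1_le_mono[OF l1_le_add[OF l1_le_head[OF a, of M] t]]) auto
qed

section \<open>Regularity of solutions of contractive equations with decaying kernels\<close>

definition kop :: "(int \<Rightarrow> int \<Rightarrow> complex) \<Rightarrow> (int \<Rightarrow> complex) \<Rightarrow> int \<Rightarrow> complex" where
  "kop G a m = (\<Sum>\<^sub>\<infinity>j. G m j * a j)"

definition contraction :: "(int \<Rightarrow> int \<Rightarrow> complex) \<Rightarrow> real \<Rightarrow> bool" where
  "contraction G \<kappa> \<longleftrightarrow> 0 \<le> \<kappa> \<and> \<kappa> < 1 \<and> (\<forall>a C. l2_le a C \<longrightarrow> l2_le (kop G a) (\<kappa> * C))"

lemma contractionD:
  assumes "contraction G \<kappa>"
  shows "0 \<le> \<kappa>" "\<kappa> < 1" "l2_le a C \<Longrightarrow> l2_le (kop G a) (\<kappa> * C)"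
  using assms by (auto simp: contraction_def)

text \<open>Absorption is legitimate because a finite bound is known beforehand: then a least bound
  exists, namely \<open>Sup S\<close>, and the step applied to it gives Sup S \<le> Y + \<kappa> *
  Sup S.\<close>

lemma l2_le_absorb:
  assumes a: "l2_le a C\<^sub>0" and \<kappa>: "0 \<le> \<kappa>" "\<kappa> < 1"
    and step: "\<And>C. l2_le a C \<Longrightarrow> l2_le a (Y + \<kappa> * C)"
  shows "l2_le a (Y / (1 - \<kappa>))"
proof -
  define S where "S = (\<lambda>F. L2_set (\<lambda>i. norm (a i)) F) ` {F. finite F}"
  have bdd: "bdd_above S" and ne: "S \<noteq> {}"
    using a by (auto simp: S_def l2_le_def bdd_above_def)
  have "l2_le a (Sup S)"
    by (rule l2_leI, rule cSup_upper[OF _ bdd]) (auto simp: S_def)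
  then have "l2_le a (Y + \<kappa> * Sup S)" by (rule step)
  then have "Sup S \<le> Y + \<kappa> * Sup S"
    by (intro cSup_least[OF ne]) (auto simp: S_def l2_le_def)
  then have "Sup S \<le> Y / (1 - \<kappa>)"
    using \<kappa> by (simp add: field_simps)
  then show ?thesis using \<open>l2_le a (Sup S)\<close> by (rule l2_le_mono[rotated 2]) simp
qed

lemma contraction_bound:
  assumes G: "contraction G \<kappa>" and a: "l2_le a C" and y: "l2_le y Y"
    and eq: "\<And>m. a m = y m + kop G a m"
  shows "l2_le a (Y / (1 - \<kappa>))"
proof (rule l2_le_absorb[OF a contractionD(1,2)[OF G]])
  fix C assume "l2_le a C"
  then have "l2_le (\<lambda>m. y m + kop G a m) (Y + \<kappa> * C)"
    by (intro l2_le_add y contractionD(3)[OF G])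
  then show "l2_le a (Y + \<kappa> * C)" by (simp only: eq[symmetric])
qed

lemma l2_le_zero: "l2_le (\<lambda>_. 0) 0"
  by (simp add: l2_le_def L2_set_constant)

lemma norm_of_int_le_wt: "norm (of_int m :: complex) \<le> norm (of_real (wt m) :: complex)"
  by (simp only: norm_of_int norm_of_real) (simp add: wt_def)

text \<open>Domination by a convolution kernel rather than equality with one: the kernels used later
  are cut to blocks of frequencies, and the decay in \<open>m - j\<close> survives that.\<close>

locale decaying_kernel =
  fixes G :: "int \<Rightarrow> int \<Rightarrow> complex" and \<beta> :: "int \<Rightarrow> complex" and B :: real
  assumes dom: "norm (G m j) \<le> norm (\<beta> (m - j))"
    and \<beta>: "l2_le (\<lambda>m. of_real (wt m) * \<beta> m) B"
begin

lemma \<beta>_l1: "l1_le \<beta> (2 * B)"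
  using \<beta> by (rule l1_le_of_wt)

lemma summable:
  assumes "l2_le a A"
  shows "(\<lambda>j. norm (G m j * a j)) summable_on UNIV" "(\<lambda>j. G m j * a j) summable_on UNIV"
proof -
  show *: "(\<lambda>j. norm (G m j * a j)) summable_on UNIV"
    by (rule young_l1_l2_summable[OF \<beta>_l1 assms]) (auto simp: norm_mult intro!: mult_right_mono dom)
  show "(\<lambda>j. G m j * a j) summable_on UNIV"
    by (rule abs_summable_summable[OF *])
qed

lemma kop_diff:
  assumes "l2_le a A" "l2_le b A'"
  shows "kop G (\<lambda>j. a j - b j) m = kop G a m - kop G b m"
proof -
  have "kop G (\<lambda>j. a j - b j) m = (\<Sum>\<^sub>\<infinity>j. G m j * a j + (- 1) * (G m j * b j))"
    unfolding kop_def by (rule infsum_cong) (simp add: algebra_simps)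
  also have "\<dots> = kop G a m + (\<Sum>\<^sub>\<infinity>j. (- 1) * (G m j * b j))"
    unfolding kop_def
    by (intro infsum_add summable_on_cmult_right summable(2)[OF assms(1)] summable(2)[OF assms(2)])
  also have "(\<Sum>\<^sub>\<infinity>j. (- 1) * (G m j * b j)) = (- 1) * kop G b m"
    unfolding kop_def by (rule infsum_cmult_right')
  finally show ?thesis by simp
qed

text \<open>
  The commutator of the kernel with multiplication by \<open>m\<close> has the kernel \<open>(m - j) G m j\<close>,
  which maps summable sequences to square summable ones.
\<close>

lemma kop_derivation:
  assumes a: "l2_le a A" and Da: "l2_le (\<lambda>m. of_int m * a m) D" and a1: "l1_le a A1"
  shows "of_int m * kop G a m = kop G (\<lambda>j. of_int j * a j) m + (\<Sum>\<^sub>\<infinity>j. of_int (m - j) * G m j * a j)"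
    and "l2_le (\<lambda>m. \<Sum>\<^sub>\<infinity>j. of_int (m - j) * G m j * a j) (B * A1)"
proof -
  have dom': "norm (of_int (m - j) * G m j * a j) \<le> norm (of_real (wt (m - j)) * \<beta> (m - j)) * norm (a j)" for m j
    unfolding norm_mult by (intro mult_mono dom mult_nonneg_nonneg norm_of_int_le_wt) auto
  show "l2_le (\<lambda>m. \<Sum>\<^sub>\<infinity>j. of_int (m - j) * G m j * a j) (B * A1)"
    by (rule young_l2_l1[OF \<beta> a1 dom'])
  have s: "(\<lambda>j. of_int (m - j) * G m j * a j) summable_on UNIV"
    by (rule abs_summable_summable, rule young_l2_l1_summable[OF \<beta> a1 dom'])
  have "of_int m * kop G a m = (\<Sum>\<^sub>\<infinity>j. of_int m * (G m j * a j))"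
    unfolding kop_def by (rule infsum_cmult_right'[symmetric])
  also have "\<dots> = (\<Sum>\<^sub>\<infinity>j. G m j * (of_int j * a j) + of_int (m - j) * G m j * a j)"
    by (rule infsum_cong) (simp add: algebra_simps)
  also have "\<dots> = kop G (\<lambda>j. of_int j * a j) m + (\<Sum>\<^sub>\<infinity>j. of_int (m - j) * G m j * a j)"
    unfolding kop_def by (rule infsum_add[OF summable(2)[OF Da] s])
  finally show "of_int m * kop G a m = kop G (\<lambda>j. of_int j * a j) m + (\<Sum>\<^sub>\<infinity>j. of_int (m - j) * G m j * a j)" .
qed

text \<open>Picard iteration from 0. The iterates converge geometrically in l2; the H^1 bound is
  shown uniformly along the iteration and inherited by the limit. Uniformity comes from
  differentiating the recursion and bounding the l1 norm in the commutator term by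
  interpolation.\<close>

lemma solution_exists:
  assumes G: "contraction G \<kappa>" and y: "l2_le (\<lambda>m. of_real (wt m) * y m) Y"
  obtains a C where "l2_le (\<lambda>m. of_real (wt m) * a m) C" "\<And>m. a m = y m + kop G a m"
proof -
  note \<kappa> = contractionD(1,2)[OF G]
  have Y: "0 \<le> Y" and B: "0 \<le> B" using y \<beta> by (auto dest: l2_le_nonneg)
  have y2: "l2_le y Y"
    by (rule l2_le_mono[OF y]) (auto simp: norm_mult mult_le_cancel_right1 wt_ge_1)
  have Dy: "l2_le (\<lambda>m. of_int m * y m) Y"
    by (rule l2_le_mono[OF y]) (simp_all only: norm_mult mult_right_mono norm_of_int_le_wt norm_ge_zero order_refl)
  define it where "it n = ((\<lambda>a m. y m + kop G a m) ^^ n) (\<lambda>_. 0)" for n :: nat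
  have it0: "it 0 m = 0" and itS: "it (Suc n) m = y m + kop G (it n) m" for n m
    by (simp_all add: it_def)
  define A where "A = Y / (1 - \<kappa>)"
  have A: "0 \<le> A" using Y \<kappa> by (simp add: A_def)
  \<comment> \<open>\<open>A\<close> is the fixed point of C |-> Y + \<kappa> * C, so the bound
    reproduces itself along the iteration.\<close>
  have YA: "Y + \<kappa> * A = A" using \<kappa> by (simp add: A_def field_simps)
  have itA: "l2_le (it n) A" for n
  proof (induction n)
    case 0
    show ?case by (rule l2_le_mono[OF l2_le_zero _ A]) (simp add: it0)
  next
    case (Suc n)
    have "l2_le (\<lambda>m. y m + kop G (it n) m) (Y + \<kappa> * A)"
      by (intro l2_le_add y2 contractionD(3)[OF G] Suc.IH)
    then show ?case by (simp only: YA itS[symmetric])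
  qed
  \<comment> \<open>\<open>M\<close> is so large that the commutator uses up at most half of the gap
    \<open>1 - \<kappa>\<close>.\<close>
  obtain M :: nat where M: "B * (2 / sqrt (1 + real M)) \<le> (1 - \<kappa>) / 2"
  proof -
    have "((\<lambda>M. B * (2 / sqrt (1 + real M))) \<longlonglongrightarrow> 0)"
      by real_asymp
    then have "\<forall>\<^sub>F M in sequentially. B * (2 / sqrt (1 + real M)) < (1 - \<kappa>) / 2"
      using \<kappa> by (intro order_tendstoD) auto
    then show ?thesis using that by (auto simp: eventually_sequentially intro: less_imp_le)
  qed
  define s where "s = sqrt (2 * real M + 1)"
  \<comment> \<open>\<open>Z\<close> bounds everything in the differentiated recursion that does not
    involve \<open>E\<close>. The other half of the gap pays for it, as (1 - \<kappa>) / 2 * E =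
    Z.\<close>
  define Z where "Z = Y + B * (s * A) + A"
  define E where "E = Z * (2 / (1 - \<kappa>))"
  have E: "0 \<le> E" unfolding E_def Z_def s_def using Y B A \<kappa> by (intro mult_nonneg_nonneg) auto
  have itE: "l2_le (\<lambda>m. of_int m * it n m) E" for n
  proof (induction n)
    case 0
    show ?case by (rule l2_le_mono[OF l2_le_zero _ E]) (simp add: it0)
  next
    case (Suc n)
    note l1 = l1_le_interpolate[OF itA[of n] Suc.IH, of M]
    have "l2_le (\<lambda>m. of_int m * y m + (kop G (\<lambda>j. of_int j * it n j) m + (\<Sum>\<^sub>\<infinity>j. of_int (m - j) * G m j * it n j)))
       (Y + (\<kappa> * E + B * (sqrt (2 * real M + 1) * A + 2 / sqrt (1 + real M) * (A + E))))"
      by (intro l2_le_add Dy contractionD(3)[OF G] Suc.IH kop_derivation(2)[OF itA Suc.IH l1])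
    moreover have "of_int m * it (Suc n) m =
        of_int m * y m + (kop G (\<lambda>j. of_int j * it n j) m + (\<Sum>\<^sub>\<infinity>j. of_int (m - j) * G m j * it n j))" for m
      unfolding itS distrib_left using kop_derivation(1)[OF itA Suc.IH l1] by simp
    moreover have "Y + (\<kappa> * E + B * (sqrt (2 * real M + 1) * A + 2 / sqrt (1 + real M) * (A + E))) \<le> E"
    proof -
      have "B * (2 / sqrt (1 + real M)) * (A + E) \<le> (1 - \<kappa>) / 2 * (A + E)"
        using M A E by (intro mult_right_mono) auto
      also have "\<dots> \<le> A + (1 - \<kappa>) / 2 * E"
        using A \<kappa> mult_right_mono[of "(1 - \<kappa>) / 2" 1 A] by (simp add: distrib_left)
      finally have "B * (2 / sqrt (1 + real M)) * (A + E) \<le> A + (1 - \<kappa>) / 2 * E" .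
      moreover have "(1 - \<kappa>) / 2 * E = Z"
        using \<kappa> by (simp add: E_def)
      moreover have "\<kappa> * E + (1 - \<kappa>) / 2 * E + (1 - \<kappa>) / 2 * E = E"
        by (simp add: field_simps)
      moreover have "Y + (\<kappa> * E + B * (s * A + 2 / sqrt (1 + real M) * (A + E))) =
          Z - A + \<kappa> * E + B * (2 / sqrt (1 + real M)) * (A + E)"
        by (simp only: distrib_left[of B] mult.assoc Z_def)
      ultimately show ?thesis
        unfolding s_def[symmetric] by linarith
    qed
    ultimately show ?case by (auto intro: l2_le_mono)
  qed
  \<comment> \<open>\<open>it 0\<close> vanishes, so the differences start below \<open>A\<close>
    and shrink by the factor \<kappa> at each step, uniformly in \<open>p\<close>.\<close>
  have diff: "l2_le (\<lambda>m. it (n + p) m - it n m) (\<kappa> ^ n * A)" for n p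
  proof (induction n)
    case 0
    show ?case using itA[of p] it0 by simp
  next
    case (Suc n)
    have "l2_le (kop G (\<lambda>m. it (n + p) m - it n m)) (\<kappa> * (\<kappa> ^ n * A))"
      by (intro contractionD(3)[OF G] Suc.IH)
    moreover have "kop G (\<lambda>m. it (n + p) m - it n m) m = it (Suc n + p) m - it (Suc n) m" for m
      using kop_diff[OF itA itA] itS by simp
    then have "kop G (\<lambda>m. it (n + p) m - it n m) = (\<lambda>m. it (Suc n + p) m - it (Suc n) m)" ..
    ultimately show ?case by (simp add: mult.assoc)
  qed
  have pow: "(\<lambda>n. \<kappa> ^ n * A) \<longlonglongrightarrow> 0"
    using \<kappa> by (intro tendsto_mult_left_zero LIMSEQ_power_zero) auto
  have "Cauchy (\<lambda>n. it n m)" for m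
  proof (rule CauchyI)
    fix e :: real assume "0 < e"
    then have "\<forall>\<^sub>F n in sequentially. \<kappa> ^ n * A < e / 2"
      using pow by (intro order_tendstoD) auto
    then obtain N where N: "\<kappa> ^ N * A < e / 2" by (auto simp: eventually_sequentially)
    have *: "norm (it n m - it N m) < e / 2" if "N \<le> n" for n
      using l2_le_norm[OF diff[of N "n - N"], of m] N that by simp
    show "\<exists>N. \<forall>n\<ge>N. \<forall>n'\<ge>N. norm (it n m - it n' m) < e"
    proof (intro exI allI impI)
      fix n n' assume "N \<le> n" "N \<le> n'"
      then show "norm (it n m - it n' m) < e"
        using norm_triangle_ineq4[of "it n m - it N m" "it n' m - it N m"] *[of n] *[of n'] by simp
    qed
  qed
  then have "\<exists>x. (\<lambda>n. it n m) \<longlonglongrightarrow> x" for m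
    by (simp add: Cauchy_convergent_iff convergent_def)
  then obtain a where lim: "\<And>m. (\<lambda>n. it n m) \<longlonglongrightarrow> a m" by metis
  have a2: "l2_le a A" by (rule l2_le_lim[OF itA lim]) simp
  \<comment> \<open>No convergence in H^1 is claimed: pointwise limits preserve the uniform
    bound.\<close>
  have Da: "l2_le (\<lambda>m. of_int m * a m) E"
    by (rule l2_le_lim[OF itE]) (auto intro!: tendsto_intros lim)
  have err: "l2_le (\<lambda>m. a m - it n m) (\<kappa> ^ n * A)" for n
    by (rule l2_le_lim[OF diff[of n], where F = sequentially])
       (auto intro!: tendsto_intros LIMSEQ_ignore_initial_segment[OF lim] simp: add.commute[of n])
  have eq: "a m = y m + kop G a m" for m
  proof -
    have lim0: "(\<lambda>n. \<kappa> * (\<kappa> ^ n * A)) \<longlonglongrightarrow> 0"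
      by (rule tendsto_mult_right_zero[OF pow])
    have "norm (kop G a m - kop G (it n) m) \<le> \<kappa> * (\<kappa> ^ n * A)" for n
      using l2_le_norm[OF contractionD(3)[OF G err[of n]], of m] kop_diff[OF a2 itA] by simp
    then have "(\<lambda>n. kop G a m - kop G (it n) m) \<longlonglongrightarrow> 0"
      by (intro Lim_null_comparison[OF always_eventually lim0]) blast
    then have "(\<lambda>n. kop G (it n) m) \<longlonglongrightarrow> kop G a m"
      using tendsto_diff[OF tendsto_const[of "kop G a m"], of "\<lambda>n. kop G a m - kop G (it n) m" 0 sequentially] by simp
    then have "(\<lambda>n. it (Suc n) m) \<longlonglongrightarrow> y m + kop G a m"
      unfolding itS by (intro tendsto_intros)
    moreover have "(\<lambda>n. it (Suc n) m) \<longlonglongrightarrow> a m"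
      using lim by (rule LIMSEQ_Suc)
    ultimately show ?thesis by (rule LIMSEQ_unique[symmetric])
  qed
  have Da': "l2_le (\<lambda>m. (if m \<ge> 0 then 1 else - 1) * (of_int m * a m)) E"
    by (rule l2_le_mono[OF Da]) (auto simp: norm_mult)
  have "l2_le (\<lambda>m. of_real (wt m) * a m) (A + E)"
  proof (rule l2_le_mono[OF l2_le_add[OF a2 Da']])
    show "norm (of_real (wt m) * a m) \<le> norm (a m + (if m \<ge> 0 then 1 else - 1) * (of_int m * a m))" for m
      by (rule eq_refl, rule arg_cong[where f = norm]) (auto simp: wt_def algebra_simps)
  qed simp
  then show ?thesis using eq by (rule that)
qed

end

section \<open>Weighted sequence spaces\<close>

definition conv :: "(int \<Rightarrow> complex) \<Rightarrow> (int \<Rightarrow> complex) \<Rightarrow> int \<Rightarrow> complex" where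
  "conv \<phi> a m = (\<Sum>\<^sub>\<infinity>j. \<phi> (m - j) * a j)"

lemma kop_conv: "kop (\<lambda>m j. \<phi> (m - j)) a = conv \<phi> a"
  by (simp add: kop_def conv_def fun_eq_iff)

lemma conv_summable:
  fixes a :: "int \<Rightarrow> complex"
  assumes "l1_le \<phi> A" "l2_le a B"
  shows "(\<lambda>j. \<phi> (m - j) * a j) summable_on UNIV"
  by (rule abs_summable_summable, rule young_l1_l2_summable[OF assms]) (simp add: norm_mult)

lemma norm_wt_power [simp]: "norm (of_real (wt m) ^ k :: complex) = wt m ^ k"
  by (simp add: norm_power)

lemma sob_mono_norm:
  assumes "sob k b" "\<And>m. norm (a m) \<le> norm (b m)"
  shows "sob k a"
proof -
  obtain C where "l2_le (\<lambda>m. of_real (wt m ^ k) * b m) C" using assms(1) by (auto simp: sob_def)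
  then have "l2_le (\<lambda>m. of_real (wt m ^ k) * a m) C"
    by (rule l2_le_mono) (auto simp: norm_mult intro!: mult_left_mono assms)
  then show ?thesis by (auto simp: sob_def)
qed

lemma sob_mono:
  assumes "sob k a" "j \<le> k"
  shows "sob j a"
proof -
  obtain C where "l2_le (\<lambda>m. of_real (wt m ^ k) * a m) C" using assms(1) by (auto simp: sob_def)
  then have "l2_le (\<lambda>m. of_real (wt m ^ j) * a m) C"
    by (rule l2_le_mono) (auto simp: norm_mult intro!: mult_right_mono power_increasing assms wt_ge_1)
  then show ?thesis by (auto simp: sob_def)
qed

lemma sob_add:
  assumes "sob k a" "sob k b"
  shows "sob k (\<lambda>m. a m + b m)"
proof -
  obtain A B where "l2_le (\<lambda>m. of_real (wt m ^ k) * a m) A" "l2_le (\<lambda>m. of_real (wt m ^ k) * b m) B"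
    using assms by (auto simp: sob_def)
  from l2_le_add[OF this] show ?thesis
    unfolding sob_def by (auto simp: distrib_left)
qed

lemma sob_cmult:
  assumes "sob k a"
  shows "sob k (\<lambda>m. c * a m)"
proof -
  obtain A where "l2_le (\<lambda>m. of_real (wt m ^ k) * a m) A"
    using assms by (auto simp: sob_def)
  from l2_le_cmult[OF this, of c] show ?thesis
    unfolding sob_def by (auto simp: mult.left_commute)
qed

text \<open>These are the coefficients of the conjugate function, see \<open>fc_cnj\<close>.\<close>

lemma sob_reflect:
  assumes "sob k a"
  shows "sob k (\<lambda>m. cnj (a (- m)))"
proof -
  obtain A where A: "l2_le (\<lambda>m. of_real (wt m ^ k) * a m) A"
    using assms by (auto simp: sob_def)
  have "l2_le (\<lambda>m. of_real (wt (- m) ^ k) * a (- m)) A"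
    by (rule l2_le_reindex[OF A]) simp
  then have "l2_le (\<lambda>m. of_real (wt m ^ k) * cnj (a (- m))) A"
    by (rule l2_le_mono) (auto simp: norm_mult)
  then show ?thesis by (auto simp: sob_def)
qed

lemma sob_finite_support:
  assumes "finite S" "\<And>m. m \<notin> S \<Longrightarrow> a m = 0"
  shows "sob k a"
proof -
  have "l2_le (\<lambda>m. of_real (wt m ^ k) * a m) (\<Sum>m\<in>S. norm (of_real (wt m ^ k) * a m))"
  proof (rule l1_le_imp_l2_le, rule l1_leI)
    fix F :: "int set" assume F: "finite F"
    have "(\<Sum>m\<in>F. norm (of_real (wt m ^ k) * a m)) = (\<Sum>m\<in>F \<inter> S. norm (of_real (wt m ^ k) * a m))"
      by (rule sum.mono_neutral_right) (use F assms(2) in auto)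
    also have "\<dots> \<le> (\<Sum>m\<in>S. norm (of_real (wt m ^ k) * a m))"
      by (rule sum_mono2) (use assms(1) in auto)
    finally show "(\<Sum>m\<in>F. norm (of_real (wt m ^ k) * a m)) \<le> (\<Sum>m\<in>S. norm (of_real (wt m ^ k) * a m))" .
  qed
  then show ?thesis by (auto simp: sob_def)
qed

lemma sob_wt:
  assumes "sob k a" "1 \<le> k"
  obtains C where "l2_le (\<lambda>m. of_real (wt m) * a m) C"
  using sob_mono[OF assms] by (auto simp: sob_def)

lemma sob_1I: "l2_le (\<lambda>m. of_real (wt m) * a m) C \<Longrightarrow> sob 1 a"
  by (auto simp: sob_def)

lemma sob_l1:
  assumes "sob k a" "1 \<le> k"
  obtains C where "l1_le a C"
  using sob_wt[OF assms] l1_le_of_wt by metis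

lemma sob_l2:
  assumes "sob k a"
  obtains C where "l2_le a C"
  using sob_mono[OF assms, of 0] by (auto simp: sob_def)

text \<open>H^k is an algebra for k \<ge> 1: the larger of \<open>wt (m - j)\<close> and
  \<open>wt j\<close> is at least \<open>wt m / 2\<close> and takes the whole weight; the other
  factor then only has to be summable, which H^1 provides.\<close>

lemma sob_conv:
  assumes "sob k \<phi>" "sob k a" "1 \<le> k"
  shows "sob k (conv \<phi> a)"
proof -
  obtain A where A: "l2_le (\<lambda>m. of_real (wt m ^ k) * \<phi> m) A"
    using assms by (auto simp: sob_def)
  obtain B where B: "l2_le (\<lambda>m. of_real (wt m ^ k) * a m) B"
    using assms by (auto simp: sob_def)
  obtain A1 B1 where A1: "l1_le \<phi> A1" and B1: "l1_le a B1"
    using sob_l1[OF assms(1,3)] sob_l1[OF assms(2,3)] by metis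
  define t where "t m j = complex_of_real ((wt m / 2) ^ k) * (\<phi> (m - j) * a j)" for m j
  define t1 where "t1 m j = (if wt j \<le> wt (m - j) then t m j else 0)" for m j
  define t2 where "t2 m j = (if wt j \<le> wt (m - j) then 0 else t m j)" for m j
  have w: "(wt m / 2) ^ k \<le> wt (m - j) ^ k" if "wt j \<le> wt (m - j)" for m j
    using wt_add[of "m - j" j] that by (intro power_mono) auto
  have w': "(wt m / 2) ^ k \<le> wt j ^ k" if "\<not> wt j \<le> wt (m - j)" for m j
    using wt_add[of "m - j" j] that by (intro power_mono) auto
  have n: "norm (t m j) = (wt m / 2) ^ k * norm (\<phi> (m - j)) * norm (a j)" for m j
    by (simp add: t_def norm_mult norm_power norm_divide)
  have t1: "norm (t1 m j) \<le> norm (of_real (wt (m - j) ^ k) * \<phi> (m - j)) * norm (a j)" for m j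
    using w[of j m] by (auto simp: t1_def n norm_mult intro!: mult_right_mono)
  have t2: "norm (t2 m j) \<le> norm (\<phi> (m - j)) * norm (of_real (wt j ^ k) * a j)" for m j
    using mult_right_mono[OF w'[of j m], of "norm (\<phi> (m - j)) * norm (a j)"]
    by (auto simp: t2_def n norm_mult mult_ac)
  have s1: "t1 m summable_on UNIV" for m
    by (rule abs_summable_summable, rule young_l2_l1_summable[OF A B1 t1])
  have s2: "t2 m summable_on UNIV" for m
    by (rule abs_summable_summable, rule young_l1_l2_summable[OF A1 B t2])
  have eq: "of_real (wt m ^ k) * conv \<phi> a m = 2 ^ k * ((\<Sum>\<^sub>\<infinity>j. t1 m j) + (\<Sum>\<^sub>\<infinity>j. t2 m j))" for m
  proof -
    have "(\<Sum>\<^sub>\<infinity>j. t1 m j) + (\<Sum>\<^sub>\<infinity>j. t2 m j) = (\<Sum>\<^sub>\<infinity>j. t1 m j + t2 m j)"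
      by (rule infsum_add[OF s1 s2, symmetric])
    also have "\<dots> = (\<Sum>\<^sub>\<infinity>j. t m j)"
      by (rule infsum_cong) (simp add: t1_def t2_def)
    also have "\<dots> = of_real ((wt m / 2) ^ k) * conv \<phi> a m"
      unfolding t_def conv_def by (rule infsum_cmult_right')
    finally show ?thesis by (simp add: power_divide)
  qed
  show ?thesis
    unfolding sob_def eq
    using l2_le_cmult[OF l2_le_add[OF young_l2_l1[OF A B1 t1] young_l1_l2[OF A1 B t2]]] by blast
qed

lemma sob_SucI:
  assumes "sob k a" "sob k (\<lambda>m. of_int m * a m)"
  shows "sob (Suc k) a"
proof -
  have "sob k (\<lambda>m. (if m \<ge> 0 then 1 else - 1) * (of_int m * a m))"
    by (rule sob_mono_norm[OF assms(2)]) (auto simp: norm_mult)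
  from sob_add[OF assms(1) this] obtain C where
    "l2_le (\<lambda>m. of_real (wt m ^ k) * (a m + (if m \<ge> 0 then 1 else - 1) * (of_int m * a m))) C"
    by (auto simp: sob_def)
  moreover have eq: "of_real (wt m ^ k) * (a m + (if m \<ge> 0 then 1 else - 1) * (of_int m * a m)) =
      of_real (wt m ^ Suc k) * a m" for m
    by (auto simp: wt_def algebra_simps)
  ultimately show ?thesis unfolding sob_def by (auto simp only: eq)
qed

lemma sob_SucD:
  assumes "sob (Suc k) a"
  shows "sob k (\<lambda>m. of_int m * a m)"
proof -
  obtain C where C: "l2_le (\<lambda>m. of_real (wt m ^ Suc k) * a m) C"
    using assms by (auto simp: sob_def)
  have "l2_le (\<lambda>m. of_real (wt m ^ k) * (of_int m * a m)) C"
  proof (rule l2_le_mono[OF C])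
    fix m
    have "norm (of_int m :: complex) * norm (of_real (wt m ^ k) * a m) \<le>
        norm (of_real (wt m) :: complex) * norm (of_real (wt m ^ k) * a m)"
      by (intro mult_right_mono norm_of_int_le_wt) auto
    then show "norm (of_real (wt m ^ k) * (of_int m * a m)) \<le> norm (of_real (wt m ^ Suc k) * a m)"
      unfolding norm_mult[symmetric] by (simp add: mult_ac)
  qed simp
  then show ?thesis by (auto simp: sob_def)
qed

lemma l2_le_weighted_tail:
  assumes "l2_le (\<lambda>m. of_real (wt m ^ k) * a m) C" "\<And>m. \<bar>m\<bar> < int M \<Longrightarrow> a m = 0"
  shows "l2_le a (C / (1 + real M) ^ k)"
proof -
  have "l2_le a (norm (complex_of_real (1 / (1 + real M) ^ k)) * C)"
  proof (rule l2_le_mono[OF l2_le_cmult[OF assms(1)]])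
    fix m
    show "norm (a m) \<le> norm (complex_of_real (1 / (1 + real M) ^ k) * (of_real (wt m ^ k) * a m))"
    proof (cases "\<bar>m\<bar> < int M")
      case True
      then show ?thesis using assms(2) by simp
    next
      case False
      then have "(1 + real M) ^ k \<le> wt m ^ k" by (intro power_mono) (auto simp: wt_def)
      then have "norm (a m) * (1 + real M) ^ k \<le> norm (a m) * wt m ^ k"
        by (intro mult_left_mono) auto
      then show ?thesis
        by (simp add: norm_mult norm_divide norm_power pos_le_divide_eq mult.commute del: of_real_add)
    qed
  qed simp
  then show ?thesis by (simp add: norm_divide norm_power del: of_real_add)
qed

text \<open>For i, j \<ge> 0 one has wt i \<le> wt (i + j), so the whole weight can be moved onto
  \<open>s\<close> and \<open>A\<close> only has to be summable. This is why auxiliary solutions in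
  H^1 are good enough to produce leading terms in H^k.\<close>

lemma sob_half_line_correlation:
  assumes A: "l1_le A A1" and supp: "\<And>j. j < 0 \<Longrightarrow> A j = 0" and s: "sob k s"
  shows "sob k (\<lambda>i. if 0 \<le> i then \<Sum>\<^sub>\<infinity>j. A j * s (i + j) else 0)"
proof -
  obtain C where C: "l2_le (\<lambda>m. of_real (wt m ^ k) * s m) C" using s by (auto simp: sob_def)
  define t where "t i j = (if 0 \<le> i then complex_of_real (wt i ^ k) * (A j * s (i + j)) else 0)" for i j
  have t: "norm (t i j) \<le> norm (A j * (of_real (wt (i + j) ^ k) * s (i + j)))" for i j
  proof (cases "0 \<le> i \<and> 0 \<le> j")
    case True
    then have "wt i ^ k \<le> wt (i + j) ^ k" by (intro power_mono) (auto simp: wt_def)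
    then have "wt i ^ k * (norm (A j) * norm (s (i + j))) \<le> wt (i + j) ^ k * (norm (A j) * norm (s (i + j)))"
      by (rule mult_right_mono) auto
    then show ?thesis using True by (simp add: t_def norm_mult mult_ac)
  next
    case False
    then show ?thesis using supp[of j] by (auto simp: t_def)
  qed
  have C0: "0 \<le> C" using C by (rule l2_le_nonneg)
  have "l2_le (\<lambda>i. \<Sum>\<^sub>\<infinity>j. t i j) (A1 * C)"
  proof (rule l2_le_infsum[where c = "\<lambda>j. norm (A j) * C"])
    fix i
    have "l1_le (t i) (A1 * C)"
      by (rule l1_le_mono[OF l1_le_mult_bounded[OF A, of "\<lambda>j. of_real (wt (i + j) ^ k) * s (i + j)"]])
         (use t l2_le_norm[OF C] in auto)
    then show "(\<lambda>j. norm (t i j)) summable_on UNIV" by (rule l1_le_abs_summable)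
  next
    fix j
    show "l2_le (\<lambda>i. t i j) (norm (A j) * C)"
      by (rule l2_le_mono[OF l2_le_cmult[OF l2_le_reindex[OF C, of "\<lambda>i. i + j"], of "A j"]]) (use t in auto)
  next
    fix J :: "int set" assume "finite J"
    then show "(\<Sum>j\<in>J. norm (A j) * C) \<le> A1 * C"
      unfolding sum_distrib_right[symmetric] using l1_leD[OF A] C0 by (intro mult_right_mono) auto
  qed
  moreover have "(\<Sum>\<^sub>\<infinity>j. t i j) = of_real (wt i ^ k) * (if 0 \<le> i then \<Sum>\<^sub>\<infinity>j. A j * s (i + j) else 0)" for i
    unfolding t_def by (cases "0 \<le> i") (simp_all only: if_True if_False infsum_cmult_right' infsum_0_simp mult_zero_right)
  ultimately show ?thesis by (auto simp: sob_def)
qed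

section \<open>Fourier coefficients\<close>

definition sq_int :: "(real \<Rightarrow> complex) \<Rightarrow> bool" where
  "sq_int f \<longleftrightarrow> f \<in> borel_measurable arc \<and> integrable arc (\<lambda>\<theta>. (norm (f \<theta>))\<^sup>2)"

definition bounded_meas :: "(real \<Rightarrow> complex) \<Rightarrow> real \<Rightarrow> bool" where
  "bounded_meas f B \<longleftrightarrow> f \<in> borel_measurable arc \<and> (\<forall>\<theta>. norm (f \<theta>) \<le> B)"

definition fc :: "(real \<Rightarrow> complex) \<Rightarrow> int \<Rightarrow> complex" where
  "fc f m = (LINT \<theta>|arc. f \<theta> * cis (- (of_int m * \<theta>))) / (2 * pi)"

definition nsq :: "(real \<Rightarrow> complex) \<Rightarrow> real" where
  "nsq f = (LINT \<theta>|arc. (norm (f \<theta>))\<^sup>2) / (2 * pi)"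

lemma finite_measure_arc: "finite_measure arc"
  by (rule finite_measure_lebesgue_on) simp

lemma measure_arc [simp]: "measure arc {- pi..pi} = 2 * pi"
  by (simp add: measure_restrict_space)

lemma integrable_const_arc [simp]: "integrable arc (\<lambda>_. c)"
  by (rule finite_measure.integrable_const[OF finite_measure_arc])

lemma cis_measurable [measurable, simp]: "(\<lambda>\<theta>. cis (a * \<theta>)) \<in> borel_measurable arc"
  by (intro continuous_imp_measurable_on_sets_lebesgue continuous_intros) auto

lemma cis_measurable' [measurable, simp]: "(\<lambda>\<theta>. cis (- (a * \<theta>))) \<in> borel_measurable arc"
  using cis_measurable[of "- a"] by simp

lemma integrable_bounded_mult:
  fixes f g :: "real \<Rightarrow> complex"
  assumes f: "integrable arc f" and g: "g \<in> borel_measurable arc" "\<And>\<theta>. norm (g \<theta>) \<le> B"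
  shows "integrable arc (\<lambda>\<theta>. g \<theta> * f \<theta>)"
proof (rule Bochner_Integration.integrable_bound)
  show "integrable arc (\<lambda>\<theta>. B * norm (f \<theta>))" using f by auto
  show "(\<lambda>\<theta>. g \<theta> * f \<theta>) \<in> borel_measurable arc" using f g(1) by measurable
  have "norm (g \<theta>) * norm (f \<theta>) \<le> \<bar>B * norm (f \<theta>)\<bar>" for \<theta>
    using mult_right_mono[OF g(2)[of \<theta>] norm_ge_zero[of "f \<theta>"]] by linarith
  then show "AE \<theta> in arc. norm (g \<theta> * f \<theta>) \<le> norm (B * norm (f \<theta>))"
    by (simp add: norm_mult)
qed

lemma integrable_bounded_mult':
  fixes f g :: "real \<Rightarrow> complex"
  assumes "integrable arc f" "g \<in> borel_measurable arc" "\<And>\<theta>. norm (g \<theta>) \<le> B"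
  shows "integrable arc (\<lambda>\<theta>. f \<theta> * g \<theta>)"
  using integrable_bounded_mult[OF assms] by (simp only: mult.commute)

lemma integrable_mult_cis [simp]:
  "integrable arc f \<Longrightarrow> integrable arc (\<lambda>\<theta>. f \<theta> * cis (- (a * \<theta>)))"
  "integrable arc f \<Longrightarrow> integrable arc (\<lambda>\<theta>. f \<theta> * cis (a * \<theta>))"
  by (rule integrable_bounded_mult'[where B = 1]; simp)+

lemma bounded_meas_integrable: "bounded_meas f B \<Longrightarrow> integrable arc f"
  using integrable_bounded_mult[of "\<lambda>_. 1" f B] by (simp add: bounded_meas_def)

lemma sq_int_prod:
  assumes "sq_int f" "sq_int g"
  shows "integrable arc (\<lambda>\<theta>. f \<theta> * g \<theta>)"
proof (rule Bochner_Integration.integrable_bound)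
  show "integrable arc (\<lambda>\<theta>. (norm (f \<theta>))\<^sup>2 + (norm (g \<theta>))\<^sup>2)"
    using assms by (auto simp: sq_int_def)
  show "(\<lambda>\<theta>. f \<theta> * g \<theta>) \<in> borel_measurable arc"
    using assms by (auto simp: sq_int_def)
  have "norm (f \<theta>) * norm (g \<theta>) \<le> (norm (f \<theta>))\<^sup>2 + (norm (g \<theta>))\<^sup>2" for \<theta>
    using sum_squares_bound[of "norm (f \<theta>)" "norm (g \<theta>)"]
      mult_nonneg_nonneg[OF norm_ge_zero norm_ge_zero, of "f \<theta>" "g \<theta>"] by linarith
  then show "AE \<theta> in arc. norm (f \<theta> * g \<theta>) \<le> norm ((norm (f \<theta>))\<^sup>2 + (norm (g \<theta>))\<^sup>2)"
    by (simp add: norm_mult)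
qed

lemma bounded_meas_sq_int:
  assumes "bounded_meas f B"
  shows "sq_int f"
proof -
  have "integrable arc (\<lambda>\<theta>. (norm (f \<theta>))\<^sup>2)"
  proof (rule finite_measure.integrable_const_bound[OF finite_measure_arc, of _ "B\<^sup>2"])
    show "AE \<theta> in arc. norm ((norm (f \<theta>))\<^sup>2) \<le> B\<^sup>2"
      using assms by (auto simp: bounded_meas_def power_mono)
  qed (use assms in \<open>auto simp: bounded_meas_def\<close>)
  then show ?thesis using assms by (simp add: sq_int_def bounded_meas_def)
qed

lemma sq_int_integrable: "sq_int f \<Longrightarrow> integrable arc f"
  using sq_int_prod[of f "\<lambda>_. 1"] bounded_meas_sq_int[of "\<lambda>_. 1" 1] by (simp add: bounded_meas_def)

lemma sq_int_add:
  assumes "sq_int f" "sq_int g"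
  shows "sq_int (\<lambda>\<theta>. f \<theta> + g \<theta>)"
proof -
  have "integrable arc (\<lambda>\<theta>. (norm (f \<theta> + g \<theta>))\<^sup>2)"
  proof (rule Bochner_Integration.integrable_bound)
    show "integrable arc (\<lambda>\<theta>. 2 * (norm (f \<theta>))\<^sup>2 + 2 * (norm (g \<theta>))\<^sup>2)"
      using assms by (auto simp: sq_int_def)
    show "(\<lambda>\<theta>. (norm (f \<theta> + g \<theta>))\<^sup>2) \<in> borel_measurable arc"
      using assms by (auto simp: sq_int_def)
    have "(norm (f \<theta> + g \<theta>))\<^sup>2 \<le> 2 * (norm (f \<theta>))\<^sup>2 + 2 * (norm (g \<theta>))\<^sup>2" for \<theta>
    proof -
      have "(norm (f \<theta> + g \<theta>))\<^sup>2 \<le> (norm (f \<theta>) + norm (g \<theta>))\<^sup>2"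
        by (intro power_mono norm_triangle_ineq) auto
      also have "\<dots> \<le> 2 * (norm (f \<theta>))\<^sup>2 + 2 * (norm (g \<theta>))\<^sup>2"
        using sum_squares_bound[of "norm (f \<theta>)" "norm (g \<theta>)"] by (simp add: power2_sum)
      finally show ?thesis .
    qed
    then show "AE \<theta> in arc. norm ((norm (f \<theta> + g \<theta>))\<^sup>2) \<le> norm (2 * (norm (f \<theta>))\<^sup>2 + 2 * (norm (g \<theta>))\<^sup>2)"
      by simp
  qed
  then show ?thesis using assms by (auto simp: sq_int_def)
qed

lemma sq_int_bounded_mult:
  assumes "sq_int f" "bounded_meas g B"
  shows "sq_int (\<lambda>\<theta>. g \<theta> * f \<theta>)"
proof -
  have "integrable arc (\<lambda>\<theta>. (norm (g \<theta> * f \<theta>))\<^sup>2)"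
  proof (rule Bochner_Integration.integrable_bound)
    show "integrable arc (\<lambda>\<theta>. B\<^sup>2 * (norm (f \<theta>))\<^sup>2)"
      using assms by (auto simp: sq_int_def)
    show "(\<lambda>\<theta>. (norm (g \<theta> * f \<theta>))\<^sup>2) \<in> borel_measurable arc"
      using assms by (auto simp: sq_int_def bounded_meas_def)
    have "(norm (g \<theta>))\<^sup>2 \<le> B\<^sup>2" for \<theta>
      using assms(2) by (auto simp: bounded_meas_def power_mono)
    then show "AE \<theta> in arc. norm ((norm (g \<theta> * f \<theta>))\<^sup>2) \<le> norm (B\<^sup>2 * (norm (f \<theta>))\<^sup>2)"
      by (auto simp: norm_mult power_mult_distrib intro!: mult_right_mono)
  qed
  then show ?thesis using assms by (auto simp: sq_int_def bounded_meas_def)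
qed

lemma bounded_meas_mult:
  assumes "bounded_meas f A" "bounded_meas g B"
  shows "bounded_meas (\<lambda>\<theta>. f \<theta> * g \<theta>) (A * B)"
proof -
  have "0 \<le> A" using assms(1) order_trans[OF norm_ge_zero[of "f 0"]] by (simp add: bounded_meas_def)
  then show ?thesis
    using assms by (auto simp: bounded_meas_def norm_mult intro!: mult_mono)
qed

lemma cnj_measurable [measurable (raw)]:
  "f \<in> borel_measurable M \<Longrightarrow> (\<lambda>x. cnj (f x)) \<in> borel_measurable M"
  by (rule measurable_compose[OF _ borel_measurable_continuous_onI]) (auto intro: continuous_intros)

lemma bounded_meas_cnj: "bounded_meas f A \<Longrightarrow> bounded_meas (\<lambda>\<theta>. cnj (f \<theta>)) A"
  by (auto simp: bounded_meas_def intro: cnj_measurable)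

lemma bounded_meas_cis [simp]: "bounded_meas (\<lambda>\<theta>. cis (a * \<theta>)) 1"
  by (auto simp: bounded_meas_def)

lemma sq_int_cmult: "sq_int f \<Longrightarrow> sq_int (\<lambda>\<theta>. c * f \<theta>)"
  using sq_int_bounded_mult[of f "\<lambda>_. c" "norm c"] by (simp add: bounded_meas_def)

lemma sq_int_diff: "sq_int f \<Longrightarrow> sq_int g \<Longrightarrow> sq_int (\<lambda>\<theta>. f \<theta> - g \<theta>)"
  using sq_int_add[of f "\<lambda>\<theta>. - 1 * g \<theta>"] sq_int_cmult[of g "- 1"] by simp

lemma sq_int_sum: "(\<And>i. i \<in> F \<Longrightarrow> sq_int (f i)) \<Longrightarrow> sq_int (\<lambda>\<theta>. \<Sum>i\<in>F. f i \<theta>)"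
proof (induction F rule: infinite_finite_induct)
  case (insert x F)
  then show ?case by (simp add: sq_int_add)
qed (auto simp: sq_int_def)

lemma sq_int_cis [simp]: "sq_int (\<lambda>\<theta>. cis (a * \<theta>))"
  by (rule bounded_meas_sq_int[OF bounded_meas_cis])

lemma sq_int_cnj: "sq_int f \<Longrightarrow> sq_int (\<lambda>\<theta>. cnj (f \<theta>))"
  by (auto simp: sq_int_def intro: cnj_measurable)

lemma fc_add: "integrable arc f \<Longrightarrow> integrable arc g \<Longrightarrow> fc (\<lambda>\<theta>. f \<theta> + g \<theta>) m = fc f m + fc g m"
  by (simp add: fc_def distrib_right add_divide_distrib)

lemma fc_diff: "integrable arc f \<Longrightarrow> integrable arc g \<Longrightarrow> fc (\<lambda>\<theta>. f \<theta> - g \<theta>) m = fc f m - fc g m"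
  by (simp add: fc_def left_diff_distrib diff_divide_distrib)

lemma fc_cmult: "fc (\<lambda>\<theta>. c * f \<theta>) m = c * fc f m"
  by (simp add: fc_def mult.assoc)

lemma fc_shift: "fc (\<lambda>\<theta>. cis (of_int j * \<theta>) * f \<theta>) m = fc f (m - j)"
proof -
  have "cis (of_int j * \<theta>) * f \<theta> * cis (- (of_int m * \<theta>)) = f \<theta> * cis (- (of_int (m - j) * \<theta>))" for \<theta>
  proof -
    have "cis (- (of_int (m - j) * \<theta>)) = cis (of_int j * \<theta>) * cis (- (of_int m * \<theta>))"
      unfolding cis_mult by (rule arg_cong[where f = cis]) (simp add: algebra_simps)
    then show ?thesis by simp
  qed
  then show ?thesis by (simp only: fc_def)
qed

lemma fc_cnj: "fc (\<lambda>\<theta>. cnj (f \<theta>)) m = cnj (fc f (- m))"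
proof -
  have "(LINT \<theta>|arc. cnj (f \<theta>) * cis (- (of_int m * \<theta>))) = (LINT \<theta>|arc. cnj (f \<theta> * cis (- (of_int (- m) * \<theta>))))"
    by (rule Bochner_Integration.integral_cong) (simp_all add: cis_cnj)
  also have "\<dots> = cnj (LINT \<theta>|arc. f \<theta> * cis (- (of_int (- m) * \<theta>)))"
    by (rule Bochner_Integration.integral_cnj)
  finally show ?thesis
    by (simp only: fc_def complex_cnj_divide complex_cnj_complex_of_real)
qed

lemma fc_cong_AE:
  assumes "AE \<theta> in arc. f \<theta> = g \<theta>" "f \<in> borel_measurable arc" "g \<in> borel_measurable arc"
  shows "fc f m = fc g m"
  unfolding fc_def
  by (intro arg_cong2[where f = "(/)"] integral_cong_AE refl) (use assms in auto)

lemma fc_norm_le: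
  assumes "integrable arc (\<lambda>\<theta>. norm (f \<theta>))"
  shows "norm (fc f m) \<le> (LINT \<theta>|arc. norm (f \<theta>)) / (2 * pi)"
proof -
  have "norm (LINT \<theta>|arc. f \<theta> * cis (- (of_int m * \<theta>))) \<le> (LINT \<theta>|arc. norm (f \<theta> * cis (- (of_int m * \<theta>))))"
    by (rule integral_norm_bound)
  then show ?thesis by (simp add: fc_def norm_divide norm_mult divide_right_mono)
qed

lemma integral_cis:
  assumes "j \<noteq> 0"
  shows "(LINT \<theta>|arc. cis (of_int j * \<theta>)) = 0"
proof -
  have d: "((\<lambda>\<theta>. cis (of_int j * \<theta>) / (\<i> * of_int j)) has_vector_derivative cis (of_int j * \<theta>)) (at \<theta> within {-pi..pi})" for \<theta>
  proof -
    have "((\<lambda>\<theta>. exp (\<i> * of_int j * of_real \<theta>)) has_vector_derivative (\<i> * of_int j * exp (\<i> * of_int j * of_real \<theta>))) (at \<theta> within {-pi..pi})"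
      by (auto intro!: derivative_eq_intros has_vector_derivative_real_field)
    then have "((\<lambda>\<theta>. cis (of_int j * \<theta>)) has_vector_derivative (\<i> * of_int j * cis (of_int j * \<theta>))) (at \<theta> within {-pi..pi})"
      by (simp add: cis_conv_exp mult.assoc)
    from has_vector_derivative_divide[OF this, of "\<i> * of_int j"] show ?thesis
      using assms by simp
  qed
  have "((\<lambda>\<theta>. cis (of_int j * \<theta>)) has_integral (cis (of_int j * pi) / (\<i> * of_int j) - cis (of_int j * - pi) / (\<i> * of_int j))) {-pi..pi}"
    by (rule fundamental_theorem_of_calculus) (auto intro: d)
  moreover have "cis (of_int j * pi) = cis (of_int j * - pi)"
    by (simp add: complex_eq_iff mult.commute[of _ pi])
  ultimately have 1: "((\<lambda>\<theta>. cis (of_int j * \<theta>)) has_integral 0) {-pi..pi}"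
    by simp
  have "integrable arc (\<lambda>\<theta>. cis (of_int j * \<theta>))"
    by (rule bounded_meas_integrable[OF bounded_meas_cis])
  then have "((\<lambda>\<theta>. cis (of_int j * \<theta>)) has_integral (LINT \<theta>|arc. cis (of_int j * \<theta>))) {-pi..pi}"
    by (rule has_integral_integral_lebesgue_on) auto
  with 1 show ?thesis by (rule has_integral_unique[symmetric])
qed

lemma fc_1: "fc (\<lambda>_. 1) m = (if m = 0 then 1 else 0)"
proof (cases "m = 0")
  case True
  then show ?thesis by (simp add: fc_def scaleR_conv_of_real)
next
  case False
  then show ?thesis using integral_cis[of "- m"] by (simp add: fc_def)
qed

lemma fc_cis: "fc (\<lambda>\<theta>. cis (of_int j * \<theta>)) m = (if m = j then 1 else 0)"
  using fc_shift[of j "\<lambda>_. 1" m] by (simp add: fc_1)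

definition trig_poly :: "(int \<Rightarrow> complex) \<Rightarrow> int set \<Rightarrow> real \<Rightarrow> complex" where
  "trig_poly a F \<theta> = (\<Sum>j\<in>F. a j * cis (of_int j * \<theta>))"

lemma sq_int_trig_poly [simp]: "sq_int (trig_poly a F)"
  unfolding trig_poly_def by (intro sq_int_sum sq_int_cmult sq_int_cis)

lemma nsq_complex:
  "complex_of_real (nsq f) = (LINT \<theta>|arc. f \<theta> * cnj (f \<theta>)) / (2 * pi)"
  by (simp add: nsq_def complex_norm_square[symmetric] flip: of_real_power)

lemma ip_trig_poly:
  assumes "sq_int f"
  shows "(LINT \<theta>|arc. f \<theta> * cnj (trig_poly a F \<theta>)) / (2 * pi) = (\<Sum>j\<in>F. cnj (a j) * fc f j)"
proof -
  have "(LINT \<theta>|arc. f \<theta> * cnj (trig_poly a F \<theta>)) = (LINT \<theta>|arc. (\<Sum>j\<in>F. cnj (a j) * (f \<theta> * cis (- (of_int j * \<theta>)))))"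
    by (intro Bochner_Integration.integral_cong refl)
       (simp add: trig_poly_def sum_distrib_left cis_cnj mult_ac)
  also have "\<dots> = (\<Sum>j\<in>F. (LINT \<theta>|arc. cnj (a j) * (f \<theta> * cis (- (of_int j * \<theta>)))))"
    by (rule Bochner_Integration.integral_sum) (use sq_int_integrable[OF assms] in auto)
  finally show ?thesis
    by (simp add: sum_divide_distrib fc_def)
qed

lemma fc_trig_poly:
  assumes "finite F"
  shows "fc (trig_poly a F) m = (if m \<in> F then a m else 0)"
proof -
  have "fc (trig_poly a F) m = (\<Sum>j\<in>F. a j * fc (\<lambda>\<theta>. cis (of_int j * \<theta>)) m)"
    unfolding trig_poly_def using assms
  proof (induction F)
    case empty
    show ?case by (simp add: fc_def)
  next
    case (insert x F)
    have "integrable arc (\<lambda>\<theta>. \<Sum>j\<in>F. a j * cis (of_int j * \<theta>))"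
      using sq_int_integrable[OF sq_int_trig_poly[of a F]] by (simp add: trig_poly_def[abs_def])
    then show ?case
      using insert by (simp add: fc_add fc_cmult bounded_meas_integrable[OF bounded_meas_cis])
  qed
  also have "\<dots> = (if m \<in> F then a m else 0)"
    using assms by (simp add: fc_cis if_distrib[of "\<lambda>x. _ * x"] cong: if_cong)
  finally show ?thesis .
qed

lemma nsq_trig_poly:
  assumes "finite F"
  shows "nsq (trig_poly a F) = (\<Sum>j\<in>F. (norm (a j))\<^sup>2)"
proof -
  have "complex_of_real (nsq (trig_poly a F)) = (\<Sum>j\<in>F. cnj (a j) * a j)"
    unfolding nsq_complex ip_trig_poly[OF sq_int_trig_poly] using assms by (simp add: fc_trig_poly)
  also have "\<dots> = complex_of_real (\<Sum>j\<in>F. (norm (a j))\<^sup>2)"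
    by (simp add: complex_norm_square mult.commute del: of_real_power)
  finally show ?thesis by (simp only: of_real_eq_iff)
qed

lemma bessel:
  assumes "sq_int f"
  shows "l2_le (fc f) (sqrt (nsq f))"
proof (rule l2_leI)
  fix F :: "int set" assume F: "finite F"
  define p where "p = trig_poly (fc f) F"
  define S where "S = (\<Sum>j\<in>F. (norm (fc f j))\<^sup>2)"
  have p: "sq_int p" by (simp add: p_def)
  have i: "integrable arc (\<lambda>\<theta>. f \<theta> * cnj (f \<theta>))" "integrable arc (\<lambda>\<theta>. f \<theta> * cnj (p \<theta>))"
    "integrable arc (\<lambda>\<theta>. p \<theta> * cnj (f \<theta>))" "integrable arc (\<lambda>\<theta>. p \<theta> * cnj (p \<theta>))"
    using assms p by (auto intro: sq_int_prod sq_int_cnj)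
  have fp: "(LINT \<theta>|arc. f \<theta> * cnj (p \<theta>)) / (2 * pi) = of_real S"
    unfolding p_def ip_trig_poly[OF assms] S_def by (simp add: complex_norm_square mult.commute del: of_real_power)
  have "(LINT \<theta>|arc. p \<theta> * cnj (f \<theta>)) = cnj (LINT \<theta>|arc. f \<theta> * cnj (p \<theta>))"
    unfolding Bochner_Integration.integral_cnj[symmetric]
    by (rule Bochner_Integration.integral_cong) simp_all
  then have pf: "(LINT \<theta>|arc. p \<theta> * cnj (f \<theta>)) / (2 * pi) = of_real S"
    using arg_cong[OF fp, of cnj] by simp
  have pp: "(LINT \<theta>|arc. p \<theta> * cnj (p \<theta>)) / (2 * pi) = of_real S"
    unfolding nsq_complex[symmetric] p_def nsq_trig_poly[OF F] S_def ..
  have "(LINT \<theta>|arc. (f \<theta> - p \<theta>) * cnj (f \<theta> - p \<theta>)) =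
      (LINT \<theta>|arc. (f \<theta> * cnj (f \<theta>) - f \<theta> * cnj (p \<theta>)) - (p \<theta> * cnj (f \<theta>) - p \<theta> * cnj (p \<theta>)))"
    by (intro Bochner_Integration.integral_cong refl) (simp add: algebra_simps)
  also have "\<dots> = (LINT \<theta>|arc. f \<theta> * cnj (f \<theta>)) - (LINT \<theta>|arc. f \<theta> * cnj (p \<theta>))
      - ((LINT \<theta>|arc. p \<theta> * cnj (f \<theta>)) - (LINT \<theta>|arc. p \<theta> * cnj (p \<theta>)))"
    using i by simp
  finally have "complex_of_real (nsq (\<lambda>\<theta>. f \<theta> - p \<theta>)) = complex_of_real (nsq f - S)"
    unfolding nsq_complex using fp pf pp by (simp add: diff_divide_distrib nsq_complex)
  then have "nsq f - S = nsq (\<lambda>\<theta>. f \<theta> - p \<theta>)" by (simp only: of_real_eq_iff)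
  also have "\<dots> \<ge> 0" by (simp add: nsq_def)
  finally have "S \<le> nsq f" by simp
  then show "L2_set (\<lambda>i. norm (fc f i)) F \<le> sqrt (nsq f)"
    by (simp add: L2_set_def S_def)
qed

section \<open>Completeness of the trigonometric system\<close>

text \<open>An inductive variant of \<open>trig_poly\<close>: closure under products, needed for
  Stone-Weierstrass, becomes a rule induction.\<close>

inductive trig :: "(real \<Rightarrow> complex) \<Rightarrow> bool" where
  trig_cis: "trig (\<lambda>\<theta>. c * cis (of_int j * \<theta>))"
| trig_add: "trig p \<Longrightarrow> trig q \<Longrightarrow> trig (\<lambda>\<theta>. p \<theta> + q \<theta>)"

lemma trig_cis_mult: "trig q \<Longrightarrow> trig (\<lambda>\<theta>. c * cis (of_int j * \<theta>) * q \<theta>)"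
proof (induction rule: trig.induct)
  case (trig_cis d i)
  have "c * cis (of_int j * \<theta>) * (d * cis (of_int i * \<theta>)) = (c * d) * cis (of_int (j + i) * \<theta>)" for \<theta>
    by (simp add: distrib_right cis_mult[symmetric])
  then show ?case using trig.trig_cis[of "c * d" "j + i"] by presburger
next
  case (trig_add p q)
  from trig.trig_add[OF trig_add.IH] show ?case by (simp add: distrib_left)
qed

lemma trig_mult: "trig p \<Longrightarrow> trig q \<Longrightarrow> trig (\<lambda>\<theta>. p \<theta> * q \<theta>)"
proof (induction rule: trig.induct)
  case (trig_add p p')
  from trig.trig_add[OF trig_add.IH] trig_add.prems show ?case by (simp add: distrib_right)
qed (rule trig_cis_mult)

text \<open>A real-linear functional of the point cis \<theta> is a combination of cosine and sine,
  that is of the frequencies 1 and -1; sums and products then reach every polynomial.\<close>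

lemma trig_real_polynomial_function:
  assumes "real_polynomial_function p"
  shows "trig (\<lambda>\<theta>. of_real (p (cis \<theta>)))"
  using assms
proof (induction rule: real_polynomial_function.induct)
  case (linear f)
  have "complex_of_real (f (cis \<theta>)) =
      (f 1 / 2 - \<i> * f \<i> / 2) * cis (of_int 1 * \<theta>) + (f 1 / 2 + \<i> * f \<i> / 2) * cis (of_int (- 1) * \<theta>)" for \<theta>
  proof -
    have "f (cis \<theta>) = f (cos \<theta> *\<^sub>R 1 + sin \<theta> *\<^sub>R \<i>)"
      by (rule arg_cong[where f = f]) (simp add: complex_eq_iff)
    also have "\<dots> = cos \<theta> * f 1 + sin \<theta> * f \<i>"
      using linear by (simp add: bounded_linear.linear linear_add linear_scale)
    finally show ?thesis
      by (simp add: complex_eq_iff)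
  qed
  then show ?case
    using trig_add[OF trig_cis[of "f 1 / 2 - \<i> * f \<i> / 2" 1] trig_cis[of "f 1 / 2 + \<i> * f \<i> / 2" "- 1"]]
    by presburger
next
  case (const c)
  show ?case using trig_cis[of "of_real c" 0] by simp
next
  case (add f g)
  from trig_add[OF add.IH] show ?case by simp
next
  case (mult f g)
  from trig_mult[OF mult.IH] show ?case by simp
qed

lemma trig_bounded_meas: "trig p \<Longrightarrow> \<exists>B. bounded_meas p B"
proof (induction rule: trig.induct)
  case (trig_cis c j)
  show ?case by (rule exI[of _ "norm c"]) (simp add: bounded_meas_def norm_mult)
next
  case (trig_add p q)
  then obtain A B where "bounded_meas p A" "bounded_meas q B" by blast
  then show ?case
    by (intro exI[of _ "A + B"]) (auto simp: bounded_meas_def intro!: norm_triangle_le add_mono)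
qed

lemma trig_orthogonal:
  assumes "trig p" and h: "integrable arc h" and z: "\<And>m. fc h m = 0"
  shows "(LINT \<theta>|arc. h \<theta> * p \<theta>) = 0"
  using assms(1)
proof (induction rule: trig.induct)
  case (trig_cis c j)
  have "(LINT \<theta>|arc. h \<theta> * (c * cis (of_int j * \<theta>))) = (LINT \<theta>|arc. c * (h \<theta> * cis (- (of_int (- j) * \<theta>))))"
    by (rule Bochner_Integration.integral_cong) auto
  also have "\<dots> = c * (LINT \<theta>|arc. h \<theta> * cis (- (of_int (- j) * \<theta>)))"
    by (rule Bochner_Integration.integral_mult_right_zero)
  also have "(LINT \<theta>|arc. h \<theta> * cis (- (of_int (- j) * \<theta>))) = 0"
    using z[of "- j"] by (simp only: fc_def divide_eq_0_iff of_real_eq_0_iff) simp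
  finally show ?case by simp
next
  case (trig_add p q)
  obtain A B where "bounded_meas p A" "bounded_meas q B"
    using trig_bounded_meas trig_add.hyps by blast
  then have "integrable arc (\<lambda>\<theta>. h \<theta> * p \<theta>)" "integrable arc (\<lambda>\<theta>. h \<theta> * q \<theta>)"
    using integrable_bounded_mult'[OF h] by (auto simp: bounded_meas_def)
  then show ?case using trig_add.IH by (simp add: distrib_left)
qed

lemma integrable_mult_continuous:
  fixes f :: "complex \<Rightarrow> real" and h :: "real \<Rightarrow> complex"
  assumes f: "continuous_on (sphere 0 1) f" and h: "integrable arc h"
  shows "integrable arc (\<lambda>\<theta>. h \<theta> * of_real (f (cis \<theta>)))"
proof -
  have "continuous_on {-pi..pi} (\<lambda>\<theta>. f (cis \<theta>))"
    by (rule continuous_on_compose2[OF f]) (auto intro!: continuous_intros)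
  then have fm: "(\<lambda>\<theta>. f (cis \<theta>)) \<in> borel_measurable arc"
    by (intro continuous_imp_measurable_on_sets_lebesgue) auto
  obtain B where B: "\<And>z. z \<in> sphere 0 1 \<Longrightarrow> norm (f z) \<le> B"
    using compact_continuous_image[OF f compact_sphere] by (meson bounded_iff compact_imp_bounded imageI)
  show ?thesis
    by (rule integrable_bounded_mult'[OF h, where B = B]) (use fm B in auto)
qed

lemma continuous_orthogonal_real:
  fixes f :: "complex \<Rightarrow> real"
  assumes f: "continuous_on (sphere 0 1) f" and h: "integrable arc h" and z: "\<And>m. fc h m = 0"
  shows "(LINT \<theta>|arc. h \<theta> * of_real (f (cis \<theta>))) = 0"
proof -
  define K where "K = (LINT \<theta>|arc. norm (h \<theta>))"
  have K: "0 \<le> K" by (simp add: K_def)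
  have fi: "integrable arc (\<lambda>\<theta>. h \<theta> * of_real (f (cis \<theta>)))"
    by (rule integrable_mult_continuous[OF f h])
  have le: "norm (LINT \<theta>|arc. h \<theta> * of_real (f (cis \<theta>))) \<le> e * K" if e: "0 < e" for e
  proof -
    obtain g where g: "real_polynomial_function g" "\<And>x. x \<in> sphere 0 1 \<Longrightarrow> \<bar>f x - g x\<bar> < e"
      using Stone_Weierstrass_real_polynomial_function[OF compact_sphere f e] by blast
    note tg = trig_real_polynomial_function[OF g(1)]
    obtain A where A: "bounded_meas (\<lambda>\<theta>. complex_of_real (g (cis \<theta>))) A"
      using trig_bounded_meas[OF tg] by blast
    have gi: "integrable arc (\<lambda>\<theta>. h \<theta> * of_real (g (cis \<theta>)))"
      by (rule integrable_bounded_mult'[OF h, where B = A]) (use A in \<open>auto simp: bounded_meas_def\<close>)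
    have "(LINT \<theta>|arc. h \<theta> * of_real (f (cis \<theta>))) = (LINT \<theta>|arc. h \<theta> * of_real (f (cis \<theta>)) - h \<theta> * of_real (g (cis \<theta>)))"
      using trig_orthogonal[OF tg h z] fi gi by simp
    also have "norm \<dots> \<le> (LINT \<theta>|arc. e * norm (h \<theta>))"
    proof (rule Bochner_Integration.integral_norm_bound_integral)
      fix \<theta>
      have "norm (h \<theta> * of_real (f (cis \<theta>)) - h \<theta> * of_real (g (cis \<theta>))) = norm (h \<theta>) * \<bar>f (cis \<theta>) - g (cis \<theta>)\<bar>"
        unfolding right_diff_distrib[symmetric] of_real_diff[symmetric] norm_mult norm_of_real ..
      also have "\<dots> \<le> norm (h \<theta>) * e"
        using g(2)[of "cis \<theta>"] by (intro mult_left_mono) auto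
      finally show "norm (h \<theta> * of_real (f (cis \<theta>)) - h \<theta> * of_real (g (cis \<theta>))) \<le> e * norm (h \<theta>)"
        by (simp add: mult.commute)
    qed (use fi gi h in auto)
    finally show ?thesis by (simp add: K_def)
  qed
  show ?thesis
  proof (rule ccontr)
    assume "(LINT \<theta>|arc. h \<theta> * of_real (f (cis \<theta>))) \<noteq> 0"
    then have pos: "0 < norm (LINT \<theta>|arc. h \<theta> * of_real (f (cis \<theta>)))" (is "0 < ?x") by simp
    then have "?x \<le> ?x / (2 * (K + 1)) * K"
      using le[of "?x / (2 * (K + 1))"] K by simp
    also have "\<dots> \<le> ?x / (2 * (K + 1)) * (K + 1)"
      using K pos by (intro mult_left_mono) auto
    also have "\<dots> = ?x / 2" using K by (simp add: field_simps)
    finally show False using pos by simp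
  qed
qed

lemma continuous_orthogonal:
  assumes f: "continuous_on (sphere 0 1) f" and h: "integrable arc h" and z: "\<And>m. fc h m = 0"
  shows "(LINT \<theta>|arc. h \<theta> * cnj (f (cis \<theta>))) = 0"
proof -
  have c: "continuous_on (sphere 0 1) (\<lambda>z. Re (f z))" "continuous_on (sphere 0 1) (\<lambda>z. Im (f z))"
    using f by (auto intro: continuous_intros)
  note i = integrable_mult_continuous[OF _ h]
  have "(LINT \<theta>|arc. h \<theta> * cnj (f (cis \<theta>))) =
     (LINT \<theta>|arc. h \<theta> * of_real (Re (f (cis \<theta>))) - \<i> * (h \<theta> * of_real (Im (f (cis \<theta>)))))"
    by (intro Bochner_Integration.integral_cong refl) (simp add: complex_eq_iff algebra_simps)
  also have "\<dots> = (LINT \<theta>|arc. h \<theta> * of_real (Re (f (cis \<theta>)))) - \<i> * (LINT \<theta>|arc. h \<theta> * of_real (Im (f (cis \<theta>))))"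
    using i[OF c(1)] i[OF c(2)] by simp
  also have "\<dots> = 0"
    using continuous_orthogonal_real[OF c(1) h z] continuous_orthogonal_real[OF c(2) h z] by simp
  finally show ?thesis .
qed

lemma AE_arcI:
  assumes "negligible N" "\<And>\<theta>. \<theta> \<in> {-pi..pi} \<Longrightarrow> \<theta> \<notin> N \<Longrightarrow> P \<theta>"
  shows "AE \<theta> in arc. P \<theta>"
proof -
  have "AE \<theta> in lebesgue. \<theta> \<notin> N"
    using assms(1) by (simp add: AE_not_in negligible_iff_null_sets)
  then have "AE \<theta> in lebesgue. \<theta> \<in> {-pi..pi} \<longrightarrow> P \<theta>"
    using assms(2) by auto
  then show ?thesis by (subst AE_restrict_space_iff) auto
qed

text \<open>\<open>h\<close> is paired with continuous functions on the circle that are bounded by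
  \<open>B\<close> and converge to \<open>h\<close> almost everywhere. Every pairing vanishes, hence
  so does the integral of |h|^2, by dominated convergence. The work lies in making such functions
  out of continuous functions of a real variable.\<close>

lemma fc_zero_imp_AE_zero:
  assumes h: "bounded_meas h B" and z: "\<And>m. fc h m = 0"
  shows "AE \<theta> in arc. h \<theta> = 0"
proof -
  have B: "0 \<le> B" using h order_trans[OF norm_ge_zero[of "h 0"]] by (simp add: bounded_meas_def)
  have hi: "integrable arc h" by (rule bounded_meas_integrable[OF h])
  have "h measurable_on {-pi..pi}"
    using h by (simp add: bounded_meas_def measurable_on_iff_borel_measurable)
  then obtain N g where N: "negligible N" and g: "\<And>n. continuous_on UNIV (g n)"
    and lim: "\<And>x. x \<notin> N \<Longrightarrow> (\<lambda>n. g n x) \<longlonglongrightarrow> (if x \<in> {-pi..pi} then h x else 0)"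
    by (auto simp: measurable_on_def)
  \<comment> \<open>Projection onto the ball of radius \<open>B\<close> fixes the values of
    \<open>h\<close> and keeps the approximants bounded, as dominated convergence requires.\<close>
  define cl where "cl = closest_point (cball (0::complex) B)"
  have cl: "continuous_on UNIV cl" "norm (cl x) \<le> B" "norm x \<le> B \<Longrightarrow> cl x = x" for x
  proof -
    show "continuous_on UNIV cl" unfolding cl_def
      by (rule continuous_on_closest_point) (use B in auto)
    show "norm (cl x) \<le> B" using closest_point_in_set[of "cball (0::complex) B" x] B
      by (simp add: cl_def)
    show "norm x \<le> B \<Longrightarrow> cl x = x" by (simp add: cl_def closest_point_self)
  qed
  \<comment> \<open>\<open>cut n\<close> vanishes at x = -1 and tends to 1 for x > -1; it removes
    the jump of \<open>Arg\<close> at the point -1 of the circle.\<close>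
  define cut where "cut n x = min 1 (real n * (1 + x))" for n x
  define f where "f n z = of_real (cut n (Re z)) * cl (g n (Arg z))" for n z
  have chi: "0 \<le> cut n x" "cut n x \<le> 1" if "-1 \<le> x" for n x
    using that by (auto simp: cut_def)
  have chi_cont: "continuous_on UNIV (\<lambda>z. cut n (Re z))" for n
    unfolding cut_def by (intro continuous_intros)
  have Re_sphere: "-1 \<le> Re z" if "z \<in> sphere 0 1" for z :: complex
    using that abs_Re_le_cmod[of z] by auto
  have f_cont: "continuous_on (sphere 0 1) (f n)" for n
  proof (subst continuous_on_eq_continuous_within, intro ballI)
    fix z :: complex assume z: "z \<in> sphere 0 1"
    show "continuous (at z within sphere 0 1) (f n)"
    proof (cases "z = -1")
      case False
      have "z \<notin> \<real>\<^sub>\<le>\<^sub>0"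
      proof
        assume "z \<in> \<real>\<^sub>\<le>\<^sub>0"
        then obtain x where "z = of_real x" "x \<le> 0" by (auto elim: nonpos_Reals_cases)
        with z have "z = -1" by simp
        with False show False by simp
      qed
      then have "continuous (at z within sphere 0 1) Arg" by (rule continuous_within_Arg)
      moreover have "continuous (at (Arg z) within Arg ` sphere 0 1) (g n)"
        using g[of n] by (simp add: continuous_on_eq_continuous_at continuous_at_imp_continuous_at_within)
      ultimately have "continuous (at z within sphere 0 1) (\<lambda>z. g n (Arg z))"
        by (rule continuous_within_compose2)
      moreover have "continuous (at (g n (Arg z)) within (\<lambda>z. g n (Arg z)) ` sphere 0 1) cl"
        using cl(1) by (simp add: continuous_on_eq_continuous_at continuous_at_imp_continuous_at_within)
      ultimately have "continuous (at z within sphere 0 1) (\<lambda>z. cl (g n (Arg z)))"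
        by (rule continuous_within_compose2)
      moreover have "continuous (at z within sphere 0 1) (\<lambda>z. cut n (Re z))"
        using chi_cont[of n] by (simp add: continuous_on_eq_continuous_at continuous_at_imp_continuous_at_within)
      ultimately show ?thesis
        unfolding f_def by (intro continuous_intros)
    next
      case True
      have fz: "f n z = 0" by (simp add: f_def True cut_def)
      have "((\<lambda>w. cut n (Re w) * B) \<longlongrightarrow> cut n (Re z) * B) (at z within sphere 0 1)"
        using continuous_on_subset[OF chi_cont[of n], of "sphere 0 1"] z
        by (intro tendsto_mult_right) (simp add: continuous_on_def)
      then have l: "((\<lambda>w. cut n (Re w) * B) \<longlongrightarrow> 0) (at z within sphere 0 1)"
        by (simp add: True cut_def)
      have "\<forall>\<^sub>F w in at z within sphere 0 1. norm (f n w) \<le> cut n (Re w) * B"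
        unfolding eventually_at_filter
      proof (intro always_eventually allI impI)
        fix w :: complex assume "w \<in> sphere 0 1"
        then have "0 \<le> cut n (Re w)" by (intro chi Re_sphere)
        then show "norm (f n w) \<le> cut n (Re w) * B"
          using cl(2) by (simp add: f_def norm_mult mult_left_mono)
      qed
      then have "(f n \<longlongrightarrow> 0) (at z within sphere 0 1)"
        by (rule Lim_null_comparison[OF _ l])
      then show ?thesis by (simp add: continuous_within fz)
    qed
  qed
  have f_bd: "norm (f n (cis \<theta>)) \<le> B" for n \<theta>
  proof -
    have "norm (f n (cis \<theta>)) = cut n (cos \<theta>) * norm (cl (g n (Arg (cis \<theta>))))"
      using chi(1)[of "cos \<theta>" n] by (simp add: f_def norm_mult)
    also have "\<dots> \<le> 1 * B"
      using chi[of "cos \<theta>" n] cl(2) by (intro mult_mono) auto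
    finally show ?thesis by simp
  qed
  have f_lim: "AE \<theta> in arc. (\<lambda>n. f n (cis \<theta>)) \<longlonglongrightarrow> h \<theta>"
  proof (rule AE_arcI)
    \<comment> \<open>Both endpoints are the point -1 of the circle, where the cut-off stays
      0.\<close>
    show "negligible (N \<union> {-pi, pi})" using N by (intro negligible_Un) auto
    fix \<theta> assume \<theta>: "\<theta> \<in> {-pi..pi}" "\<theta> \<notin> N \<union> {-pi, pi}"
    have "cos \<theta> \<noteq> -1"
    proof
      assume "cos \<theta> = -1"
      with \<theta> have "\<bar>\<theta>\<bar> = pi" by (intro cos_inj_pi[of "\<bar>\<theta>\<bar>" pi]) (auto simp: abs_le_iff)
      then show False using \<theta> by auto
    qed
    then have c: "0 < 1 + cos \<theta>" using cos_ge_minus_one[of \<theta>] by linarith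
    have "\<forall>\<^sub>F n in sequentially. 1 / (1 + cos \<theta>) \<le> real n"
      by (rule eventually_sequentiallyI[of "nat \<lceil>1 / (1 + cos \<theta>)\<rceil>"]) linarith
    then have "\<forall>\<^sub>F n in sequentially. 1 = cut n (cos \<theta>)"
      by eventually_elim (use c in \<open>simp add: cut_def divide_simps\<close>)
    then have chi_lim: "(\<lambda>n. cut n (cos \<theta>)) \<longlonglongrightarrow> 1"
      by (rule tendsto_cong[THEN iffD1]) simp
    have "(\<lambda>n. cl (g n \<theta>)) \<longlonglongrightarrow> cl (h \<theta>)"
      using lim[of \<theta>] \<theta> cl(1) by (intro isCont_tendsto_compose[of _ cl]) (auto simp: continuous_on_eq_continuous_at)
    moreover have "cl (h \<theta>) = h \<theta>" using h by (intro cl(3)) (simp add: bounded_meas_def)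
    moreover have "Arg (cis \<theta>) = \<theta>" using \<theta> by (intro Arg_cis) auto
    ultimately show "(\<lambda>n. f n (cis \<theta>)) \<longlonglongrightarrow> h \<theta>"
      using tendsto_mult[OF tendsto_of_real[OF chi_lim], of "\<lambda>n. cl (g n \<theta>)" "h \<theta>"] by (simp add: f_def)
  qed
  have f_meas: "(\<lambda>\<theta>. f n (cis \<theta>)) \<in> borel_measurable arc" for n
  proof -
    have "continuous_on {-pi..pi} (\<lambda>\<theta>. f n (cis \<theta>))"
      by (rule continuous_on_compose2[OF f_cont]) (auto intro!: continuous_intros)
    then show ?thesis
      by (intro continuous_imp_measurable_on_sets_lebesgue) auto
  qed
  have hm: "h \<in> borel_measurable arc" using h by (simp add: bounded_meas_def)
  have "(\<lambda>n. LINT \<theta>|arc. h \<theta> * cnj (f n (cis \<theta>))) \<longlonglongrightarrow> (LINT \<theta>|arc. h \<theta> * cnj (h \<theta>))"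
  proof (rule integral_dominated_convergence[where w = "\<lambda>_. B * B"])
    show "AE \<theta> in arc. (\<lambda>n. h \<theta> * cnj (f n (cis \<theta>))) \<longlonglongrightarrow> h \<theta> * cnj (h \<theta>)"
      using f_lim by eventually_elim (intro tendsto_intros)
    show "AE \<theta> in arc. norm (h \<theta> * cnj (f n (cis \<theta>))) \<le> B * B" for n
      using h f_bd B by (auto simp: norm_mult bounded_meas_def intro!: mult_mono)
  qed (use hm f_meas in \<open>auto intro!: cnj_measurable borel_measurable_times\<close>)
  then have "(LINT \<theta>|arc. h \<theta> * cnj (h \<theta>)) = 0"
    unfolding continuous_orthogonal[OF f_cont hi z] by (simp add: LIMSEQ_const_iff)
  then have "complex_of_real (nsq h) = 0" by (simp add: nsq_complex)
  then have "(LINT \<theta>|arc. (norm (h \<theta>))\<^sup>2) = 0" by (simp add: nsq_def)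
  moreover have "integrable arc (\<lambda>\<theta>. (norm (h \<theta>))\<^sup>2)"
    using bounded_meas_sq_int[OF h] by (simp add: sq_int_def)
  ultimately have "AE \<theta> in arc. (norm (h \<theta>))\<^sup>2 = 0"
    by (subst (asm) integral_nonneg_eq_0_iff_AE) auto
  then show ?thesis by auto
qed

section \<open>Multiplication by absolutely convergent Fourier series\<close>

definition ser :: "(int \<Rightarrow> complex) \<Rightarrow> real \<Rightarrow> complex" where
  "ser a \<theta> = (\<Sum>\<^sub>\<infinity>j. a j * cis (of_int j * \<theta>))"

lemma ser_uniform_limit:
  assumes "l1_le a A"
  shows "uniform_limit UNIV (\<lambda>F \<theta>. trig_poly a F \<theta>) (ser a) (finite_subsets_at_top UNIV)"
  unfolding trig_poly_def ser_def
  by (rule Weierstrass_m_test_general[where M = "\<lambda>j. norm (a j)"])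
     (use l1_le_abs_summable[OF assms] in \<open>auto simp: norm_mult\<close>)

lemma ser_has_sum:
  assumes "l1_le a A"
  shows "((\<lambda>j. a j * cis (of_int j * \<theta>)) has_sum ser a \<theta>) UNIV"
  unfolding ser_def
  by (intro has_sum_infsum, rule abs_summable_summable)
     (use l1_le_abs_summable[OF assms, of UNIV] in \<open>simp add: norm_mult\<close>)

lemma ser_bounded_meas:
  assumes "l1_le a A"
  shows "bounded_meas (ser a) A"
proof -
  have "continuous_on UNIV (ser a)"
    by (rule uniform_limit_theorem[OF _ ser_uniform_limit[OF assms]])
       (auto simp: trig_poly_def[abs_def] intro!: always_eventually continuous_intros)
  then have "ser a \<in> borel_measurable arc"
    by (intro continuous_imp_measurable_on_sets_lebesgue) (auto intro: continuous_on_subset)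
  moreover have "norm (ser a \<theta>) \<le> A" for \<theta>
    unfolding ser_def by (rule l1_le_norm_infsum[OF l1_le_mono[OF assms]]) (auto simp: norm_mult)
  ultimately show ?thesis by (simp add: bounded_meas_def)
qed

lemma fc_trig_poly_mult:
  assumes h: "integrable arc h" and F: "finite F"
  shows "fc (\<lambda>\<theta>. trig_poly a F \<theta> * h \<theta>) m = (\<Sum>j\<in>F. a j * fc h (m - j))"
  using F
proof (induction F)
  case empty
  show ?case by (simp add: fc_def trig_poly_def)
next
  case (insert x F)
  have i: "integrable arc (\<lambda>\<theta>. a j * (cis (of_int j * \<theta>) * h \<theta>))" for j
    by (intro Bochner_Integration.integrable_mult_right integrable_bounded_mult[OF h, where B = 1]) auto
  have "integrable arc (\<lambda>\<theta>. \<Sum>j\<in>F. a j * (cis (of_int j * \<theta>) * h \<theta>))"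
    by (rule Bochner_Integration.integrable_sum) (rule i)
  then have iF: "integrable arc (\<lambda>\<theta>. trig_poly a F \<theta> * h \<theta>)"
    by (simp add: trig_poly_def sum_distrib_right mult.assoc)
  have "trig_poly a (insert x F) \<theta> * h \<theta> = a x * (cis (of_int x * \<theta>) * h \<theta>) + trig_poly a F \<theta> * h \<theta>" for \<theta>
    using insert.hyps by (simp add: trig_poly_def algebra_simps)
  then show ?case
    using insert.IH insert.hyps fc_add[OF i[of x] iF, of m] by (simp add: fc_cmult fc_shift)
qed

text \<open>\<open>h\<close> is merely integrable: the partial sums converge uniformly, and a
  coefficient of a product is bounded by the supremum of one factor times the L1 norm of the
  other.\<close>

lemma fc_ser_mult:
  assumes a: "l1_le a A" and h: "integrable arc h"
  shows "((\<lambda>j. a j * fc h (m - j)) has_sum fc (\<lambda>\<theta>. ser a \<theta> * h \<theta>) m) UNIV"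
  unfolding has_sum_def
proof (rule tendstoI)
  fix e :: real assume e: "0 < e"
  define K where "K = (LINT \<theta>|arc. norm (h \<theta>)) / (2 * pi)"
  have K: "0 \<le> K" by (simp add: K_def)
  define d where "d = e / (K + 1)"
  have d: "0 < d" using e K by (simp add: d_def)
  have "\<forall>\<^sub>F F in finite_subsets_at_top UNIV. \<forall>\<theta>\<in>UNIV. dist (trig_poly a F \<theta>) (ser a \<theta>) < d"
    using ser_uniform_limit[OF a] d by (simp add: uniform_limit_iff)
  moreover have "\<forall>\<^sub>F F in finite_subsets_at_top (UNIV :: int set). finite F"
    by (rule eventually_finite_subsets_at_top_weakI)
  ultimately show "\<forall>\<^sub>F F in finite_subsets_at_top UNIV. dist (\<Sum>j\<in>F. a j * fc h (m - j)) (fc (\<lambda>\<theta>. ser a \<theta> * h \<theta>) m) < e"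
  proof eventually_elim
    case (elim F)
    obtain B where B: "bounded_meas (ser a) B" using ser_bounded_meas[OF a] by blast
    have tp: "trig_poly a F \<in> borel_measurable arc" using sq_int_trig_poly by (simp add: sq_int_def)
    have s: "ser a \<in> borel_measurable arc" using B by (simp add: bounded_meas_def)
    have bd: "norm (trig_poly a F \<theta> - ser a \<theta>) \<le> d" for \<theta>
      using elim(1) by (auto simp: dist_norm less_imp_le)
    have i1: "integrable arc (\<lambda>\<theta>. (trig_poly a F \<theta> - ser a \<theta>) * h \<theta>)"
      by (rule integrable_bounded_mult[OF h _ bd]) (use tp s in auto)
    have i2: "integrable arc (\<lambda>\<theta>. ser a \<theta> * h \<theta>)"
      by (rule integrable_bounded_mult[OF h s]) (use B in \<open>auto simp: bounded_meas_def\<close>)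
    have i3: "integrable arc (\<lambda>\<theta>. trig_poly a F \<theta> * h \<theta>)"
      using Bochner_Integration.integrable_add[OF i1 i2] by (simp add: algebra_simps)
    have "(\<Sum>j\<in>F. a j * fc h (m - j)) - fc (\<lambda>\<theta>. ser a \<theta> * h \<theta>) m = fc (\<lambda>\<theta>. (trig_poly a F \<theta> - ser a \<theta>) * h \<theta>) m"
      unfolding left_diff_distrib using elim(2) by (simp add: fc_diff[OF i3 i2] fc_trig_poly_mult[OF h])
    also have "norm \<dots> \<le> (LINT \<theta>|arc. norm ((trig_poly a F \<theta> - ser a \<theta>) * h \<theta>)) / (2 * pi)"
      by (rule fc_norm_le) (use i1 in auto)
    also have "\<dots> \<le> (LINT \<theta>|arc. d * norm (h \<theta>)) / (2 * pi)"
    proof (intro divide_right_mono integral_mono)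
      show "integrable arc (\<lambda>\<theta>. norm ((trig_poly a F \<theta> - ser a \<theta>) * h \<theta>))"
        using i1 by (rule integrable_norm)
      show "norm ((trig_poly a F \<theta> - ser a \<theta>) * h \<theta>) \<le> d * norm (h \<theta>)" for \<theta>
        unfolding norm_mult by (intro mult_right_mono bd) simp
    qed (use h in auto)
    also have "\<dots> = d * K" by (simp add: K_def)
    also have "\<dots> < d * (K + 1)" using d by simp
    also have "\<dots> = e" using K by (simp add: d_def)
    finally show ?case by (simp add: dist_norm)
  qed
qed

lemma fc_ser_mult_conv:
  assumes a: "l1_le a A" and h: "integrable arc h"
  shows "fc (\<lambda>\<theta>. ser a \<theta> * h \<theta>) m = conv a (fc h) m"
proof -
  have "fc (\<lambda>\<theta>. ser a \<theta> * h \<theta>) m = (\<Sum>\<^sub>\<infinity>j. a j * fc h (m - j))"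
    by (rule infsumI[OF fc_ser_mult[OF assms], symmetric])
  also have "\<dots> = conv a (fc h) m"
    unfolding conv_def
    by (rule infsum_reindex_bij_witness[of _ "\<lambda>j. m - j" "\<lambda>j. m - j"]) auto
  finally show ?thesis .
qed

text \<open>\<open>fc_ser_mult\<close> for h = 1, whose only nonzero coefficient sits at 0.\<close>

lemma fc_ser:
  assumes "l1_le a A"
  shows "fc (ser a) m = a m"
proof -
  have "((\<lambda>j. a j * fc (\<lambda>_. 1) (m - j)) has_sum fc (\<lambda>\<theta>. ser a \<theta> * 1) m) UNIV"
    by (rule fc_ser_mult[OF assms]) simp
  moreover have "((\<lambda>j. a j * fc (\<lambda>_. 1) (m - j)) has_sum a m) UNIV"
    by (rule has_sum_finite_neutralI[of "{m}"]) (auto simp: fc_1)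
  ultimately show ?thesis by (simp add: has_sum_unique)
qed

text \<open>Parseval's identity, read off as the coefficient at 0 of the product of the series with
  its conjugate.\<close>

lemma nsq_ser_le:
  assumes a: "l1_le a A" and a2: "l2_le a C"
  shows "nsq (ser a) \<le> C\<^sup>2"
proof -
  have i: "integrable arc (\<lambda>\<theta>. cnj (ser a \<theta>))"
    by (rule bounded_meas_integrable[OF bounded_meas_cnj[OF ser_bounded_meas[OF a]]])
  have "complex_of_real (nsq (ser a)) = fc (\<lambda>\<theta>. ser a \<theta> * cnj (ser a \<theta>)) 0"
    unfolding nsq_complex fc_def by simp
  moreover have "((\<lambda>j. a j * cnj (a j)) has_sum fc (\<lambda>\<theta>. ser a \<theta> * cnj (ser a \<theta>)) 0) UNIV"
    using fc_ser_mult[OF a i, of 0] by (simp add: fc_cnj fc_ser[OF a])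
  ultimately have "((\<lambda>j. complex_of_real ((norm (a j))\<^sup>2)) has_sum complex_of_real (nsq (ser a))) UNIV"
    by (simp add: complex_norm_square del: of_real_power)
  then have "((\<lambda>j. (norm (a j))\<^sup>2) has_sum nsq (ser a)) UNIV"
    by (simp only: has_sum_of_real_iff)
  then show ?thesis
  proof (rule has_sum_le_finite_sums)
    fix F :: "int set" assume "finite F"
    then have "sqrt (\<Sum>j\<in>F. (norm (a j))\<^sup>2) \<le> C" using l2_leD[OF a2] by (simp add: L2_set_def)
    then show "(\<Sum>j\<in>F. (norm (a j))\<^sup>2) \<le> C\<^sup>2"
      using sqrt_le_D by blast
  qed
qed

lemma nsq_bounded_mult_le:
  assumes "bounded_meas \<phi> \<kappa>" "sq_int f"
  shows "nsq (\<lambda>\<theta>. \<phi> \<theta> * f \<theta>) \<le> \<kappa>\<^sup>2 * nsq f"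
proof -
  have "(LINT \<theta>|arc. (norm (\<phi> \<theta> * f \<theta>))\<^sup>2) \<le> (LINT \<theta>|arc. \<kappa>\<^sup>2 * (norm (f \<theta>))\<^sup>2)"
  proof (rule integral_mono)
    show "integrable arc (\<lambda>\<theta>. (norm (\<phi> \<theta> * f \<theta>))\<^sup>2)"
      using sq_int_bounded_mult[OF assms(2,1)] by (simp add: sq_int_def)
    show "integrable arc (\<lambda>\<theta>. \<kappa>\<^sup>2 * (norm (f \<theta>))\<^sup>2)" using assms(2) by (simp add: sq_int_def)
    fix \<theta>
    have "norm (\<phi> \<theta>) \<le> \<kappa>" using assms(1) by (simp add: bounded_meas_def)
    then show "(norm (\<phi> \<theta> * f \<theta>))\<^sup>2 \<le> \<kappa>\<^sup>2 * (norm (f \<theta>))\<^sup>2"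
      by (simp add: norm_mult power_mult_distrib mult_right_mono power_mono)
  qed
  then show ?thesis by (simp add: nsq_def divide_right_mono)
qed

text \<open>The norm of a multiplication operator is at most the supremum of its symbol, however
  large \<open>A\<close> is. Bessel's inequality gives this on trigonometric polynomials, and
  absolute summability lets the finite sections of \<open>a\<close> converge
  coefficientwise.\<close>

lemma conv_multiplier:
  assumes \<phi>: "bounded_meas \<phi> \<kappa>" and l1: "l1_le (fc \<phi>) A" and a: "l2_le a C"
  shows "l2_le (conv (fc \<phi>) a) (\<kappa> * C)"
proof (rule l2_le_lim[where F = "finite_subsets_at_top UNIV"
      and a = "\<lambda>F m. if finite F then \<Sum>j\<in>F. fc \<phi> (m - j) * a j else 0"])
  have \<kappa>: "0 \<le> \<kappa>" using \<phi> order_trans[OF norm_ge_zero[of "\<phi> 0"]] by (simp add: bounded_meas_def)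
  have C: "0 \<le> C" by (rule l2_le_nonneg[OF a])
  fix F :: "int set"
  show "l2_le (\<lambda>m. if finite F then \<Sum>j\<in>F. fc \<phi> (m - j) * a j else 0) (\<kappa> * C)"
  proof (cases "finite F")
    case True
    have eq: "fc (\<lambda>\<theta>. \<phi> \<theta> * trig_poly a F \<theta>) m = (\<Sum>j\<in>F. fc \<phi> (m - j) * a j)" for m
      using fc_trig_poly_mult[OF bounded_meas_integrable[OF \<phi>] True, of a m] by (simp add: mult.commute)
    have "(\<Sum>j\<in>F. (norm (a j))\<^sup>2) \<le> C\<^sup>2"
      using l2_leD[OF a True] by (simp add: L2_set_def sqrt_le_D)
    then have "\<kappa>\<^sup>2 * nsq (trig_poly a F) \<le> \<kappa>\<^sup>2 * C\<^sup>2"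
      unfolding nsq_trig_poly[OF True] by (rule mult_left_mono) simp
    then have "nsq (\<lambda>\<theta>. \<phi> \<theta> * trig_poly a F \<theta>) \<le> \<kappa>\<^sup>2 * C\<^sup>2"
      using nsq_bounded_mult_le[OF \<phi> sq_int_trig_poly[of a F]] by linarith
    then have "sqrt (nsq (\<lambda>\<theta>. \<phi> \<theta> * trig_poly a F \<theta>)) \<le> \<kappa> * C"
      using \<kappa> C by (intro real_le_lsqrt) (auto simp: nsq_def power_mult_distrib)
    then have "l2_le (fc (\<lambda>\<theta>. \<phi> \<theta> * trig_poly a F \<theta>)) (\<kappa> * C)"
      by (intro l2_le_mono[OF bessel[OF sq_int_bounded_mult[OF sq_int_trig_poly \<phi>]]]) auto
    then have "l2_le (\<lambda>m. fc (\<lambda>\<theta>. \<phi> \<theta> * trig_poly a F \<theta>) m) (\<kappa> * C)" .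
    then show ?thesis using True by (simp only: eq if_True)
  next
    case False
    then show ?thesis using \<kappa> C by (simp add: l2_le_mono[OF l2_le_zero])
  qed
next
  fix m
  have "((\<lambda>F. \<Sum>j\<in>F. fc \<phi> (m - j) * a j) \<longlongrightarrow> conv (fc \<phi>) a m) (finite_subsets_at_top UNIV)"
    unfolding conv_def by (rule infsum_tendsto[OF conv_summable[OF l1 a]])
  then show "((\<lambda>F. if finite F then \<Sum>j\<in>F. fc \<phi> (m - j) * a j else 0) \<longlongrightarrow> conv (fc \<phi>) a m) (finite_subsets_at_top UNIV)"
    by (rule Lim_transform_eventually) (rule eventually_finite_subsets_at_top_weakI, simp)
qed simp

text \<open>Completeness enters here: the function and its continuous series are both bounded and
  have the same coefficients.\<close>

lemma AE_eq_ser_fc: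
  assumes \<phi>: "bounded_meas \<phi> B" and l1: "l1_le (fc \<phi>) A"
  shows "AE \<theta> in arc. \<phi> \<theta> = ser (fc \<phi>) \<theta>"
proof -
  note s = ser_bounded_meas[OF l1]
  have "bounded_meas (\<lambda>\<theta>. \<phi> \<theta> - ser (fc \<phi>) \<theta>) (B + A)"
    using \<phi> s by (auto simp: bounded_meas_def intro!: norm_triangle_le_diff add_mono)
  moreover have "fc (\<lambda>\<theta>. \<phi> \<theta> - ser (fc \<phi>) \<theta>) m = 0" for m
    by (simp add: fc_diff[OF bounded_meas_integrable[OF \<phi>] bounded_meas_integrable[OF s]] fc_ser[OF l1])
  ultimately have "AE \<theta> in arc. \<phi> \<theta> - ser (fc \<phi>) \<theta> = 0"
    by (rule fc_zero_imp_AE_zero)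
  then show ?thesis by simp
qed

lemma fc_mult:
  assumes \<phi>: "bounded_meas \<phi> B" and l1: "l1_le (fc \<phi>) A" and h: "integrable arc h"
  shows "fc (\<lambda>\<theta>. \<phi> \<theta> * h \<theta>) m = conv (fc \<phi>) (fc h) m"
proof -
  have "fc (\<lambda>\<theta>. \<phi> \<theta> * h \<theta>) m = fc (\<lambda>\<theta>. ser (fc \<phi>) \<theta> * h \<theta>) m"
  proof (rule fc_cong_AE)
    show "AE \<theta> in arc. \<phi> \<theta> * h \<theta> = ser (fc \<phi>) \<theta> * h \<theta>"
      using AE_eq_ser_fc[OF \<phi> l1] by eventually_elim simp
  qed (use \<phi> h ser_bounded_meas[OF l1] in \<open>auto simp: bounded_meas_def\<close>)
  then show ?thesis by (simp add: fc_ser_mult_conv[OF l1 h])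
qed

section \<open>Boundary values of Cauchy integrals\<close>

lemma has_sum_geometric_int:
  fixes w :: "'a :: {real_normed_field, banach}"
  assumes "norm w < 1"
  shows "((\<lambda>j::int. if 0 \<le> j then w ^ nat j else 0) has_sum 1 / (1 - w)) UNIV"
proof -
  have "((\<lambda>n. w ^ n) has_sum 1 / (1 - w)) UNIV"
    by (rule norm_summable_imp_has_sum)
       (use assms in \<open>auto simp: norm_power summable_geometric intro: geometric_sums\<close>)
  then have "((\<lambda>j. w ^ nat j) has_sum 1 / (1 - w)) (range int)"
    by (subst has_sum_reindex) (auto simp: o_def)
  also have "range int = {0..}" by (auto intro: image_eqI[of _ _ "nat _"])
  finally show ?thesis
    by (rule has_sum_cong_neutral[THEN iffD1, rotated -1]) auto
qed

text \<open>\<open>ser (abel c t)\<close> is the harmonic extension of the series with coefficients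
  \<open>c\<close>, taken at radius \<open>t\<close>.\<close>

definition abel :: "(int \<Rightarrow> complex) \<Rightarrow> real \<Rightarrow> int \<Rightarrow> complex" where
  "abel c t j = of_real (t ^ nat \<bar>j\<bar>) * c j"

lemma norm_abel_le:
  assumes "0 \<le> t" "t \<le> 1"
  shows "norm (abel c t j) \<le> norm (c j)"
proof -
  have "t ^ nat \<bar>j\<bar> * norm (c j) \<le> 1 * norm (c j)"
    using assms by (intro mult_right_mono power_le_one) auto
  then show ?thesis using assms by (simp add: abel_def norm_mult norm_power)
qed

lemma l1_le_abel:
  assumes c: "\<And>j. norm (c j) \<le> C" and t: "0 \<le> t" "t < 1"
  obtains A where "l1_le (abel c t) A"
proof -
  have 1: "((\<lambda>j::int. if 0 \<le> j then t ^ nat j else 0) has_sum 1 / (1 - t)) UNIV"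
    using has_sum_geometric_int[of t] t by simp
  then have "((\<lambda>j::int. if 0 \<le> - j then t ^ nat (- j) else 0) has_sum 1 / (1 - t)) UNIV"
    by (rule has_sum_reindex_bij_witness[of _ uminus uminus, THEN iffD1, rotated -1]) auto
  from has_sum_add[OF 1 this]
  have s: "(\<lambda>j::int. (if 0 \<le> j then t ^ nat j else 0) + (if 0 \<le> - j then t ^ nat (- j) else 0)) summable_on UNIV"
    by (rule has_sum_imp_summable)
  have "(\<lambda>j. norm (abel c t j)) summable_on UNIV"
  proof (rule summable_on_comparison_test[OF summable_on_cmult_right[OF s]])
    fix j :: int
    have "t ^ nat \<bar>j\<bar> \<le> (if 0 \<le> j then t ^ nat j else 0) + (if 0 \<le> - j then t ^ nat (- j) else 0)"
      using t by (auto simp: abs_if)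
    moreover have "0 \<le> t ^ nat \<bar>j\<bar>" using t by simp
    ultimately have "norm (c j) * t ^ nat \<bar>j\<bar> \<le>
       C * ((if 0 \<le> j then t ^ nat j else 0) + (if 0 \<le> - j then t ^ nat (- j) else 0))"
      using c[of j] order_trans[OF norm_ge_zero c[of j]] by (intro mult_mono) auto
    then show "norm (abel c t j) \<le> C * ((if 0 \<le> j then t ^ nat j else 0) + (if 0 \<le> - j then t ^ nat (- j) else 0))"
      using t by (simp add: abel_def norm_mult norm_power mult.commute)
  qed auto
  from abs_summable_l1_le[OF this] show ?thesis by (rule that)
qed

text \<open>With d\<zeta> = \<i> \<zeta> d\<theta> the factor 1 / (2 pi \<i>) becomes the
  normalisation of \<open>fc\<close>, and the clockwise orientation leaves the sign.\<close>

lemma cauchy_integral_fc: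
  "cauchy_integral F z = - fc (\<lambda>\<theta>. cis \<theta> / (cis \<theta> - z) * F (cis \<theta>)) 0"
proof -
  have "(LINT \<theta>|arc. F (cis \<theta>) / (cis \<theta> - z) * (\<i> * cis \<theta>)) =
      (LINT \<theta>|arc. \<i> * (cis \<theta> / (cis \<theta> - z) * F (cis \<theta>)))"
    by (intro Bochner_Integration.integral_cong refl) simp
  also have "\<dots> = \<i> * (LINT \<theta>|arc. cis \<theta> / (cis \<theta> - z) * F (cis \<theta>))"
    by (rule Bochner_Integration.integral_mult_right_zero)
  finally have "cauchy_integral F z = 1 / (2 * pi * \<i>) * - (\<i> * (LINT \<theta>|arc. cis \<theta> / (cis \<theta> - z) * F (cis \<theta>)))"
    by (simp only: cauchy_integral_def circle_integral_def)
  moreover have "fc (\<lambda>\<theta>. cis \<theta> / (cis \<theta> - z) * F (cis \<theta>)) 0 = (LINT \<theta>|arc. cis \<theta> / (cis \<theta> - z) * F (cis \<theta>)) / (2 * pi)"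
    unfolding fc_def by simp
  moreover have "1 / (2 * pi * \<i>) * - (\<i> * X) = - (X / (2 * pi))" for X :: complex
    by simp
  ultimately show ?thesis by (simp only:)
qed

lemma cis_power_nat: "cis \<theta> ^ nat j = cis (of_int j * \<theta>)" if "0 \<le> j"
  using that by (simp add: Complex.DeMoivre)

text \<open>For |z| < 1 the kernel \<zeta> / (\<zeta> - z) is a geometric series in z / \<zeta>, so
  the coefficient at 0 of its product with \<open>F\<close> picks the frequencies j \<ge> 0 of
  \<open>F\<close>, damped by t^j.\<close>

lemma cauchy_integral_inside:
  assumes F: "sq_int (\<lambda>\<theta>. F (cis \<theta>))" and t: "0 \<le> t" "t < 1"
  shows "cauchy_integral F (of_real t * cis \<alpha>) =
     ser (abel (\<lambda>j. if 0 \<le> j then - fc (\<lambda>\<theta>. F (cis \<theta>)) j else 0) t) \<alpha>"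
proof -
  define c where "c = fc (\<lambda>\<theta>. F (cis \<theta>))"
  define z where "z = of_real t * cis \<alpha>"
  define a where "a j = (if 0 \<le> - j then z ^ nat (- j) else 0)" for j :: int
  have z: "norm z < 1" using t by (simp add: z_def norm_mult)
  have ps: "((\<lambda>j. a j * cis (of_int j * \<theta>)) has_sum cis \<theta> / (cis \<theta> - z)) UNIV" for \<theta>
  proof -
    have "norm (z * cis (- \<theta>)) < 1" using z by (simp add: norm_mult)
    from has_sum_geometric_int[OF this]
    have "((\<lambda>j. if 0 \<le> - j then (z * cis (- \<theta>)) ^ nat (- j) else 0) has_sum 1 / (1 - z * cis (- \<theta>))) UNIV"
      by (rule has_sum_reindex_bij_witness[of _ uminus uminus, THEN iffD1, rotated -1]) auto
    moreover have "(if 0 \<le> - j then (z * cis (- \<theta>)) ^ nat (- j) else 0) = a j * cis (of_int j * \<theta>)" for j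
      by (simp add: a_def power_mult_distrib cis_power_nat)
    moreover have "1 / (1 - z * cis (- \<theta>)) = cis \<theta> / (cis \<theta> - z)"
    proof -
      have "1 / (1 - z * cis (- \<theta>)) = (cis \<theta> * 1) / (cis \<theta> * (1 - z * cis (- \<theta>)))"
        by (rule mult_divide_mult_cancel_left[symmetric]) simp
      also have "cis \<theta> * (1 - z * cis (- \<theta>)) = cis \<theta> - z"
        by (simp add: right_diff_distrib mult.left_commute cis_mult)
      finally show ?thesis by simp
    qed
    ultimately show ?thesis by simp
  qed
  have "((\<lambda>j. norm (if 0 \<le> - j then z ^ nat (- j) else 0)) has_sum 1 / (1 - norm z)) UNIV"
  proof -
    have "((\<lambda>j::int. if 0 \<le> - j then norm z ^ nat (- j) else 0) has_sum 1 / (1 - norm z)) UNIV"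
      by (rule has_sum_reindex_bij_witness[of _ uminus uminus, THEN iffD1, rotated -1,
            OF has_sum_geometric_int[of "norm z"]]) (use z in auto)
    then show ?thesis by (simp add: if_distrib[of norm] norm_power cong: if_cong)
  qed
  then obtain A where a: "l1_le a A"
    using abs_summable_l1_le[of a] by (auto simp: a_def[abs_def] dest: has_sum_imp_summable)
  have sa: "ser a \<theta> = cis \<theta> / (cis \<theta> - z)" for \<theta>
    unfolding ser_def by (rule infsumI[OF ps])
  have "fc (\<lambda>\<theta>. cis \<theta> / (cis \<theta> - z) * F (cis \<theta>)) 0 = (\<Sum>\<^sub>\<infinity>j. a j * c (0 - j))"
    using infsumI[OF fc_ser_mult[OF a sq_int_integrable[OF F], of 0]] by (simp add: sa c_def)
  also have "\<dots> = (\<Sum>\<^sub>\<infinity>j. - (abel (\<lambda>j. if 0 \<le> j then - c j else 0) t j * cis (of_int j * \<alpha>)))"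
    by (rule infsum_reindex_bij_witness[of _ uminus uminus])
       (auto simp: a_def abel_def z_def power_mult_distrib cis_power_nat)
  also have "\<dots> = - ser (abel (\<lambda>j. if 0 \<le> j then - c j else 0) t) \<alpha>"
    by (simp add: ser_def infsum_uminus)
  finally show ?thesis
    unfolding cauchy_integral_fc z_def[symmetric] c_def[symmetric] by simp
qed

text \<open>For |z| > 1 the kernel \<zeta> / (\<zeta> - z) is minus the geometric series in w
  \<zeta> = \<zeta> / z without its zeroth term. So only negative frequencies appear, and the
  frequency 0 belongs to the inside.\<close>

lemma cauchy_integral_outside:
  assumes F: "sq_int (\<lambda>\<theta>. F (cis \<theta>))" and e: "0 < e"
  shows "cauchy_integral F (of_real (1 + e) * cis \<alpha>) =
     ser (abel (\<lambda>j. if j < 0 then fc (\<lambda>\<theta>. F (cis \<theta>)) j else 0) (1 / (1 + e))) \<alpha>"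
proof -
  define c where "c = fc (\<lambda>\<theta>. F (cis \<theta>))"
  define t where "t = 1 / (1 + e)"
  define w where "w = of_real t * cis (- \<alpha>)"
  define z where "z = of_real (1 + e) * cis \<alpha>"
  define a where "a j = (if 0 < j then - (w ^ nat j) else 0)" for j :: int
  have t: "0 \<le> t" "t < 1" using e by (auto simp: t_def)
  have w: "norm w < 1" using t by (simp add: w_def norm_mult)
  have wz: "w * z = 1"
  proof -
    have "w * z = of_real (t * (1 + e)) * (cis (- \<alpha>) * cis \<alpha>)"
      by (simp add: w_def z_def)
    also have "\<dots> = 1" using e by (simp add: t_def cis_mult del: of_real_mult of_real_add)
    finally show ?thesis .
  qed
  have geo: "((\<lambda>j::int. if 0 < j then v ^ nat j else 0) has_sum 1 / (1 - v) - 1) UNIV"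
    if "norm v < 1" for v :: "'b :: {real_normed_field, banach}"
  proof -
    have "((\<lambda>j::int. if j = 0 then - 1 else 0 :: 'b) has_sum - 1) UNIV"
      by (rule has_sum_finite_neutralI[of "{0}"]) auto
    from has_sum_add[OF has_sum_geometric_int[OF that] this]
    have "((\<lambda>j::int. (if 0 \<le> j then v ^ nat j else 0) + (if j = 0 then - 1 else 0)) has_sum 1 / (1 - v) - 1) UNIV"
      by simp
    moreover have "(if 0 \<le> j then v ^ nat j else 0) + (if j = 0 then - 1 else 0) = (if 0 < j then v ^ nat j else 0)" for j
      by auto
    ultimately show ?thesis by simp
  qed
  have ps: "((\<lambda>j. a j * cis (of_int j * \<theta>)) has_sum cis \<theta> / (cis \<theta> - z)) UNIV" for \<theta>
  proof -
    have n: "norm (w * cis \<theta>) < 1" using w by (simp add: norm_mult)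
    have "((\<lambda>j. - (if 0 < j then (w * cis \<theta>) ^ nat j else 0)) has_sum - (1 / (1 - w * cis \<theta>) - 1)) UNIV"
      using geo[OF n] by (simp only: has_sum_uminus minus_minus)
    moreover have "- (if 0 < j then (w * cis \<theta>) ^ nat j else 0) = a j * cis (of_int j * \<theta>)" for j
      by (simp add: a_def power_mult_distrib cis_power_nat)
    moreover have "- (1 / (1 - w * cis \<theta>) - 1) = cis \<theta> / (cis \<theta> - z)"
    proof -
      have ne: "1 - w * cis \<theta> \<noteq> 0" using n by (metis eq_iff_diff_eq_0 norm_one order_less_irrefl)
      have z0: "z \<noteq> 0" using wz by auto
      have eq: "cis \<theta> - z = - z * (1 - w * cis \<theta>)"
        using wz by (simp add: algebra_simps)
      have "- (1 / (1 - w * cis \<theta>) - 1) = - (w * cis \<theta>) / (1 - w * cis \<theta>)"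
        using ne by (simp add: field_simps)
      also have "\<dots> = (- z * - (w * cis \<theta>)) / (- z * (1 - w * cis \<theta>))"
        by (rule mult_divide_mult_cancel_left[symmetric]) (use z0 in simp)
      also have "- z * - (w * cis \<theta>) = cis \<theta>" using wz by (simp add: mult.assoc[symmetric] mult.commute)
      finally show ?thesis unfolding eq .
    qed
    ultimately show ?thesis by simp
  qed
  have "((\<lambda>j::int. if 0 < j then norm w ^ nat j else 0) has_sum 1 / (1 - norm w) - 1) UNIV"
    by (rule geo) (use w in simp)
  then have "((\<lambda>j. norm (a j)) has_sum 1 / (1 - norm w) - 1) UNIV"
    by (simp add: a_def if_distrib[of norm] norm_power cong: if_cong)
  then obtain A where a: "l1_le a A"
    using abs_summable_l1_le[of a] by (auto dest: has_sum_imp_summable)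
  have sa: "ser a \<theta> = cis \<theta> / (cis \<theta> - z)" for \<theta>
    unfolding ser_def by (rule infsumI[OF ps])
  have "fc (\<lambda>\<theta>. cis \<theta> / (cis \<theta> - z) * F (cis \<theta>)) 0 = (\<Sum>\<^sub>\<infinity>j. a j * c (0 - j))"
    using infsumI[OF fc_ser_mult[OF a sq_int_integrable[OF F], of 0]] by (simp add: sa c_def)
  also have "\<dots> = (\<Sum>\<^sub>\<infinity>j. - (abel (\<lambda>j. if j < 0 then c j else 0) t j * cis (of_int j * \<alpha>)))"
    by (rule infsum_reindex_bij_witness[of _ uminus uminus])
       (auto simp: a_def abel_def w_def power_mult_distrib cis_power_nat)
  also have "\<dots> = - ser (abel (\<lambda>j. if j < 0 then c j else 0) t) \<alpha>"
    by (simp add: ser_def infsum_uminus)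
  finally show ?thesis
    unfolding cauchy_integral_fc z_def[symmetric] c_def[symmetric] t_def[symmetric] by simp
qed

text \<open>Abel's theorem in the absolutely convergent case: the series converges uniformly for t
  in the closed interval {0..1}.\<close>

lemma ser_abel_tendsto:
  assumes c: "l1_le c C"
  shows "((\<lambda>t. ser (abel c t) \<theta>) \<longlongrightarrow> ser c \<theta>) (at_left 1)"
proof -
  have "uniform_limit {0..1} (\<lambda>F t. \<Sum>j\<in>F. abel c t j * cis (of_int j * \<theta>))
     (\<lambda>t. \<Sum>\<^sub>\<infinity>j. abel c t j * cis (of_int j * \<theta>)) (finite_subsets_at_top UNIV)"
    by (rule Weierstrass_m_test_general[where M = "\<lambda>j. norm (c j)"])
       (use l1_le_abs_summable[OF c] in \<open>auto simp: norm_mult intro!: norm_abel_le\<close>)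
  then have "continuous_on {0..1} (\<lambda>t. ser (abel c t) \<theta>)"
    unfolding ser_def
    by (rule uniform_limit_theorem[rotated])
       (auto simp: abel_def intro!: always_eventually continuous_on_sum continuous_intros)
  then have "((\<lambda>t. ser (abel c t) \<theta>) \<longlongrightarrow> ser (abel c 1) \<theta>) (at_left 1)"
    by (rule continuous_on_Icc_at_leftD) simp
  then show ?thesis by (simp add: abel_def[abs_def])
qed

text \<open>
  The Abel means are bounded in \<open>L\<^sup>2\<close>, so they are uniformly integrable and almost everywhere
  convergence carries over to the Fourier coefficients; this is made quantitative by
  \<open>x \<le> min x M + x\<^sup>2 / M\<close>.
\<close>

lemma fc_of_radial_limit:
  assumes c: "l2_le c C" and A: "sq_int A"
    and t: "\<And>n. 0 \<le> t n" "\<And>n. t n < 1" "t \<longlonglongrightarrow> 1"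
    and lim: "AE \<theta> in arc. (\<lambda>n. ser (abel c (t n)) \<theta>) \<longlonglongrightarrow> A \<theta>"
  shows "fc A m = c m"
proof -
  define h where "h n = ser (abel c (t n))" for n
  define D where "D n \<theta> = h n \<theta> - A \<theta>" for n \<theta>
  have C: "0 \<le> C" using c by (rule l2_le_nonneg)
  have l1: "\<exists>L. l1_le (abel c (t n)) L" for n
    using l1_le_abel[of c C "t n"] l2_le_norm[OF c] t by metis
  have abel2: "l2_le (abel c (t n)) C" for n
    using norm_abel_le[OF t(1)[of n] less_imp_le[OF t(2)[of n]]] by (rule l2_le_mono[OF c]) simp
  have hb: "\<exists>B. bounded_meas (h n) B" for n
    using l1[of n] ser_bounded_meas unfolding h_def by blast
  have hs: "sq_int (h n)" for n
    using hb[of n] bounded_meas_sq_int by blast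
  have h2: "nsq (h n) \<le> C\<^sup>2" for n
    using l1[of n] nsq_ser_le[OF _ abel2[of n]] unfolding h_def by blast
  have Ds: "sq_int (D n)" for n
    unfolding D_def[abs_def] by (rule sq_int_diff[OF hs A])
  \<comment> \<open>A bound, uniform in \<open>n\<close>, for the integral of |D n|^2, from |h -
    A|^2 \<le> 2 |h|^2 + 2 |A|^2; the factor 2 * pi undoes the normalisation of
    \<open>nsq\<close>.\<close>
  define K where "K = 2 * (2 * pi * C\<^sup>2) + 2 * (LINT \<theta>|arc. (norm (A \<theta>))\<^sup>2)"
  have D2: "(LINT \<theta>|arc. (norm (D n \<theta>))\<^sup>2) \<le> K" for n
  proof -
    have "(LINT \<theta>|arc. (norm (D n \<theta>))\<^sup>2) \<le> (LINT \<theta>|arc. 2 * (norm (h n \<theta>))\<^sup>2 + 2 * (norm (A \<theta>))\<^sup>2)"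
    proof (rule integral_mono)
      show "integrable arc (\<lambda>\<theta>. (norm (D n \<theta>))\<^sup>2)" using Ds by (simp add: sq_int_def)
      show "integrable arc (\<lambda>\<theta>. 2 * (norm (h n \<theta>))\<^sup>2 + 2 * (norm (A \<theta>))\<^sup>2)"
        using hs[of n] A by (simp add: sq_int_def)
      fix \<theta>
      have "(norm (D n \<theta>))\<^sup>2 \<le> (norm (h n \<theta>) + norm (A \<theta>))\<^sup>2"
        unfolding D_def by (intro power_mono norm_triangle_ineq4) auto
      also have "\<dots> \<le> 2 * (norm (h n \<theta>))\<^sup>2 + 2 * (norm (A \<theta>))\<^sup>2"
        using sum_squares_bound[of "norm (h n \<theta>)" "norm (A \<theta>)"] by (simp add: power2_sum)
      finally show "(norm (D n \<theta>))\<^sup>2 \<le> 2 * (norm (h n \<theta>))\<^sup>2 + 2 * (norm (A \<theta>))\<^sup>2" .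
    qed
    also have "\<dots> = 2 * (2 * pi * nsq (h n)) + 2 * (LINT \<theta>|arc. (norm (A \<theta>))\<^sup>2)"
      using hs[of n] A by (simp add: sq_int_def nsq_def)
    also have "\<dots> \<le> K"
      using h2[of n] by (simp add: K_def)
    finally show ?thesis .
  qed
  have Dm: "D n \<in> borel_measurable arc" for n using Ds by (simp add: sq_int_def)
  have bound: "norm (c m - fc A m) \<le> K / M / (2 * pi)" if M: "0 < M" for M
  proof -
    have imin: "integrable arc (\<lambda>\<theta>. min (norm (D n \<theta>)) M)" for n
      by (rule finite_measure.integrable_const_bound[OF finite_measure_arc, of _ M]) (use M Dm in auto)
    have min0: "(\<lambda>n. LINT \<theta>|arc. min (norm (D n \<theta>)) M) \<longlonglongrightarrow> (LINT \<theta>|arc. 0)"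
    proof (rule integral_dominated_convergence[where w = "\<lambda>_. M"])
      show "AE \<theta> in arc. (\<lambda>n. min (norm (D n \<theta>)) M) \<longlonglongrightarrow> 0"
        using lim
      proof eventually_elim
        case (elim \<theta>)
        have "(\<lambda>n. D n \<theta>) \<longlonglongrightarrow> 0"
          unfolding D_def h_def using elim by (simp add: LIM_zero)
        then have "(\<lambda>n. min (norm (D n \<theta>)) M) \<longlonglongrightarrow> min (norm (0::complex)) M"
          by (intro tendsto_intros)
        then show ?case using M by simp
      qed
      show "AE \<theta> in arc. norm (min (norm (D n \<theta>)) M) \<le> M" for n using M by auto
    qed (use Dm in auto)
    have le: "norm (fc (h n) m - fc A m) \<le> ((LINT \<theta>|arc. min (norm (D n \<theta>)) M) + K / M) / (2 * pi)" for n
    proof -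
      have "fc (h n) m - fc A m = fc (D n) m"
        unfolding D_def[abs_def] by (simp add: fc_diff[OF sq_int_integrable[OF hs] sq_int_integrable[OF A]])
      also have "norm \<dots> \<le> (LINT \<theta>|arc. norm (D n \<theta>)) / (2 * pi)"
        by (rule fc_norm_le[OF integrable_norm[OF sq_int_integrable[OF Ds]]])
      also have "(LINT \<theta>|arc. norm (D n \<theta>)) \<le> (LINT \<theta>|arc. min (norm (D n \<theta>)) M + (norm (D n \<theta>))\<^sup>2 / M)"
      proof (rule integral_mono)
        show "integrable arc (\<lambda>\<theta>. norm (D n \<theta>))"
          by (rule integrable_norm[OF sq_int_integrable[OF Ds]])
        show "integrable arc (\<lambda>\<theta>. min (norm (D n \<theta>)) M + (norm (D n \<theta>))\<^sup>2 / M)"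
          using imin[of n] Ds[of n] by (simp add: sq_int_def)
        fix \<theta>
        show "norm (D n \<theta>) \<le> min (norm (D n \<theta>)) M + (norm (D n \<theta>))\<^sup>2 / M"
        proof (cases "norm (D n \<theta>) \<le> M")
          case True
          then show ?thesis using M by simp
        next
          case False
          then have "norm (D n \<theta>) * M \<le> norm (D n \<theta>) * norm (D n \<theta>)"
            by (intro mult_left_mono) auto
          then have "norm (D n \<theta>) \<le> (norm (D n \<theta>))\<^sup>2 / M"
            using M by (simp add: pos_le_divide_eq power2_eq_square)
          then show ?thesis using M False by simp
        qed
      qed
      also have "\<dots> = (LINT \<theta>|arc. min (norm (D n \<theta>)) M) + (LINT \<theta>|arc. (norm (D n \<theta>))\<^sup>2) / M"
        using imin[of n] Ds[of n] by (simp add: sq_int_def)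
      also have "\<dots> \<le> (LINT \<theta>|arc. min (norm (D n \<theta>)) M) + K / M"
        using D2[of n] M by (simp add: divide_right_mono)
      finally show ?thesis by (simp add: divide_right_mono)
    qed
    have "fc (h n) m = of_real (t n ^ nat \<bar>m\<bar>) * c m" for n
      using l1[of n] fc_ser unfolding h_def by (metis abel_def)
    then have "(\<lambda>n. fc (h n) m) \<longlonglongrightarrow> of_real (1 ^ nat \<bar>m\<bar>) * c m"
      by (simp only:) (intro tendsto_intros t(3))
    then have "(\<lambda>n. norm (fc (h n) m - fc A m)) \<longlonglongrightarrow> norm (c m - fc A m)"
      by (intro tendsto_intros) simp
    moreover have "(\<lambda>n. ((LINT \<theta>|arc. min (norm (D n \<theta>)) M) + K / M) / (2 * pi)) \<longlonglongrightarrow> (0 + K / M) / (2 * pi)"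
      using min0 by (intro tendsto_intros) auto
    ultimately have "norm (c m - fc A m) \<le> (0 + K / M) / (2 * pi)"
      by (rule LIMSEQ_le) (use le in blast)
    then show ?thesis by simp
  qed
  \<comment> \<open>\<open>M\<close> goes to infinity after the limit in \<open>n\<close> has
    removed the truncated part.\<close>
  have "((\<lambda>M. K / M / (2 * pi)) \<longlongrightarrow> 0) at_top"
    by real_asymp
  then have "norm (c m - fc A m) \<le> 0"
  proof (rule tendsto_lowerbound)
    show "\<forall>\<^sub>F M in at_top. norm (c m - fc A m) \<le> K / M / (2 * pi)"
      using eventually_gt_at_top[of 0] by eventually_elim (rule bound)
  qed simp
  then show ?thesis by simp
qed

text \<open>Absolute summability makes the radial limit exist at every angle, with the series as its
  value; exceptional angles come from the choice of \<open>G\<close>.\<close>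

lemma cauchy_minusI:
  assumes F: "sq_int (\<lambda>\<theta>. F (cis \<theta>))"
    and c: "l1_le (\<lambda>j. if 0 \<le> j then - fc (\<lambda>\<theta>. F (cis \<theta>)) j else 0) C"
    and G: "AE \<theta> in arc. G (cis \<theta>) = ser (\<lambda>j. if 0 \<le> j then - fc (\<lambda>\<theta>. F (cis \<theta>)) j else 0) \<theta>"
  shows "cauchy_minus F G"
  unfolding cauchy_minus_def using G
proof eventually_elim
  case (elim \<theta>)
  define c where "c = (\<lambda>j. if 0 \<le> j then - fc (\<lambda>\<theta>. F (cis \<theta>)) j else 0)"
  have "filterlim (\<lambda>\<epsilon>. 1 + \<epsilon>) (at_left 1) (at_left (0::real))"
    by real_asymp
  then have "((\<lambda>\<epsilon>. ser (abel c (1 + \<epsilon>)) \<theta>) \<longlongrightarrow> ser c \<theta>) (at_left 0)"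
    using ser_abel_tendsto[OF assms(2), of \<theta>] unfolding c_def by (rule filterlim_compose[rotated])
  moreover have "\<forall>\<^sub>F \<epsilon> in at_left (0::real). ser (abel c (1 + \<epsilon>)) \<theta> = cauchy_integral F (of_real (1 + \<epsilon>) * cis \<theta>)"
    using eventually_at_left_real[of "-1" 0, OF neg_less_0_iff_less[THEN iffD2, OF zero_less_one]]
    by eventually_elim (unfold c_def, rule cauchy_integral_inside[OF F, symmetric], auto)
  ultimately show ?case
    unfolding elim c_def[symmetric] by (rule Lim_transform_eventually)
qed

lemma cauchy_plusI:
  assumes F: "sq_int (\<lambda>\<theta>. F (cis \<theta>))"
    and c: "l1_le (\<lambda>j. if j < 0 then fc (\<lambda>\<theta>. F (cis \<theta>)) j else 0) C"
    and G: "AE \<theta> in arc. G (cis \<theta>) = ser (\<lambda>j. if j < 0 then fc (\<lambda>\<theta>. F (cis \<theta>)) j else 0) \<theta>"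
  shows "cauchy_plus F G"
  unfolding cauchy_plus_def using G
proof eventually_elim
  case (elim \<theta>)
  define c where "c = (\<lambda>j. if j < 0 then fc (\<lambda>\<theta>. F (cis \<theta>)) j else 0)"
  have "filterlim (\<lambda>\<epsilon>. 1 / (1 + \<epsilon>)) (at_left 1) (at_right (0::real))"
    by real_asymp
  then have "((\<lambda>\<epsilon>. ser (abel c (1 / (1 + \<epsilon>))) \<theta>) \<longlongrightarrow> ser c \<theta>) (at_right 0)"
    using ser_abel_tendsto[OF assms(2), of \<theta>] unfolding c_def by (rule filterlim_compose[rotated])
  moreover have "\<forall>\<^sub>F \<epsilon> in at_right (0::real). ser (abel c (1 / (1 + \<epsilon>))) \<theta> = cauchy_integral F (of_real (1 + \<epsilon>) * cis \<theta>)"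
    using eventually_at_right_real[OF zero_less_one]
    by eventually_elim (unfold c_def, rule cauchy_integral_outside[OF F, symmetric], auto)
  ultimately show ?case
    unfolding elim c_def[symmetric] by (rule Lim_transform_eventually)
qed

text \<open>The converse for an arbitrary square integrable \<open>F\<close>, where the series of
  the limit need not converge absolutely: the limit is sampled along a sequence of radii and
  identified through \<open>fc_of_radial_limit\<close>.\<close>

lemma cauchy_minusD:
  assumes F: "sq_int (\<lambda>\<theta>. F (cis \<theta>))" and G: "sq_int G"
    and FG: "cauchy_minus F G'" and eq: "AE \<theta> in arc. G' (cis \<theta>) = G \<theta>"
  shows "fc G m = (if 0 \<le> m then - fc (\<lambda>\<theta>. F (cis \<theta>)) m else 0)"
proof -
  define c where "c = (\<lambda>j. if 0 \<le> j then - fc (\<lambda>\<theta>. F (cis \<theta>)) j else 0)"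
  define t where "t n = 1 + - (1 / (real n + 2))" for n
  have t: "0 \<le> t n" "t n < 1" for n by (auto simp: t_def divide_simps)
  have "fc G m = c m"
  proof (rule fc_of_radial_limit[OF l2_le_mono[OF bessel[OF F]] G t])
    show "norm (c j) \<le> norm (fc (\<lambda>\<theta>. F (cis \<theta>)) j)" for j by (simp add: c_def)
    show "t \<longlonglongrightarrow> 1" unfolding t_def by real_asymp
    have fl: "filterlim (\<lambda>n. - (1 / (real n + 2))) (at_left 0) sequentially"
      by real_asymp
    show "AE \<theta> in arc. (\<lambda>n. ser (abel c (t n)) \<theta>) \<longlonglongrightarrow> G \<theta>"
      using FG[unfolded cauchy_minus_def] eq
    proof eventually_elim
      case (elim \<theta>)
      have "(\<lambda>n. cauchy_integral F (of_real (t n) * cis \<theta>)) \<longlonglongrightarrow> G' (cis \<theta>)"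
        unfolding t_def by (rule filterlim_compose[OF elim(1) fl])
      then show ?case
        unfolding cauchy_integral_inside[OF F t] c_def[symmetric] elim(2) .
    qed
  qed (rule order_refl)
  then show ?thesis by (simp add: c_def)
qed

lemma cauchy_plusD:
  assumes F: "sq_int (\<lambda>\<theta>. F (cis \<theta>))" and G: "sq_int G"
    and FG: "cauchy_plus F G'" and eq: "AE \<theta> in arc. G' (cis \<theta>) = G \<theta>"
  shows "fc G m = (if m < 0 then fc (\<lambda>\<theta>. F (cis \<theta>)) m else 0)"
proof -
  define c where "c = (\<lambda>j. if j < 0 then fc (\<lambda>\<theta>. F (cis \<theta>)) j else 0)"
  define e where "e n = 1 / (real n + 1)" for n
  have e: "0 < e n" for n by (auto simp: e_def divide_simps)
  have "fc G m = c m"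
  proof (rule fc_of_radial_limit[OF l2_le_mono[OF bessel[OF F]] G, of c _ "\<lambda>n. 1 / (1 + e n)"])
    show "norm (c j) \<le> norm (fc (\<lambda>\<theta>. F (cis \<theta>)) j)" for j by (simp add: c_def)
    show "0 \<le> 1 / (1 + e n)" "1 / (1 + e n) < 1" for n using e[of n] by auto
    show "(\<lambda>n. 1 / (1 + e n)) \<longlonglongrightarrow> 1" unfolding e_def by real_asymp
    have fl: "filterlim e (at_right 0) sequentially"
      unfolding e_def by real_asymp
    show "AE \<theta> in arc. (\<lambda>n. ser (abel c (1 / (1 + e n))) \<theta>) \<longlonglongrightarrow> G \<theta>"
      using FG[unfolded cauchy_plus_def] eq
    proof eventually_elim
      case (elim \<theta>)
      have "(\<lambda>n. cauchy_integral F (of_real (1 + e n) * cis \<theta>)) \<longlonglongrightarrow> G' (cis \<theta>)"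
        by (rule filterlim_compose[OF elim(1) fl])
      then show ?case
        unfolding cauchy_integral_outside[OF F e] c_def[symmetric] elim(2) .
    qed
  qed (rule order_refl)
  then show ?thesis by (simp add: c_def)
qed

section \<open>Sobolev functions and the symbol\<close>

text \<open>Tested against these exponentials, a weak derivative acts on Fourier coefficients as
  multiplication by a power of \<i> m.\<close>

lemma test_function_cis: "test_function (\<lambda>j \<theta>. (- \<i> * of_int m) ^ j * cis (- (of_int m * \<theta>)))"
  unfolding test_function_def
proof (intro conjI allI)
  fix t :: real
  have "cis (- (of_int m * (t + 2 * pi))) = cis (- (of_int m * t)) * cis (2 * pi * of_int (- m))"
    unfolding cis_mult by (rule arg_cong[where f = cis]) (simp add: algebra_simps)
  also have "cis (2 * pi * of_int (- m)) = 1"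
    by (rule cis_multiple_2pi) simp
  finally show "(- \<i> * of_int m) ^ 0 * cis (- (of_int m * (t + 2 * pi))) = (- \<i> * of_int m) ^ 0 * cis (- (of_int m * t))"
    by simp
next
  fix j t
  have "((\<lambda>\<theta>. exp (- \<i> * of_int m * of_real \<theta>)) has_vector_derivative (- \<i> * of_int m * exp (- \<i> * of_int m * of_real t))) (at t)"
    by (auto intro!: derivative_eq_intros has_vector_derivative_real_field)
  then have "((\<lambda>\<theta>. cis (- (of_int m * \<theta>))) has_vector_derivative (- \<i> * of_int m * cis (- (of_int m * t)))) (at t)"
    by (simp add: cis_conv_exp mult.assoc)
  from has_vector_derivative_mult_right[OF this, of "(- \<i> * of_int m) ^ j"]
  show "((\<lambda>\<theta>. (- \<i> * of_int m) ^ j * cis (- (of_int m * \<theta>))) has_vector_derivative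
      (- \<i> * of_int m) ^ Suc j * cis (- (of_int m * t))) (at t)"
    by (simp add: mult_ac)
qed

lemma weak_derivative_fc:
  assumes "weak_derivative k f g"
  shows "(\<i> * of_int m) ^ k * fc (\<lambda>\<theta>. f (cis \<theta>)) m = fc (\<lambda>\<theta>. g (cis \<theta>)) m"
proof -
  have "(LINT \<theta>|arc. f (cis \<theta>) * ((- \<i> * of_int m) ^ k * cis (- (of_int m * \<theta>)))) =
      (- 1) ^ k * (LINT \<theta>|arc. g (cis \<theta>) * ((- \<i> * of_int m) ^ 0 * cis (- (of_int m * \<theta>))))"
    using assms test_function_cis[of m] unfolding weak_derivative_def by blast
  moreover have "(LINT \<theta>|arc. f (cis \<theta>) * ((- \<i> * of_int m) ^ k * cis (- (of_int m * \<theta>)))) =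
      (LINT \<theta>|arc. (- \<i> * of_int m) ^ k * (f (cis \<theta>) * cis (- (of_int m * \<theta>))))"
    by (rule Bochner_Integration.integral_cong) (simp_all add: mult.left_commute)
  moreover have "\<dots> = (- \<i> * of_int m) ^ k * (LINT \<theta>|arc. f (cis \<theta>) * cis (- (of_int m * \<theta>)))"
    by (rule Bochner_Integration.integral_mult_right_zero)
  ultimately have eq: "(- \<i> * of_int m) ^ k * fc (\<lambda>\<theta>. f (cis \<theta>)) m = (- 1) ^ k * fc (\<lambda>\<theta>. g (cis \<theta>)) m"
    by (simp add: fc_def)
  have "(- 1) ^ k * (- \<i> * of_int m) ^ k = (\<i> * of_int m) ^ k"
    unfolding power_mult_distrib[symmetric] by simp
  moreover have "(- 1) ^ k * (- 1 :: complex) ^ k = 1"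
    unfolding power_mult_distrib[symmetric] by simp
  ultimately show ?thesis
    using arg_cong[OF eq, of "\<lambda>x. (- 1) ^ k * x"] by (simp only: mult.assoc[symmetric] mult_1_left)
qed

lemma L2_circle_iff: "f \<in> L2_circle \<longleftrightarrow> sq_int (\<lambda>\<theta>. f (cis \<theta>))"
  by (simp add: L2_circle_def sq_int_def)

text \<open>Bessel's inequality for \<open>f\<close> and for its k-th derivative, combined through
  (1 + |m|)^k \<le> 2^k (1 + |m|^k).\<close>

lemma sobolev_circle_sob:
  assumes f: "f \<in> sobolev_circle k" and k: "1 \<le> k"
  shows "sob k (fc (\<lambda>\<theta>. f (cis \<theta>)))"
proof -
  define c where "c = fc (\<lambda>\<theta>. f (cis \<theta>))"
  have f2: "sq_int (\<lambda>\<theta>. f (cis \<theta>))" using f by (simp add: sobolev_circle_def L2_circle_iff)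
  obtain g where g: "g \<in> L2_circle" "weak_derivative k f g"
    using f k unfolding sobolev_circle_def by fastforce
  define d where "d = fc (\<lambda>\<theta>. g (cis \<theta>))"
  define S where "S m = complex_of_real (norm (c m)) + complex_of_real (norm (d m))" for m
  have "l2_le (\<lambda>m. complex_of_real (norm (c m))) (sqrt (nsq (\<lambda>\<theta>. f (cis \<theta>))))"
    by (rule l2_le_mono[OF bessel[OF f2]]) (simp_all add: c_def)
  moreover have "l2_le (\<lambda>m. complex_of_real (norm (d m))) (sqrt (nsq (\<lambda>\<theta>. g (cis \<theta>))))"
    by (rule l2_le_mono[OF bessel[OF g(1)[unfolded L2_circle_iff]]]) (simp_all add: d_def)
  ultimately obtain C where C: "l2_le S C"
    unfolding S_def[abs_def] using l2_le_add by blast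
  have "l2_le (\<lambda>m. of_real (wt m ^ k) * c m) (norm (2 ^ k :: complex) * C)"
  proof (rule l2_le_mono[OF l2_le_cmult[OF C]])
    fix m
    have dm: "norm (d m) = \<bar>real_of_int m\<bar> ^ k * norm (c m)"
      unfolding d_def c_def weak_derivative_fc[OF g(2), symmetric] by (simp add: norm_mult norm_power)
    have "wt m ^ k \<le> (2 * max 1 \<bar>real_of_int m\<bar>) ^ k"
      by (rule power_mono) (auto simp: wt_def)
    also have "\<dots> = 2 ^ k * max 1 \<bar>real_of_int m\<bar> ^ k" by (simp add: power_mult_distrib)
    also have "max 1 \<bar>real_of_int m\<bar> ^ k \<le> 1 + \<bar>real_of_int m\<bar> ^ k"
      by (auto simp: max_def)
    finally have "wt m ^ k * norm (c m) \<le> 2 ^ k * (1 + \<bar>real_of_int m\<bar> ^ k) * norm (c m)"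
      by (intro mult_right_mono) auto
    also have "\<dots> = 2 ^ k * (norm (c m) + norm (d m))"
      by (simp add: dm algebra_simps)
    finally have "wt m ^ k * norm (c m) \<le> 2 ^ k * (norm (c m) + norm (d m))" .
    moreover have "norm (S m) = norm (c m) + norm (d m)"
      unfolding S_def of_real_add[symmetric] norm_of_real by simp
    ultimately show "norm (of_real (wt m ^ k) * c m) \<le> norm (2 ^ k * S m)"
      by (simp add: norm_mult norm_power)
  qed simp
  then show ?thesis by (auto simp: sob_def c_def)
qed

definition delta :: "int \<Rightarrow> complex" where
  "delta m = (if m = 0 then 1 else 0)"

lemma fc_1_delta: "fc (\<lambda>_. 1) = delta"
  by (simp add: fun_eq_iff fc_1 delta_def)

lemma sob_delta: "sob k delta"
  by (rule sob_finite_support[of "{0}"]) (auto simp: delta_def)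

lemma sob_ex_wt: "sob k a \<Longrightarrow> 1 \<le> k \<Longrightarrow> \<exists>C. l2_le (\<lambda>m. of_real (wt m) * a m) C"
  using sob_wt by metis

lemma conv_contraction:
  assumes "bounded_meas \<phi> \<kappa>" "\<kappa> < 1" "l1_le (fc \<phi>) A"
  shows "contraction (\<lambda>m j. fc \<phi> (m - j)) \<kappa>"
  unfolding contraction_def kop_conv
  using conv_multiplier[OF assms(1,3)] assms(2) order_trans[OF norm_ge_zero[of "\<phi> 0"]] assms(1)
  by (auto simp: bounded_meas_def)

lemma conv_decaying:
  assumes "l2_le (\<lambda>m. of_real (wt m) * \<phi> m) B"
  shows "decaying_kernel (\<lambda>m j. \<phi> (m - j)) \<phi> B"
  using assms by unfold_locales auto

lemma contraction_unique:
  assumes G: "contraction G \<kappa>" and d: "decaying_kernel G \<beta> B"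
    and a: "l2_le a A" "\<And>m. a m = y m + kop G a m"
    and a': "l2_le a' A'" "\<And>m. a' m = y m + kop G a' m"
  shows "a = a'"
proof
  fix m
  have "a m - a' m = 0 + kop G (\<lambda>m. a m - a' m) m" for m
    unfolding decaying_kernel.kop_diff[OF d a(1) a'(1)] using a(2)[of m] a'(2)[of m] by simp
  from contraction_bound[OF G l2_le_diff[OF a(1) a'(1)] l2_le_zero this]
  have "l2_le (\<lambda>m. a m - a' m) 0" by simp
  from l2_le_norm[OF this, of m] show "a m = a' m" by simp
qed

section \<open>The function 1 / (1 - |r|^2) and its smoothness\<close>

locale reflection =
  fixes \<rho> :: "real \<Rightarrow> complex" and \<kappa> :: real and k :: nat
  assumes k: "1 \<le> k" and \<rho>: "bounded_meas \<rho> \<kappa>" and \<kappa>: "\<kappa> < 1" and sob_\<rho>: "sob k (fc \<rho>)"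
begin

lemma \<kappa>_nonneg: "0 \<le> \<kappa>"
  using \<rho> order_trans[OF norm_ge_zero[of "\<rho> 0"]] by (simp add: bounded_meas_def)

lemma \<kappa>2: "\<kappa>\<^sup>2 < 1"
  using \<kappa> \<kappa>_nonneg by (simp add: power_less_one_iff)

lemma norm_\<rho>: "norm (\<rho> \<theta>) \<le> \<kappa>"
  using \<rho> by (simp add: bounded_meas_def)

definition u :: "real \<Rightarrow> complex" where
  "u \<theta> = of_real (1 / (1 - (norm (\<rho> \<theta>))\<^sup>2))"

definition U :: real where
  "U = 1 / (1 - \<kappa>\<^sup>2)"

lemma norm_\<rho>2: "(norm (\<rho> \<theta>))\<^sup>2 \<le> \<kappa>\<^sup>2"
  using norm_\<rho> by (intro power_mono) auto

lemma U_ge_1: "1 \<le> U"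
  using \<kappa>2 by (simp add: U_def)

lemma Re_u: "1 \<le> Re (u \<theta>)" "Re (u \<theta>) \<le> U"
proof -
  show "1 \<le> Re (u \<theta>)" using norm_\<rho>2[of \<theta>] \<kappa>2 by (simp add: u_def)
  show "Re (u \<theta>) \<le> U" using norm_\<rho>2[of \<theta>] \<kappa>2
    unfolding u_def U_def by (simp add: frac_le)
qed

lemma u_of_real: "u \<theta> = of_real (Re (u \<theta>))"
  by (simp add: u_def)

lemma bounded_u: "bounded_meas u U"
proof -
  have "norm (u \<theta>) \<le> U" for \<theta>
    using Re_u[of \<theta>] by (subst u_of_real) (simp only: norm_of_real)
  moreover have "u \<in> borel_measurable arc"
    unfolding u_def[abs_def] using \<rho> by (auto simp: bounded_meas_def)
  ultimately show ?thesis by (simp add: bounded_meas_def)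
qed

text \<open>|\<rho>|^2 written as a product, so that its coefficients are a convolution and
  \<open>sob_conv\<close> applies.\<close>

definition b :: "real \<Rightarrow> complex" where
  "b \<theta> = \<rho> \<theta> * cnj (\<rho> \<theta>)"

lemma bounded_b: "bounded_meas b (\<kappa>\<^sup>2)"
  unfolding b_def[abs_def] power2_eq_square by (intro bounded_meas_mult bounded_meas_cnj \<rho>)

text \<open>This presents the inverse as a fixed point of 1 + multiplication by \<open>b\<close>,
  which contracts because \<open>b\<close> is bounded by \<kappa>^2 < 1.\<close>

lemma u_eq: "u \<theta> = 1 + b \<theta> * u \<theta>"
proof -
  have "b \<theta> = of_real ((norm (\<rho> \<theta>))\<^sup>2)" by (simp only: b_def complex_norm_square)
  moreover have "1 - (norm (\<rho> \<theta>))\<^sup>2 \<noteq> 0" using norm_\<rho>2[of \<theta>] \<kappa>2 by linarith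
  then have "1 / (1 - (norm (\<rho> \<theta>))\<^sup>2) = 1 + (norm (\<rho> \<theta>))\<^sup>2 * (1 / (1 - (norm (\<rho> \<theta>))\<^sup>2))"
    by (simp add: field_simps)
  ultimately show ?thesis
    unfolding u_def by (metis of_real_1 of_real_add of_real_mult)
qed

lemma \<rho>_l1: "\<exists>A. l1_le (fc \<rho>) A"
  using sob_l1[OF sob_\<rho> k] by blast

lemma sob_b: "sob k (fc b)"
proof -
  obtain A where A: "l1_le (fc \<rho>) A" using \<rho>_l1 by blast
  have "fc b m = conv (fc \<rho>) (\<lambda>m. cnj (fc \<rho> (- m))) m" for m
    unfolding b_def[abs_def]
    using fc_mult[OF \<rho> A bounded_meas_integrable[OF bounded_meas_cnj[OF \<rho>]], of m]
    by (simp only: fc_cnj[abs_def])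
  then have "fc b = conv (fc \<rho>) (\<lambda>m. cnj (fc \<rho> (- m)))" ..
  then show ?thesis
    by (simp add: sob_conv[OF sob_\<rho> sob_reflect[OF sob_\<rho>] k])
qed

text \<open>The equation u = 1 + b u has a solution in H^1, which is \<open>u\<close> by uniqueness
  in l2. Higher smoothness is bootstrapped: if D multiplies coefficients by m, then D u = c + b D u
  with c = u D b, hence D u = u c, and H^j is an algebra. So \<open>u\<close> in H^j puts D u in H^j
  as long as j < k.\<close>

lemma sob_u: "sob k (fc u)"
proof -
  obtain A where A: "l1_le (fc b) A" using sob_l1[OF sob_b k] by blast
  obtain B where B: "l2_le (\<lambda>m. of_real (wt m) * fc b m) B" using sob_ex_wt[OF sob_b k] by blast
  note G = conv_contraction[OF bounded_b \<kappa>2 A]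
  note D = conv_decaying[OF B]
  have fix_eq: "fc f m = fc w m + kop (\<lambda>m j. fc b (m - j)) (fc f) m"
    if "\<And>\<theta>. f \<theta> = w \<theta> + b \<theta> * f \<theta>" and f: "sq_int f" and w: "sq_int w" for f w m
  proof -
    have "fc f m = fc (\<lambda>\<theta>. w \<theta> + b \<theta> * f \<theta>) m"
      using that(1) by (intro arg_cong[where f = "\<lambda>f. fc f m"] ext)
    also have "\<dots> = fc w m + conv (fc b) (fc f) m"
      using fc_mult[OF bounded_b A sq_int_integrable[OF f], of m]
      by (simp add: fc_add[OF sq_int_integrable[OF w] sq_int_integrable[OF sq_int_bounded_mult[OF f bounded_b]]])
    finally show ?thesis by (simp only: kop_conv)
  qed
  have us: "sq_int u" by (rule bounded_meas_sq_int[OF bounded_u])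
  have one: "sq_int (\<lambda>_. 1)" by (rule bounded_meas_sq_int[of _ 1]) (simp add: bounded_meas_def)
  have u_fix: "fc u m = delta m + kop (\<lambda>m j. fc b (m - j)) (fc u) m" for m
    using fix_eq[OF u_eq us one, of m] by (simp only: fc_1_delta)
  have "sob 1 (fc u)"
  proof -
    obtain Y where "l2_le (\<lambda>m. of_real (wt m) * delta m) Y" using sob_ex_wt[OF sob_delta[of 1]] by auto
    from decaying_kernel.solution_exists[OF D G this] obtain a C where
      a: "l2_le (\<lambda>m. of_real (wt m) * a m) C" "\<And>m. a m = delta m + kop (\<lambda>m j. fc b (m - j)) a m"
      by blast
    have "l2_le a C"
      by (rule l2_le_mono[OF a(1)]) (auto simp: norm_mult mult_le_cancel_right1 wt_ge_1)
    then have "a = fc u"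
      by (rule contraction_unique[OF G D _ a(2) bessel[OF us] u_fix])
    with sob_1I[OF a(1)] show ?thesis by simp
  qed
  have "sob j (fc u)" if "1 \<le> j" "j \<le> k" for j
    using that
  proof (induction j rule: dec_induct)
    case base
    show ?case by fact
  next
    case (step j)
    then have j: "1 \<le> j" "Suc j \<le> k" and IH: "sob j (fc u)" by auto
    define c where "c = conv (\<lambda>m. of_int m * fc b m) (fc u)"
    have c: "sob j c"
      unfolding c_def by (intro sob_conv sob_SucD IH sob_mono[OF sob_b] j)
    obtain C where C: "l1_le c C" using sob_l1[OF c j(1)] by blast
    obtain Au where Au: "l1_le (fc u) Au" using sob_l1[OF IH j(1)] by blast
    obtain A2 where A2: "l2_le (fc u) A2" using sob_l2[OF IH] by blast
    obtain D2 where D2: "l2_le (\<lambda>m. of_int m * fc u m) D2"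
      using sob_l2[OF sob_SucD[of 0 "fc u"]] sob_mono[OF IH, of 1] j(1) by auto
    have Du: "of_int m * fc u m = c m + kop (\<lambda>m j. fc b (m - j)) (\<lambda>m. of_int m * fc u m) m" for m
    proof -
      have "of_int m * fc u m = of_int m * delta m + of_int m * kop (\<lambda>m j. fc b (m - j)) (fc u) m"
        using u_fix[of m] by (metis distrib_left)
      also have "of_int m * delta m = 0" by (simp add: delta_def)
      also have "of_int m * kop (\<lambda>m j. fc b (m - j)) (fc u) m =
          kop (\<lambda>m j. fc b (m - j)) (\<lambda>j. of_int j * fc u j) m + c m"
        unfolding c_def conv_def by (rule decaying_kernel.kop_derivation(1)[OF D A2 D2 Au])
      finally show ?thesis by simp
    qed
    note w = ser_bounded_meas[OF C]
    have uws: "sq_int (\<lambda>\<theta>. u \<theta> * ser c \<theta>)"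
      by (rule sq_int_bounded_mult[OF bounded_meas_sq_int[OF w] bounded_u])
    \<comment> \<open>Multiplying \<open>u_eq\<close> by \<open>ser c\<close> shows that the product
      u c solves the equation of D u; uniqueness in l2 identifies the two.\<close>
    have "u \<theta> * ser c \<theta> = ser c \<theta> + b \<theta> * (u \<theta> * ser c \<theta>)" for \<theta>
      using arg_cong[OF u_eq[of \<theta>], of "\<lambda>x. x * ser c \<theta>"] by (simp add: distrib_right mult.assoc)
    from fix_eq[OF this uws bounded_meas_sq_int[OF w]]
    have uw: "fc (\<lambda>\<theta>. u \<theta> * ser c \<theta>) m = c m + kop (\<lambda>m j. fc b (m - j)) (fc (\<lambda>\<theta>. u \<theta> * ser c \<theta>)) m" for m
      by (simp only: fc_ser[OF C])
    have "(\<lambda>m. of_int m * fc u m) = fc (\<lambda>\<theta>. u \<theta> * ser c \<theta>)"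
      by (rule contraction_unique[OF G D D2 Du bessel[OF uws] uw])
    also have "\<dots> = conv (fc u) c"
      using fc_mult[OF bounded_u Au bounded_meas_integrable[OF w]] by (simp add: fun_eq_iff fc_ser[OF C] fc_ser[OF C, abs_def])
    finally have "sob j (\<lambda>m. of_int m * fc u m)"
      using sob_conv[OF IH c j(1)] by simp
    then show ?case by (rule sob_SucI[OF IH])
  qed
  then show ?thesis using k by blast
qed

end

section \<open>The Riemann-Hilbert problem in Fourier coefficients\<close>

lemma l2_le_sq_sum:
  assumes "l2_le a C" "finite F"
  shows "(\<Sum>i\<in>F. (norm (a i))\<^sup>2) \<le> C\<^sup>2"
  using l2_leD[OF assms] by (simp add: L2_set_def sqrt_le_D)

text \<open>The two bounds are the exact l2 norms of the parts, so their squares add up. The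
  triangle inequality instead would spoil the contraction constant of \<open>G N\<close>.\<close>

lemma l2_le_split:
  assumes a: "l2_le a C"
  obtains C1 C2 where "l2_le (\<lambda>i. if P i then a i else 0) C1" "l2_le (\<lambda>i. if P i then 0 else a i) C2"
    "C1\<^sup>2 + C2\<^sup>2 \<le> C\<^sup>2"
proof -
  define s where "s i = (norm (a i))\<^sup>2" for i
  have s: "s summable_on UNIV"
    by (rule nonneg_bdd_above_summable_on)
       (auto simp: s_def bdd_above_def intro!: exI[of _ "C\<^sup>2"] l2_le_sq_sum[OF a])
  have sS: "s summable_on S" for S by (rule summable_on_subset_banach[OF s]) simp
  have bd: "l2_le (\<lambda>i. if i \<in> S then a i else 0) (sqrt (infsum s S))" for S
  proof (rule l2_leI)
    fix F :: "'a set" assume F: "finite F"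
    have "(\<Sum>i\<in>F. (norm (if i \<in> S then a i else 0))\<^sup>2) = sum s (F \<inter> S)"
      using F by (intro sum.mono_neutral_cong_right) (auto simp: s_def)
    also have "\<dots> \<le> infsum s S"
      by (rule finite_sum_le_infsum[OF sS]) (use F in \<open>auto simp: s_def\<close>)
    finally show "L2_set (\<lambda>i. norm (if i \<in> S then a i else 0)) F \<le> sqrt (infsum s S)"
      unfolding L2_set_def by (rule real_sqrt_le_mono)
  qed
  have nn: "0 \<le> infsum s S" for S by (rule infsum_nonneg) (simp add: s_def)
  have "infsum s {i. P i} + infsum s {i. \<not> P i} = infsum s ({i. P i} \<union> {i. \<not> P i})"
    by (rule infsum_Un_disjoint[OF sS sS, symmetric]) auto
  also have "\<dots> \<le> C\<^sup>2"
    by (rule infsum_le_finite_sums[OF sS]) (auto simp: s_def intro: l2_le_sq_sum[OF a])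
  finally have "(sqrt (infsum s {i. P i}))\<^sup>2 + (sqrt (infsum s {i. \<not> P i}))\<^sup>2 \<le> C\<^sup>2"
    using nn by simp
  moreover have "l2_le (\<lambda>i. if P i then 0 else a i) (sqrt (infsum s {i. \<not> P i}))"
    using bd[of "{i. \<not> P i}"] by (rule l2_le_mono) auto
  ultimately show ?thesis using that bd[of "{i. P i}"] by simp
qed

lemma l2_le_join:
  assumes 1: "l2_le (\<lambda>i. if P i then a i else 0) C1" and 2: "l2_le (\<lambda>i. if P i then 0 else a i) C2"
    and C: "C1\<^sup>2 + C2\<^sup>2 \<le> C\<^sup>2" "0 \<le> C"
  shows "l2_le a C"
proof (rule l2_leI)
  fix F :: "'a set" assume F: "finite F"
  have "(\<Sum>i\<in>F. (norm (a i))\<^sup>2) =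
      (\<Sum>i\<in>F. (norm (if P i then a i else 0))\<^sup>2) + (\<Sum>i\<in>F. (norm (if P i then 0 else a i))\<^sup>2)"
    unfolding sum.distrib[symmetric] by (rule sum.cong) auto
  also have "\<dots> \<le> C\<^sup>2"
    using l2_le_sq_sum[OF 1 F] l2_le_sq_sum[OF 2 F] C(1) by linarith
  finally show "L2_set (\<lambda>i. norm (a i)) F \<le> C"
    unfolding L2_set_def using C(2) by (intro real_le_lsqrt sum_nonneg) auto
qed

lemma conv_delta [simp]: "conv \<phi> delta = \<phi>"
proof
  fix m
  have "((\<lambda>j. \<phi> (m - j) * delta j) has_sum \<phi> m) UNIV"
    by (rule has_sum_finite_neutralI[of "{0}"]) (auto simp: delta_def)
  then show "conv \<phi> delta m = \<phi> m" by (simp add: conv_def infsumI)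
qed

lemma conv_add:
  assumes "l1_le \<phi> A" "l2_le a B" "l2_le b C"
  shows "conv \<phi> (\<lambda>j. a j + b j) m = conv \<phi> a m + conv \<phi> b m"
  unfolding conv_def distrib_left
  by (rule infsum_add[OF conv_summable[OF assms(1,2)] conv_summable[OF assms(1,3)]])

lemma conv_cmult: "conv \<phi> (\<lambda>j. c * a j) m = c * conv \<phi> a m"
  unfolding conv_def mult.left_commute[of _ c] by (rule infsum_cmult_right')

lemma l1_le_delta: "l1_le delta 1"
proof (rule l1_leI)
  fix F :: "int set" assume "finite F"
  then have "(\<Sum>i\<in>F. norm (delta i)) = (\<Sum>i\<in>F \<inter> {0}. norm (delta i))"
    by (intro sum.mono_neutral_right) (auto simp: delta_def)
  also have "\<dots> \<le> 1" by (cases "0 \<in> F") (auto simp: delta_def)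
  finally show "(\<Sum>i\<in>F. norm (delta i)) \<le> 1" .
qed

lemmas l2_le_delta = l1_le_delta[THEN l1_le_imp_l2_le]

text \<open>Peetre's inequality: a translation changes the weight by a factor that depends on the
  shift alone.\<close>

lemma wt_mult: "wt m \<le> wt n * wt (m + n)"
proof -
  have "\<bar>real_of_int m\<bar> \<le> \<bar>real_of_int n\<bar> + \<bar>real_of_int (m + n)\<bar>" by simp
  also have "\<dots> \<le> \<bar>real_of_int n\<bar> + \<bar>real_of_int (m + n)\<bar> + \<bar>real_of_int n\<bar> * \<bar>real_of_int (m + n)\<bar>"
    by simp
  finally show ?thesis unfolding wt_def by (simp add: algebra_simps)
qed

lemma sob_shift:
  assumes "sob k a"
  shows "sob k (\<lambda>m. a (m + n))"
proof -
  obtain C where C: "l2_le (\<lambda>m. of_real (wt m ^ k) * a m) C" using assms by (auto simp: sob_def)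
  have "l2_le (\<lambda>m. of_real (wt m ^ k) * a (m + n)) (norm (complex_of_real (wt n ^ k)) * C)"
  proof (rule l2_le_mono[OF l2_le_cmult[OF l2_le_reindex[OF C]]])
    fix m
    have "wt m ^ k \<le> (wt n * wt (m + n)) ^ k" by (intro power_mono wt_mult) simp
    then have "wt m ^ k * norm (a (m + n)) \<le> wt n ^ k * wt (m + n) ^ k * norm (a (m + n))"
      unfolding power_mult_distrib by (rule mult_right_mono) simp
    then show "norm (of_real (wt m ^ k) * a (m + n)) \<le>
        norm (complex_of_real (wt n ^ k) * (of_real (wt (m + n) ^ k) * a (m + n)))"
      by (simp add: norm_mult)
  qed simp_all
  then show ?thesis by (auto simp: sob_def)
qed

context reflection
begin

definition R :: "int \<Rightarrow> real \<Rightarrow> complex" where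
  "R N \<theta> = cis (of_int (- 2 * N) * \<theta>) * \<rho> \<theta>"

definition Rc :: "int \<Rightarrow> real \<Rightarrow> complex" where
  "Rc N \<theta> = cnj (R N \<theta>)"

lemma bounded_R: "bounded_meas (R N) \<kappa>" and bounded_Rc: "bounded_meas (Rc N) \<kappa>"
proof -
  show 1: "bounded_meas (R N) \<kappa>"
    using bounded_meas_mult[OF bounded_meas_cis[of "of_int (- 2 * N)"] \<rho>] by (simp add: R_def[abs_def])
  show "bounded_meas (Rc N) \<kappa>"
    unfolding Rc_def[abs_def] by (rule bounded_meas_cnj[OF 1])
qed

lemma fc_R: "fc (R N) m = fc \<rho> (m + 2 * N)"
  unfolding R_def[abs_def] fc_shift by simp

lemma fc_Rc: "fc (Rc N) m = cnj (fc \<rho> (2 * N - m))"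
  unfolding Rc_def[abs_def] fc_cnj fc_R by simp

lemma sob_R: "sob k (fc (R N))" and sob_Rc: "sob k (fc (Rc N))"
proof -
  show 1: "sob k (fc (R N))"
    using sob_shift[OF sob_\<rho>, of "2 * N"] by (simp only: fc_R[symmetric])
  show "sob k (fc (Rc N))"
    using sob_reflect[OF 1] unfolding Rc_def[abs_def] fc_cnj[abs_def] .
qed

lemma R_l1: obtains A where "l1_le (fc (R N)) A"
  using sob_l1[OF sob_R k] by metis

lemma Rc_l1: obtains A where "l1_le (fc (Rc N)) A"
  using sob_l1[OF sob_Rc k] by metis

text \<open>
  The unknowns \<open>f - p\<close> and \<open>g - q\<close> of \<open>rh_row\<close> below have disjoint frequencies, so that both fit
  into one sequence, on which \<open>G N\<close> acts.
\<close>

definition G :: "int \<Rightarrow> int \<Rightarrow> int \<Rightarrow> complex" where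
  "G N m j = (if 0 \<le> m then (if 0 \<le> j then 0 else - fc (R N) (m - j))
              else (if 0 \<le> j then - fc (Rc N) (m - j) else 0))"

lemma kop_G:
  "kop (G N) a m = (if 0 \<le> m then - conv (fc (R N)) (\<lambda>j. if 0 \<le> j then 0 else a j) m
                    else - conv (fc (Rc N)) (\<lambda>j. if 0 \<le> j then a j else 0) m)"
proof (cases "0 \<le> m")
  case True
  have "kop (G N) a m = (\<Sum>\<^sub>\<infinity>j. - (fc (R N) (m - j) * (if 0 \<le> j then 0 else a j)))"
    unfolding kop_def by (rule infsum_cong) (simp add: G_def True)
  then show ?thesis using True by (simp add: conv_def infsum_uminus)
next
  case False
  have "kop (G N) a m = (\<Sum>\<^sub>\<infinity>j. - (fc (Rc N) (m - j) * (if 0 \<le> j then a j else 0)))"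
    unfolding kop_def by (rule infsum_cong) (simp add: G_def False)
  then show ?thesis using False by (simp add: conv_def infsum_uminus)
qed

text \<open>\<open>G N\<close> exchanges the two half-lines, each block being a compressed
  multiplication of norm at most \<kappa>; by Pythagoras the two blocks together keep the bound
  \<kappa>.\<close>

lemma contraction_G: "contraction (G N) \<kappa>"
  unfolding contraction_def
proof (intro conjI allI impI \<kappa>_nonneg \<kappa>)
  fix a :: "int \<Rightarrow> complex" and C assume a: "l2_le a C"
  obtain A where A: "l1_le (fc (R N)) A" using R_l1 .
  obtain A' where A': "l1_le (fc (Rc N)) A'" using Rc_l1 .
  obtain C1 C2 where C: "l2_le (\<lambda>j. if 0 \<le> j then a j else 0) C1" "l2_le (\<lambda>j. if 0 \<le> j then 0 else a j) C2"
    "C1\<^sup>2 + C2\<^sup>2 \<le> C\<^sup>2"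
    using l2_le_split[OF a, of "\<lambda>j. 0 \<le> j"] by blast
  show "l2_le (kop (G N) a) (\<kappa> * C)"
  proof (rule l2_le_join[where P = "\<lambda>j. 0 \<le> j"])
    show "l2_le (\<lambda>m. if 0 \<le> m then kop (G N) a m else 0) (\<kappa> * C2)"
      by (rule l2_le_mono[OF conv_multiplier[OF bounded_R A C(2)]]) (auto simp: kop_G)
    show "l2_le (\<lambda>m. if 0 \<le> m then 0 else kop (G N) a m) (\<kappa> * C1)"
      by (rule l2_le_mono[OF conv_multiplier[OF bounded_Rc A' C(1)]]) (auto simp: kop_G)
    have "\<kappa>\<^sup>2 * (C1\<^sup>2 + C2\<^sup>2) \<le> \<kappa>\<^sup>2 * C\<^sup>2" by (intro mult_left_mono C(3)) simp
    then show "(\<kappa> * C2)\<^sup>2 + (\<kappa> * C1)\<^sup>2 \<le> (\<kappa> * C)\<^sup>2"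
      by (simp add: power_mult_distrib algebra_simps)
    show "0 \<le> \<kappa> * C" using \<kappa>_nonneg l2_le_nonneg[OF a] by simp
  qed
qed

lemma decaying_G: obtains \<beta> B where "decaying_kernel (G N) \<beta> B"
proof -
  \<comment> \<open>Adding norms rather than coefficients excludes cancellation, so that
    \<open>\<beta>\<close> dominates both blocks.\<close>
  define \<beta> where "\<beta> m = complex_of_real (norm (fc (R N) m)) + complex_of_real (norm (fc (Rc N) m))" for m
  have "sob k (\<lambda>m. complex_of_real (norm (fc (R N) m)))"
    by (rule sob_mono_norm[OF sob_R[of N]]) simp
  moreover have "sob k (\<lambda>m. complex_of_real (norm (fc (Rc N) m)))"
    by (rule sob_mono_norm[OF sob_Rc[of N]]) simp
  ultimately have "sob k \<beta>"
    unfolding \<beta>_def[abs_def] by (rule sob_add)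
  then obtain B where B: "l2_le (\<lambda>m. of_real (wt m) * \<beta> m) B" using sob_ex_wt k by blast
  have "norm (\<beta> m) = norm (fc (R N) m) + norm (fc (Rc N) m)" for m
    unfolding \<beta>_def of_real_add[symmetric] norm_of_real by simp
  then have "decaying_kernel (G N) \<beta> B"
    using B by unfold_locales (auto simp: G_def)
  then show ?thesis by (rule that)
qed

text \<open>
  A row of \<open>(I - C\<^sub>w) F = I\<close> in Fourier coefficients; \<open>(p, q)\<close> is the corresponding row of \<open>I\<close>.
\<close>

definition rh_row :: "int \<Rightarrow> complex \<Rightarrow> complex \<Rightarrow> (real \<Rightarrow> complex) \<Rightarrow> (real \<Rightarrow> complex) \<Rightarrow> bool" where
  "rh_row N p q f g \<longleftrightarrow> sq_int f \<and> sq_int g \<and>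
     (\<forall>m. fc f m = (if 0 \<le> m then p * delta m - fc (\<lambda>\<theta>. R N \<theta> * g \<theta>) m else 0)) \<and>
     (\<forall>m. fc g m = (if 0 \<le> m then q * delta m else - fc (\<lambda>\<theta>. Rc N \<theta> * f \<theta>) m))"

lemma fc_R_mult: "sq_int f \<Longrightarrow> fc (\<lambda>\<theta>. R N \<theta> * f \<theta>) m = conv (fc (R N)) (fc f) m"
  using R_l1[of N] fc_mult[OF bounded_R _ sq_int_integrable] by metis

lemma fc_Rc_mult: "sq_int f \<Longrightarrow> fc (\<lambda>\<theta>. Rc N \<theta> * f \<theta>) m = conv (fc (Rc N)) (fc f) m"
  using Rc_l1[of N] fc_mult[OF bounded_Rc _ sq_int_integrable] by metis

text \<open>Subtracting the constants \<open>p\<close> and \<open>q\<close> leaves unknowns on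
  complementary half-lines and a forcing term. The solution lies in H^1, so its coefficients are
  summable and the row consists of absolutely convergent series.\<close>

lemma rh_row_exists:
  obtains \<alpha> \<beta> A B where "l1_le \<alpha> A" "l1_le \<beta> B" "rh_row N p q (ser \<alpha>) (ser \<beta>)"
proof -
  obtain A where A: "l1_le (fc (R N)) A" using R_l1 .
  obtain A' where A': "l1_le (fc (Rc N)) A'" using Rc_l1 .
  \<comment> \<open>The constants after passing through the blocks: \<open>q\<close> through
    \<open>R\<close> onto the nonnegative half-line, \<open>p\<close> through \<open>Rc\<close> onto
    the negative one.\<close>
  define y where "y m = (if 0 \<le> m then - q * fc (R N) m else 0) + (if 0 \<le> m then 0 else - p * fc (Rc N) m)" for m
  have "sob k (\<lambda>m. if 0 \<le> m then - q * fc (R N) m else 0)"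
    by (rule sob_mono_norm[OF sob_cmult[OF sob_R, of "- q"]]) auto
  moreover have "sob k (\<lambda>m. if 0 \<le> m then 0 else - p * fc (Rc N) m)"
    by (rule sob_mono_norm[OF sob_cmult[OF sob_Rc, of "- p"]]) auto
  ultimately have "sob k y" unfolding y_def[abs_def] by (rule sob_add)
  then obtain Y where Y: "l2_le (\<lambda>m. of_real (wt m) * y m) Y" using sob_ex_wt k by blast
  obtain \<beta>' B where D: "decaying_kernel (G N) \<beta>' B" using decaying_G .
  obtain a C where a: "l2_le (\<lambda>m. of_real (wt m) * a m) C" "\<And>m. a m = y m + kop (G N) a m"
    using decaying_kernel.solution_exists[OF D contraction_G Y] by blast
  define a1 where "a1 m = (if 0 \<le> m then a m else 0)" for m
  define a2 where "a2 m = (if 0 \<le> m then 0 else a m)" for m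
  note al = l1_le_of_wt[OF a(1)]
  have l1: "l1_le a1 (2 * C)" "l1_le a2 (2 * C)"
    using al by (auto intro: l1_le_mono simp: a1_def a2_def)
  note l2 = l1(1)[THEN l1_le_imp_l2_le] l1(2)[THEN l1_le_imp_l2_le]
  note d1 = l1_le_cmult[OF l1_le_delta]
  define \<alpha> where "\<alpha> m = p * delta m + a1 m" for m
  define \<beta> where "\<beta> m = q * delta m + a2 m" for m
  have L: "l1_le \<alpha> (norm p * 1 + 2 * C)" "l1_le \<beta> (norm q * 1 + 2 * C)"
    unfolding \<alpha>_def[abs_def] \<beta>_def[abs_def] by (intro l1_le_add d1 l1)+
  note s = ser_bounded_meas[OF L(1), THEN bounded_meas_sq_int] ser_bounded_meas[OF L(2), THEN bounded_meas_sq_int]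
  have fcs: "fc (ser \<alpha>) = \<alpha>" "fc (ser \<beta>) = \<beta>"
    using fc_ser[OF L(1)] fc_ser[OF L(2)] by auto
  have c1: "fc (\<lambda>\<theta>. R N \<theta> * ser \<beta> \<theta>) m = q * fc (R N) m + conv (fc (R N)) a2 m" for m
    unfolding fc_R_mult[OF s(2)] fcs
    unfolding \<beta>_def[abs_def] using conv_add[OF A l2_le_cmult[OF l2_le_delta] l2(2), of q m]
    by (simp add: conv_cmult)
  have c2: "fc (\<lambda>\<theta>. Rc N \<theta> * ser \<alpha> \<theta>) m = p * fc (Rc N) m + conv (fc (Rc N)) a1 m" for m
    unfolding fc_Rc_mult[OF s(1)] fcs
    unfolding \<alpha>_def[abs_def] using conv_add[OF A' l2_le_cmult[OF l2_le_delta] l2(1), of p m]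
    by (simp add: conv_cmult)
  have e1: "a m = - q * fc (R N) m - conv (fc (R N)) a2 m" if "0 \<le> m" for m
    using a(2)[of m] that by (simp add: y_def kop_G a2_def[abs_def])
  have e2: "a m = - p * fc (Rc N) m - conv (fc (Rc N)) a1 m" if "m < 0" for m
    using a(2)[of m] that by (simp add: y_def kop_G a1_def[abs_def])
  have "fc (ser \<alpha>) m = (if 0 \<le> m then p * delta m - fc (\<lambda>\<theta>. R N \<theta> * ser \<beta> \<theta>) m else 0)" for m
    unfolding fcs c1 using e1[of m] by (auto simp: \<alpha>_def a1_def delta_def)
  moreover have "fc (ser \<beta>) m = (if 0 \<le> m then q * delta m else - fc (\<lambda>\<theta>. Rc N \<theta> * ser \<alpha> \<theta>) m)" for m
    unfolding fcs c2 using e2[of m] by (auto simp: \<beta>_def a2_def delta_def)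
  ultimately have "rh_row N p q (ser \<alpha>) (ser \<beta>)"
    using s by (simp add: rh_row_def)
  with L show ?thesis by (rule that)
qed

end

section \<open>The resolvent and the reconstructed potential\<close>

lemma mat_mult_w_minus:
  "(M ** w_minus r N z) $ i $ 1 = 0"
  "(M ** w_minus r N z) $ i $ 2 = M $ i $ 1 * (- cnj (r z) * z powi (2 * N))"
  by (simp_all add: matrix_matrix_mult_def sum_2 w_minus_def)

lemma mat_mult_w_plus:
  "(M ** w_plus r N z) $ i $ 1 = M $ i $ 2 * (r z * z powi (- 2 * N))"
  "(M ** w_plus r N z) $ i $ 2 = 0"
  by (simp_all add: matrix_matrix_mult_def sum_2 w_plus_def)

lemma cauchy_integral_zero: "cauchy_integral (\<lambda>_. 0) z = 0"
  by (simp add: cauchy_integral_def circle_integral_def)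

lemma cauchy_plus_zero: "cauchy_plus (\<lambda>_. 0) g \<Longrightarrow> AE \<theta> in arc. g (cis \<theta>) = 0"
  by (simp add: cauchy_plus_def cauchy_integral_zero tendsto_const_iff)

lemma cauchy_minus_zero: "cauchy_minus (\<lambda>_. 0) g \<Longrightarrow> AE \<theta> in arc. g (cis \<theta>) = 0"
  by (simp add: cauchy_minus_def cauchy_integral_zero tendsto_const_iff)

text \<open>\<open>C_w\<close> acts on functions of z; integer powers turn a series in \<theta> into
  such a function.\<close>

definition zser :: "(int \<Rightarrow> complex) \<Rightarrow> complex \<Rightarrow> complex" where
  "zser a z = (\<Sum>\<^sub>\<infinity>j. a j * z powi j)"

lemma zser_cis: "zser a (cis \<theta>) = ser a \<theta>"
  by (simp add: zser_def ser_def cis_power_int)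

lemma ser_add_delta:
  assumes "l1_le a A"
  shows "ser (\<lambda>m. a m + c * delta m) \<theta> = ser a \<theta> + c"
proof -
  have "((\<lambda>j. c * delta j * cis (of_int j * \<theta>)) has_sum c) UNIV"
    by (rule has_sum_finite_neutralI[of "{0}"]) (auto simp: delta_def)
  from has_sum_add[OF ser_has_sum[OF assms] this]
  show ?thesis unfolding ser_def[of "\<lambda>m. a m + c * delta m"] distrib_right
    by (rule infsumI)
qed

lemma fc_const: "fc (\<lambda>_. c) m = c * delta m"
  using fc_cmult[of c "\<lambda>_. 1" m] by (simp add: fc_1_delta)

lemma bounded_meas_const: "bounded_meas (\<lambda>_. c) (norm c)"
  by (simp add: bounded_meas_def)

locale circle_reflection = reflection "\<lambda>\<theta>. r (cis \<theta>)" \<kappa> k for r :: "complex \<Rightarrow> complex" and \<kappa> k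
begin

lemma R_cis: "r (cis \<theta>) * cis \<theta> powi (- 2 * N) = R N \<theta>"
  by (simp only: R_def cis_power_int mult.commute)

lemma Rc_cis: "- cnj (r (cis \<theta>)) * cis \<theta> powi (2 * N) = - Rc N \<theta>"
proof -
  have "cnj (cis (of_int (- 2 * N) * \<theta>)) = cis \<theta> powi (2 * N)"
    unfolding cis_power_int cis_cnj by simp
  then show ?thesis by (simp add: Rc_def R_def mult.commute)
qed

text \<open>\<open>w_minus\<close> feeds only the second column and \<open>w_plus\<close> only the
  first, so the other columns of \<open>A\<close> and \<open>B\<close> are limits of zero. Hence
  \<open>B\<close> supplies the first column of F - I and \<open>A\<close> the second, and each row
  satisfies its own pair of scalar equations.\<close>

lemma C_w_imp_rh_row:
  assumes F: "F \<in> L2_circle_mat" and C: "C_w r N F (\<lambda>z. F z - mat 1)"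
  shows "rh_row N (mat 1 $ i $ 1) (mat 1 $ i $ 2) (\<lambda>\<theta>. F (cis \<theta>) $ i $ 1) (\<lambda>\<theta>. F (cis \<theta>) $ i $ 2)"
proof -
  define f g where "f = (\<lambda>\<theta>. F (cis \<theta>) $ i $ 1)" and "g = (\<lambda>\<theta>. F (cis \<theta>) $ i $ 2)"
  define p q :: complex where "p = mat 1 $ i $ 1" and "q = mat 1 $ i $ 2"
  have sq: "sq_int f" "sq_int g"
    using F by (auto simp: L2_circle_mat_def L2_circle_iff f_def g_def)
  obtain A B where A: "\<And>i j. cauchy_plus (\<lambda>z. (F z ** w_minus r N z) $ i $ j) (\<lambda>z. A z $ i $ j)"
    and B: "\<And>i j. cauchy_minus (\<lambda>z. (F z ** w_plus r N z) $ i $ j) (\<lambda>z. B z $ i $ j)"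
    and eq: "AE \<theta> in arc. F (cis \<theta>) - mat 1 = A (cis \<theta>) + B (cis \<theta>)"
    using C unfolding C_w_def by blast
  have A1: "AE \<theta> in arc. A (cis \<theta>) $ i $ 1 = 0"
    using A[of i 1] cauchy_plus_zero[of "\<lambda>z. A z $ i $ 1"] by (simp add: mat_mult_w_minus)
  have B2: "AE \<theta> in arc. B (cis \<theta>) $ i $ 2 = 0"
    using B[of i 2] cauchy_minus_zero[of "\<lambda>z. B z $ i $ 2"] by (simp add: mat_mult_w_plus)
  have fB: "AE \<theta> in arc. B (cis \<theta>) $ i $ 1 = f \<theta> - p"
    using eq A1
  proof eventually_elim
    case (elim \<theta>)
    from arg_cong[OF elim(1), of "\<lambda>M. M $ i $ 1"] elim(2) show ?case by (simp add: f_def p_def)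
  qed
  have gA: "AE \<theta> in arc. A (cis \<theta>) $ i $ 2 = g \<theta> - q"
    using eq B2
  proof eventually_elim
    case (elim \<theta>)
    from arg_cong[OF elim(1), of "\<lambda>M. M $ i $ 2"] elim(2) show ?case by (simp add: g_def q_def)
  qed
  note const = bounded_meas_sq_int[OF bounded_meas_const]
  have Fp: "(\<lambda>\<theta>. (F (cis \<theta>) ** w_plus r N (cis \<theta>)) $ i $ 1) = (\<lambda>\<theta>. R N \<theta> * g \<theta>)"
    unfolding mat_mult_w_plus R_cis by (simp add: g_def mult.commute)
  have Fm: "(\<lambda>\<theta>. (F (cis \<theta>) ** w_minus r N (cis \<theta>)) $ i $ 2) = (\<lambda>\<theta>. - 1 * (Rc N \<theta> * f \<theta>))"
    unfolding mat_mult_w_minus Rc_cis by (simp add: f_def mult.commute)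
  have f: "fc (\<lambda>\<theta>. f \<theta> - p) m = (if 0 \<le> m then - fc (\<lambda>\<theta>. R N \<theta> * g \<theta>) m else 0)" for m
    using cauchy_minusD[OF _ sq_int_diff[OF sq(1) const] B[of i 1] fB, of m] 
    unfolding Fp using sq_int_bounded_mult[OF sq(2) bounded_R] by blast
  have g: "fc (\<lambda>\<theta>. g \<theta> - q) m = (if m < 0 then - fc (\<lambda>\<theta>. Rc N \<theta> * f \<theta>) m else 0)" for m
    using cauchy_plusD[OF _ sq_int_diff[OF sq(2) const] A[of i 2] gA, of m] 
    unfolding Fm fc_cmult using sq_int_cmult[OF sq_int_bounded_mult[OF sq(1) bounded_Rc], of "- 1" N] by simp
  have "fc f m = p * delta m + fc (\<lambda>\<theta>. f \<theta> - p) m" "fc g m = q * delta m + fc (\<lambda>\<theta>. g \<theta> - q) m" for m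
    by (simp_all add: fc_diff[OF sq_int_integrable[OF sq(1)]] fc_diff[OF sq_int_integrable[OF sq(2)]] fc_const)
  then have "rh_row N p q f g"
    unfolding rh_row_def f g using sq by (auto simp: delta_def)
  then show ?thesis by (simp add: f_def g_def p_def q_def)
qed

text \<open>Needed to unfold the \<open>SOME\<close> in \<open>resolvent\<close>. \<open>C_w\<close>
  asks for genuine limits almost everywhere, and the summability of the rows from
  \<open>rh_row_exists\<close> provides them.\<close>

lemma resolvent_exists: "\<exists>F. F \<in> L2_circle_mat \<and> C_w r N F (\<lambda>z. F z - mat 1)"
proof -
  have "\<exists>\<alpha> \<beta> A B. l1_le \<alpha> A \<and> l1_le \<beta> B \<and>
      rh_row N (mat 1 $ i $ 1) (mat 1 $ i $ 2) (ser \<alpha>) (ser \<beta>)" for i :: 2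
    using rh_row_exists[of N "mat 1 $ i $ 1" "mat 1 $ i $ 2"] by metis
  then obtain \<alpha> \<beta> A B where l1: "\<And>i. l1_le (\<alpha> i) (A i)" "\<And>i. l1_le (\<beta> i) (B i)"
    and row: "\<And>i::2. rh_row N (mat 1 $ i $ 1) (mat 1 $ i $ 2) (ser (\<alpha> i)) (ser (\<beta> i))"
    by metis
  define F :: "complex \<Rightarrow> cmat" where "F z = (\<chi> i j. if j = 1 then zser (\<alpha> i) z else zser (\<beta> i) z)" for z
  have F1: "F (cis \<theta>) $ i $ 1 = ser (\<alpha> i) \<theta>" and F2: "F (cis \<theta>) $ i $ 2 = ser (\<beta> i) \<theta>" for i \<theta>
    by (simp_all add: F_def zser_cis)
  have sq: "sq_int (ser (\<alpha> i))" "sq_int (ser (\<beta> i))" for i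
    using row[of i] by (auto simp: rh_row_def)
  have "sq_int (\<lambda>\<theta>. F (cis \<theta>) $ i $ j)" for i j
    using sq[of i] exhaust_2[of j] F1[of _ i] F2[of _ i] by (auto simp: sq_int_def)
  then have mem: "F \<in> L2_circle_mat"
    by (simp add: L2_circle_mat_def L2_circle_iff)
  define Am :: "complex \<Rightarrow> cmat" where "Am z = (\<chi> i j. if j = 1 then 0 else F z $ i $ 2 - mat 1 $ i $ 2)" for z
  define Bm :: "complex \<Rightarrow> cmat" where "Bm z = (\<chi> i j. if j = 1 then F z $ i $ 1 - mat 1 $ i $ 1 else 0)" for z
  have A: "cauchy_plus (\<lambda>z. (F z ** w_minus r N z) $ i $ j) (\<lambda>z. Am z $ i $ j)" for i j
  proof (cases "j = 1")
    case True
    then show ?thesis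
      by (simp add: mat_mult_w_minus Am_def cauchy_plus_def cauchy_integral_zero)
  next
    case False
    then have j: "j = 2" using exhaust_2[of j] by auto
    have Fm: "(\<lambda>\<theta>. (F (cis \<theta>) ** w_minus r N (cis \<theta>)) $ i $ 2) = (\<lambda>\<theta>. - 1 * (Rc N \<theta> * ser (\<alpha> i) \<theta>))"
      unfolding mat_mult_w_minus Rc_cis F1 by (simp add: mult.commute)
    have fm: "(if m < 0 then fc (\<lambda>\<theta>. - 1 * (Rc N \<theta> * ser (\<alpha> i) \<theta>)) m else 0) = \<beta> i m + (- (mat 1 $ i $ 2)) * delta m" for m
      using row[of i] fc_ser[OF l1(2)[of i], of m] unfolding rh_row_def fc_cmult by (auto simp: delta_def)
    have dl: "l1_le (\<lambda>m. (- (mat 1 $ i $ 2)) * delta m) (norm (- (mat 1 $ i $ 2) :: complex) * 1)"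
      by (rule l1_le_cmult[OF l1_le_delta])
    show ?thesis unfolding j
    proof (rule cauchy_plusI)
      show "sq_int (\<lambda>\<theta>. (F (cis \<theta>) ** w_minus r N (cis \<theta>)) $ i $ 2)"
        unfolding Fm by (intro sq_int_cmult sq_int_bounded_mult[OF _ bounded_Rc] sq)
      show "l1_le (\<lambda>m. if m < 0 then fc (\<lambda>\<theta>. (F (cis \<theta>) ** w_minus r N (cis \<theta>)) $ i $ 2) m else 0)
          (B i + norm (- (mat 1 $ i $ 2) :: complex) * 1)"
        unfolding Fm fm by (rule l1_le_add[OF l1(2) dl])
      show "AE \<theta> in arc. Am (cis \<theta>) $ i $ 2 =
          ser (\<lambda>m. if m < 0 then fc (\<lambda>\<theta>. (F (cis \<theta>) ** w_minus r N (cis \<theta>)) $ i $ 2) m else 0) \<theta>"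
        unfolding Fm fm ser_add_delta[OF l1(2)] by (simp add: Am_def F2)
    qed
  qed
  have B: "cauchy_minus (\<lambda>z. (F z ** w_plus r N z) $ i $ j) (\<lambda>z. Bm z $ i $ j)" for i j
  proof (cases "j = 1")
    case False
    then have j: "j = 2" using exhaust_2[of j] by auto
    then show ?thesis
      by (simp add: mat_mult_w_plus Bm_def cauchy_minus_def cauchy_integral_zero)
  next
    case j: True
    have Fp: "(\<lambda>\<theta>. (F (cis \<theta>) ** w_plus r N (cis \<theta>)) $ i $ 1) = (\<lambda>\<theta>. R N \<theta> * ser (\<beta> i) \<theta>)"
      unfolding mat_mult_w_plus R_cis F2 by (simp add: mult.commute)
    have fm: "(if 0 \<le> m then - fc (\<lambda>\<theta>. R N \<theta> * ser (\<beta> i) \<theta>) m else 0) = \<alpha> i m + (- (mat 1 $ i $ 1)) * delta m" for m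
    proof -
      have "\<alpha> i m = (if 0 \<le> m then mat 1 $ i $ 1 * delta m - fc (\<lambda>\<theta>. R N \<theta> * ser (\<beta> i) \<theta>) m else 0)"
        using row[of i] fc_ser[OF l1(1)[of i], of m] unfolding rh_row_def by metis
      then show ?thesis by (simp add: delta_def)
    qed
    have dl: "l1_le (\<lambda>m. (- (mat 1 $ i $ 1)) * delta m) (norm (- (mat 1 $ i $ 1) :: complex) * 1)"
      by (rule l1_le_cmult[OF l1_le_delta])
    show ?thesis unfolding j
    proof (rule cauchy_minusI)
      show "sq_int (\<lambda>\<theta>. (F (cis \<theta>) ** w_plus r N (cis \<theta>)) $ i $ 1)"
        unfolding Fp by (intro sq_int_bounded_mult[OF _ bounded_R] sq)
      show "l1_le (\<lambda>m. if 0 \<le> m then - fc (\<lambda>\<theta>. (F (cis \<theta>) ** w_plus r N (cis \<theta>)) $ i $ 1) m else 0)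
          (A i + norm (- (mat 1 $ i $ 1) :: complex) * 1)"
        unfolding Fp fm by (rule l1_le_add[OF l1(1) dl])
      show "AE \<theta> in arc. Bm (cis \<theta>) $ i $ 1 =
          ser (\<lambda>m. if 0 \<le> m then - fc (\<lambda>\<theta>. (F (cis \<theta>) ** w_plus r N (cis \<theta>)) $ i $ 1) m else 0) \<theta>"
        unfolding Fp fm ser_add_delta[OF l1(1)] by (simp add: Bm_def F1)
    qed
  qed
  have "F z - mat 1 = Am z + Bm z" for z
  proof -
    have "(F z - mat 1) $ i $ j = (Am z + Bm z) $ i $ j" for i j
      using exhaust_2[of j] by (auto simp: Am_def Bm_def)
    then show ?thesis by (simp add: vec_eq_iff)
  qed
  then have "C_w r N F (\<lambda>z. F z - mat 1)"
    unfolding C_w_def using A B by (intro exI[of _ Am] exI[of _ Bm]) auto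
  with mem show ?thesis by blast
qed

text \<open>Whichever solution \<open>SOME\<close> selects, its first row is an
  \<open>rh_row\<close>. In the integral z^(-2) dz contributes \<i> e^(-\<i> \<theta>) d\<theta>,
  hence the coefficient at 1; the sign of \<open>w_minus\<close> cancels that of the clockwise
  orientation.\<close>

lemma reconstructed_potential_rh_row:
  obtains f g where "rh_row (n + 1) 1 0 f g" "reconstructed_potential r n = fc (\<lambda>\<theta>. Rc (n + 1) \<theta> * f \<theta>) 1"
proof -
  define F where "F = resolvent r (n + 1) (\<lambda>_. mat 1)"
  have F: "F \<in> L2_circle_mat \<and> C_w r (n + 1) F (\<lambda>z. F z - mat 1)"
    unfolding F_def resolvent_def by (rule someI_ex[OF resolvent_exists])
  define f where "f \<theta> = F (cis \<theta>) $ 1 $ 1" for \<theta>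
  have "rh_row (n + 1) (mat 1 $ (1::2) $ 1) (mat 1 $ (1::2) $ 2) f (\<lambda>\<theta>. F (cis \<theta>) $ 1 $ 2)"
    unfolding f_def[abs_def] using F by (intro C_w_imp_rh_row) auto
  then have row: "rh_row (n + 1) 1 0 f (\<lambda>\<theta>. F (cis \<theta>) $ 1 $ 2)" by (simp add: mat_def)
  have D: "RH_density r (n + 1) (cis \<theta>) $ 1 $ 2 = - (Rc (n + 1) \<theta> * f \<theta>)" for \<theta>
  proof -
    have "RH_density r (n + 1) (cis \<theta>) $ 1 $ 2 = (F (cis \<theta>) ** w_minus r (n + 1) (cis \<theta>)) $ 1 $ 2"
      unfolding RH_density_def F_def[symmetric] w_full_def
      by (simp add: matrix_matrix_mult_def sum_2 w_plus_def)
    then show ?thesis unfolding mat_mult_w_minus Rc_cis by (simp add: f_def)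
  qed
  have "cis \<theta> powi (- 2) * (RH_density r (n + 1) (cis \<theta>) $ 1 $ 2) * (\<i> * cis \<theta>) =
      - \<i> * (Rc (n + 1) \<theta> * f \<theta> * cis (- (of_int 1 * \<theta>)))" for \<theta>
  proof -
    have "cis \<theta> powi (- 2) * cis \<theta> = cis (- (of_int 1 * \<theta>))"
      unfolding cis_power_int cis_mult by (rule arg_cong[where f = cis]) simp
    then show ?thesis unfolding D by (metis (no_types, lifting) mult.assoc mult.commute mult_minus_left)
  qed
  then have "circle_integral (\<lambda>z. z powi (- 2) * RH_density r (n + 1) z $ 1 $ 2) =
      - (LINT \<theta>|arc. - \<i> * (Rc (n + 1) \<theta> * f \<theta> * cis (- (of_int 1 * \<theta>))))"
    unfolding circle_integral_def by presburger
  also have "\<dots> = - (- \<i> * (LINT \<theta>|arc. Rc (n + 1) \<theta> * f \<theta> * cis (- (of_int 1 * \<theta>))))"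
    by (subst Bochner_Integration.integral_mult_right_zero) (rule refl)
  finally have "reconstructed_potential r n = fc (\<lambda>\<theta>. Rc (n + 1) \<theta> * f \<theta>) 1"
    unfolding reconstructed_potential_def fc_def by simp
  with row show ?thesis by (rule that)
qed

end

section \<open>Decay of the potential\<close>

lemma l1_le_upper_tail:
  assumes "l2_le (\<lambda>m. of_real (wt m) * a m) C"
  shows "l1_le (\<lambda>m. if int M \<le> m then a m else 0) (2 / sqrt (1 + real M) * C)"
proof (rule l1_le_tail)
  show "l2_le (\<lambda>m. of_real (wt m) * (if int M \<le> m then a m else 0)) C"
    by (rule l2_le_mono[OF assms]) auto
qed auto

lemma l2_le_upper_tail:
  assumes "l2_le (\<lambda>m. of_real (wt m ^ k) * a m) C"
  shows "l2_le (\<lambda>m. if int M \<le> m then a m else 0) (C / (1 + real M) ^ k)"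
proof (rule l2_le_weighted_tail)
  show "l2_le (\<lambda>m. of_real (wt m ^ k) * (if int M \<le> m then a m else 0)) C"
    by (rule l2_le_mono[OF assms]) auto
qed auto

context reflection
begin

lemma R_norm: "norm (R N \<theta>) = norm (\<rho> \<theta>)"
  by (simp add: R_def norm_mult)

text \<open>With f - 1 and g collected in one sequence, the forcing is what the constant 1 produces,
  the negative half of \<open>Rc\<close>. Its norm \<tau> therefore governs the size of the
  solution.\<close>

lemma rh_row_split:
  assumes row: "rh_row N 1 0 f g"
    and \<tau>: "l2_le (\<lambda>m. if 0 \<le> m then 0 else fc (Rc N) m) \<tau>"
  obtains a where "l2_le a (\<tau> / (1 - \<kappa>))" "\<And>m. fc f m = delta m + (if 0 \<le> m then a m else 0)"
    "\<And>m. fc g m = (if 0 \<le> m then 0 else a m)"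
proof -
  have sq: "sq_int f" "sq_int g"
    and f: "\<And>m. fc f m = (if 0 \<le> m then delta m - conv (fc (R N)) (fc g) m else 0)"
    and g: "\<And>m. fc g m = (if 0 \<le> m then 0 else - conv (fc (Rc N)) (fc f) m)"
    using row unfolding rh_row_def by (auto simp: fc_R_mult fc_Rc_mult)
  obtain A' where A': "l1_le (fc (Rc N)) A'" using Rc_l1 .
  define a where "a m = (if 0 \<le> m then fc f m - delta m else 0) + fc g m" for m
  have fa: "fc f m = delta m + (if 0 \<le> m then a m else 0)" for m
    using f[of m] g[of m] by (auto simp: a_def delta_def)
  have ga: "fc g m = (if 0 \<le> m then 0 else a m)" for m
    using g[of m] by (simp add: a_def)
  have 1: "l2_le (\<lambda>m. if 0 \<le> m then fc f m - delta m else 0) (sqrt (nsq f) + 1)"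
    by (rule l2_le_mono[OF l2_le_diff[OF bessel[OF sq(1)] l2_le_delta]]) auto
  have a2: "l2_le a (sqrt (nsq f) + 1 + sqrt (nsq g))"
    unfolding a_def[abs_def] by (rule l2_le_add[OF 1 bessel[OF sq(2)]])
  have pa: "l2_le (\<lambda>m. if 0 \<le> m then a m else 0) (sqrt (nsq f) + 1 + sqrt (nsq g))"
    by (rule l2_le_mono[OF a2]) auto
  have eq: "a m = (if 0 \<le> m then 0 else - fc (Rc N) m) + kop (G N) a m" for m
  proof (cases "0 \<le> m")
    case True
    then have "a m = fc f m - delta m" by (simp add: fa)
    also have "\<dots> = - conv (fc (R N)) (\<lambda>m. if 0 \<le> m then 0 else a m) m"
      using f[of m] True by (simp only: ga[abs_def] if_True) simp
    finally show ?thesis using True by (simp add: kop_G)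
  next
    case False
    then have "a m = - conv (fc (Rc N)) (fc f) m" using ga[of m] g[of m] by simp
    also have "conv (fc (Rc N)) (fc f) m = conv (fc (Rc N)) (\<lambda>m. delta m + (if 0 \<le> m then a m else 0)) m"
      by (simp only: fa[abs_def])
    also have "\<dots> = fc (Rc N) m + conv (fc (Rc N)) (\<lambda>m. if 0 \<le> m then a m else 0) m"
      by (simp only: conv_add[OF A' l2_le_delta pa] conv_delta)
    finally show ?thesis using False by (simp add: kop_G)
  qed
  have y: "l2_le (\<lambda>m. if 0 \<le> m then 0 else - fc (Rc N) m) \<tau>"
    by (rule l2_le_mono[OF \<tau>]) auto
  have "l2_le a (\<tau> / (1 - \<kappa>))"
    by (rule contraction_bound[OF contraction_G a2 y eq])
  then show ?thesis using fa ga by (rule that)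
qed

text \<open>The constant in f = 1 + ... gives the leading coefficient. The remainder pairs
  \<open>a j\<close>, j \<ge> 0, with the conjugate of the coefficient of r at 2 N - 1 + j. The
  first factor has norm at most \<tau> / (1 - \<kappa>), the second at most \<tau>, and
  Cauchy-Schwarz finishes.\<close>

lemma potential_positive:
  assumes row: "rh_row N 1 0 f g"
    and \<tau>: "l2_le (\<lambda>m. if 2 * N - 1 \<le> m then fc \<rho> m else 0) \<tau>"
  shows "norm (fc (\<lambda>\<theta>. Rc N \<theta> * f \<theta>) 1 - cnj (fc \<rho> (2 * N - 1))) \<le> \<tau>\<^sup>2 / (1 - \<kappa>)"
proof -
  have sq: "sq_int f" using row by (simp add: rh_row_def)
  obtain A' where A': "l1_le (fc (Rc N)) A'" using Rc_l1 .
  \<comment> \<open>The forcing sees \<open>fc \<rho>\<close> at 2 N - m with m < 0, inside the tail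
    that starts at 2 N - 1.\<close>
  have y: "l2_le (\<lambda>m. if 0 \<le> m then 0 else fc (Rc N) m) \<tau>"
    by (rule l2_le_mono[OF l2_le_reindex[OF \<tau>, of "\<lambda>m. 2 * N - m"]]) (auto simp: fc_Rc)
  obtain a where a: "l2_le a (\<tau> / (1 - \<kappa>))" and fa: "\<And>m. fc f m = delta m + (if 0 \<le> m then a m else 0)"
    using rh_row_split[OF row y] by metis
  have pa: "l2_le (\<lambda>m. if 0 \<le> m then a m else 0) (\<tau> / (1 - \<kappa>))"
    by (rule l2_le_mono[OF a]) auto
  have "fc (\<lambda>\<theta>. Rc N \<theta> * f \<theta>) 1 = conv (fc (Rc N)) (\<lambda>m. delta m + (if 0 \<le> m then a m else 0)) 1"
    unfolding fc_Rc_mult[OF sq] by (simp only: fa[abs_def])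
  also have "\<dots> = fc (Rc N) 1 + conv (fc (Rc N)) (\<lambda>m. if 0 \<le> m then a m else 0) 1"
    by (simp only: conv_add[OF A' l2_le_delta pa] conv_delta)
  finally have "fc (\<lambda>\<theta>. Rc N \<theta> * f \<theta>) 1 - cnj (fc \<rho> (2 * N - 1)) =
      (\<Sum>\<^sub>\<infinity>j. fc (Rc N) (1 - j) * (if 0 \<le> j then a j else 0))"
    by (simp add: fc_Rc conv_def)
  moreover have l1: "l1_le (\<lambda>j. fc (Rc N) (1 - j) * (if 0 \<le> j then a j else 0)) (\<tau> * (\<tau> / (1 - \<kappa>)))"
    by (rule l1_le_mono[OF l2_le_mult[OF l2_le_reindex[OF \<tau> inj_int_shift(2), of "2 * N - 1"] a]])
       (auto simp: fc_Rc norm_mult algebra_simps)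
  ultimately show ?thesis
    using l1_le_norm_infsum[OF l1] by (simp add: power2_eq_square)
qed

section \<open>Half-line equations with symbol 1 / (1 - |r|^2)\<close>

definition \<phi> :: "real \<Rightarrow> complex" where
  "\<phi> \<theta> = 1 - of_real (1 / U) * u \<theta>"

text \<open>From 1 \<le> u \<le> U and 1 / U = 1 - \<kappa>^2. The undivided difference u - 1 is
  bounded by U - 1, which may exceed 1; hence the scaling.\<close>

lemma bounded_\<phi>: "bounded_meas \<phi> (\<kappa>\<^sup>2)"
proof -
  have "norm (\<phi> \<theta>) \<le> \<kappa>\<^sup>2" for \<theta>
  proof -
    have "1 / U * 1 \<le> 1 / U * Re (u \<theta>)" "1 / U * Re (u \<theta>) \<le> 1 / U * U"
      using Re_u[of \<theta>] U_ge_1 by (intro mult_left_mono; simp)+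
    moreover have "1 / U = 1 - \<kappa>\<^sup>2" "1 / U * U = 1" using \<kappa>2 by (simp_all add: U_def)
    ultimately have "1 - \<kappa>\<^sup>2 \<le> 1 / U * Re (u \<theta>)" "1 / U * Re (u \<theta>) \<le> 1" by simp_all
    then have "\<bar>1 - 1 / U * Re (u \<theta>)\<bar> \<le> \<kappa>\<^sup>2"
      using zero_le_power2[of \<kappa>] by (simp only: abs_le_iff) linarith
    moreover have "\<phi> \<theta> = of_real (1 - 1 / U * Re (u \<theta>))"
      unfolding \<phi>_def by (subst u_of_real) simp
    ultimately show ?thesis
      by (simp only: norm_of_real)
  qed
  moreover have "\<phi> \<in> borel_measurable arc"
    unfolding \<phi>_def[abs_def] using bounded_u by (auto simp: bounded_meas_def)
  ultimately show ?thesis by (simp add: bounded_meas_def)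
qed

lemma fc_\<phi>: "fc \<phi> = (\<lambda>m. delta m + - of_real (1 / U) * fc u m)"
proof
  fix m
  have "integrable arc (\<lambda>\<theta>. of_real (1 / U) * u \<theta>)"
    by (intro Bochner_Integration.integrable_mult_right bounded_meas_integrable[OF bounded_u])
  then have "fc \<phi> m = fc (\<lambda>_. 1) m - fc (\<lambda>\<theta>. of_real (1 / U) * u \<theta>) m"
    unfolding \<phi>_def[abs_def] by (rule fc_diff[OF integrable_const_arc])
  then show "fc \<phi> m = delta m + - of_real (1 / U) * fc u m"
    unfolding fc_cmult fc_1_delta by simp
qed

lemma sob_\<phi>: "sob k (fc \<phi>)"
  unfolding fc_\<phi> by (intro sob_add sob_delta sob_cmult sob_u)

text \<open>
  On the frequencies in \<open>P\<close>, the compression of multiplication by \<open>u\<close> is \<open>U (1 - T P)\<close>.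
\<close>

definition T :: "(int \<Rightarrow> bool) \<Rightarrow> int \<Rightarrow> int \<Rightarrow> complex" where
  "T P m j = (if P m \<and> P j then fc \<phi> (m - j) else 0)"

lemma kop_T: "kop (T P) a m = (if P m then conv (fc \<phi>) (\<lambda>j. if P j then a j else 0) m else 0)"
proof (cases "P m")
  case True
  have "kop (T P) a m = (\<Sum>\<^sub>\<infinity>j. fc \<phi> (m - j) * (if P j then a j else 0))"
    unfolding kop_def by (rule infsum_cong) (simp add: T_def True)
  then show ?thesis using True by (simp add: conv_def)
next
  case False
  then show ?thesis by (simp add: kop_def T_def)
qed

lemma contraction_T: "contraction (T P) (\<kappa>\<^sup>2)"
  unfolding contraction_def
proof (intro conjI allI impI)
  fix a :: "int \<Rightarrow> complex" and C assume a: "l2_le a C"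
  obtain A where A: "l1_le (fc \<phi>) A" using sob_l1[OF sob_\<phi> k] by blast
  have "l2_le (\<lambda>j. if P j then a j else 0) C" by (rule l2_le_mono[OF a]) auto
  from conv_multiplier[OF bounded_\<phi> A this]
  show "l2_le (kop (T P) a) (\<kappa>\<^sup>2 * C)"
    by (rule l2_le_mono) (auto simp: kop_T)
qed (use \<kappa>2 in auto)

lemma decaying_T: obtains B where "decaying_kernel (T P) (fc \<phi>) B"
proof -
  obtain B where B: "l2_le (\<lambda>m. of_real (wt m) * fc \<phi> m) B" using sob_ex_wt[OF sob_\<phi> k] by blast
  then have "decaying_kernel (T P) (fc \<phi>) B"
    by unfold_locales (auto simp: T_def)
  then show ?thesis by (rule that)
qed

lemma kop_T_supported:
  assumes a: "l2_le a A" and supp: "\<And>m. \<not> P m \<Longrightarrow> a m = 0" and P: "P m"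
  shows "kop (T P) a m = a m - of_real (1 / U) * conv (fc u) a m"
proof -
  obtain Au where Au: "l1_le (fc u) Au" using sob_l1[OF sob_u k] by blast
  have s: "(\<lambda>j. if P j then a j else 0) = a" using supp by auto
  have d: "((\<lambda>j. delta (m - j) * a j) has_sum a m) UNIV"
    by (rule has_sum_finite_neutralI[of "{m}"]) (auto simp: delta_def)
  have c: "((\<lambda>j. - of_real (1 / U) * (fc u (m - j) * a j)) has_sum (- of_real (1 / U) * conv (fc u) a m)) UNIV"
    unfolding conv_def by (intro has_sum_cmult_right has_sum_infsum conv_summable[OF Au a])
  have "((\<lambda>j. fc \<phi> (m - j) * a j) has_sum (a m + - of_real (1 / U) * conv (fc u) a m)) UNIV"
    using has_sum_add[OF d c] unfolding fc_\<phi> by (simp only: distrib_right mult.assoc)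
  from infsumI[OF this] show ?thesis
    using P unfolding kop_T s by (simp add: conv_def)
qed

text \<open>On \<open>P\<close> the equation reads v = y / U + T v. The solution is obtained in H^1,
  hence is summable, as \<open>sob_half_line_correlation\<close> requires.\<close>

lemma toeplitz_solution:
  assumes y: "sob k y"
  obtains v where "sob 1 v" "\<And>m. \<not> P m \<Longrightarrow> v m = 0" "\<And>m. P m \<Longrightarrow> conv (fc u) v m = y m"
proof -
  define y' where "y' m = (if P m then of_real (1 / U) * y m else 0)" for m
  have "sob k y'"
    unfolding y'_def[abs_def] by (rule sob_mono_norm[OF sob_cmult[OF y, of "of_real (1 / U)"]]) auto
  then obtain Y where Y: "l2_le (\<lambda>m. of_real (wt m) * y' m) Y" using sob_ex_wt k by blast
  obtain B where D: "decaying_kernel (T P) (fc \<phi>) B" using decaying_T .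
  obtain v C where v: "l2_le (\<lambda>m. of_real (wt m) * v m) C" "\<And>m. v m = y' m + kop (T P) v m"
    using decaying_kernel.solution_exists[OF D contraction_T Y] by blast
  have v2: "l2_le v C"
    by (rule l2_le_mono[OF v(1)]) (auto simp: norm_mult mult_le_cancel_right1 wt_ge_1)
  have supp: "v m = 0" if "\<not> P m" for m
    using v(2)[of m] that by (simp add: y'_def kop_T)
  have "conv (fc u) v m = y m" if P: "P m" for m
  proof -
    have "of_real (1 / U) * conv (fc u) v m = of_real (1 / U) * y m"
      using v(2)[of m] kop_T_supported[of v C P m, OF v2 supp P] P by (auto simp: y'_def)
    then show ?thesis using U_ge_1 by simp
  qed
  with sob_1I[OF v(1)] supp show ?thesis by (rule that)
qed

text \<open>The constant is exactly 1 because (1 / U) / (1 - \<kappa>^2) = 1. It mirrors u \<ge> 1,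
  by which no compression of \<open>u\<close> shrinks norms.\<close>

lemma toeplitz_bound:
  assumes a: "l2_le a A" and supp: "\<And>m. \<not> P m \<Longrightarrow> a m = 0"
    and Y: "l2_le (\<lambda>m. if P m then conv (fc u) a m else 0) Y"
  shows "l2_le a Y"
proof -
  have eq: "a m = of_real (1 / U) * (if P m then conv (fc u) a m else 0) + kop (T P) a m" for m
  proof (cases "P m")
    case True
    then show ?thesis using kop_T_supported[of a A P m, OF a supp True] by simp
  next
    case False
    then show ?thesis using supp[of m] by (simp add: kop_T)
  qed
  have "l2_le a (norm (complex_of_real (1 / U)) * Y / (1 - \<kappa>\<^sup>2))"
    by (rule contraction_bound[OF contraction_T a l2_le_cmult[OF Y] eq])
  moreover have "norm (complex_of_real (1 / U)) * Y / (1 - \<kappa>\<^sup>2) = Y"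
    using \<kappa>2 unfolding norm_of_real U_def by simp
  ultimately show ?thesis by simp
qed

definition s :: "real \<Rightarrow> complex" where
  "s \<theta> = cnj (\<rho> \<theta>) * u \<theta>"

lemma sob_s: "sob k (fc s)"
proof -
  have sr: "sob k (fc (\<lambda>\<theta>. cnj (\<rho> \<theta>)))"
    using sob_reflect[OF sob_\<rho>] unfolding fc_cnj[abs_def] .
  then obtain A where "l1_le (fc (\<lambda>\<theta>. cnj (\<rho> \<theta>))) A" using sob_l1 k by blast
  then have "fc s m = conv (fc (\<lambda>\<theta>. cnj (\<rho> \<theta>))) (fc u) m" for m
    unfolding s_def[abs_def]
    by (rule fc_mult[OF bounded_meas_cnj[OF \<rho>] _ bounded_meas_integrable[OF bounded_u]])
  then have "fc s = conv (fc (\<lambda>\<theta>. cnj (\<rho> \<theta>))) (fc u)" ..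
  then show ?thesis by (simp add: sob_conv[OF sr sob_u k])
qed

end

section \<open>Weighted summability from a leading term and an error bound\<close>

lemma weighted_decay_l2: "l2_le (\<lambda>m. complex_of_real (1 / wt m)) 2"
  using l2_le_wt_tail[of 0] by simp

text \<open>With W = wt (g n), the weight W^k turns the leading term into an injective sampling of
  an l2 sequence and leaves K / W of the error, square summable because \<open>g\<close> is
  injective. Comparing \<open>wt n\<close> with W costs 2^k.\<close>

lemma sob_from_approximation:
  assumes Q: "sob k Q" and g: "inj g" and K: "0 \<le> K"
    and wt: "\<And>n. P n \<Longrightarrow> wt n \<le> 2 * wt (g n)"
    and approx: "\<And>n. P n \<Longrightarrow> norm (q n - Q (g n)) \<le> K / wt (g n) ^ (k + 1)"
  shows "sob k (\<lambda>n. if P n then q n else 0)"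
proof -
  obtain D where D: "l2_le (\<lambda>m. of_real (wt m ^ k) * Q m) D" using Q by (auto simp: sob_def)
  define b1 where "b1 n = complex_of_real (norm (of_real (wt (g n) ^ k) * Q (g n)))" for n
  define b2 where "b2 n = complex_of_real K * complex_of_real (1 / wt (g n))" for n
  have "l2_le b1 D"
    by (rule l2_le_mono[OF l2_le_reindex[OF D g]]) (auto simp: b1_def)
  moreover have "l2_le b2 (norm (complex_of_real K) * 2)"
    unfolding b2_def[abs_def] by (rule l2_le_cmult[OF l2_le_reindex[OF weighted_decay_l2 g]])
  ultimately have "l2_le (\<lambda>n. b1 n + b2 n) (D + norm (complex_of_real K) * 2)"
    by (rule l2_le_add)
  note l2_le_cmult[OF this, of "2 ^ k"]
  then have "l2_le (\<lambda>n. of_real (wt n ^ k) * (if P n then q n else 0))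
     (norm (2 ^ k :: complex) * (D + norm (complex_of_real K) * 2))"
  proof (rule l2_le_mono)
    fix n
    define W where "W = wt (g n)"
    have W: "1 \<le> W" unfolding W_def by (rule wt_ge_1)
    have nb: "norm (b1 n + b2 n) = W ^ k * norm (Q (g n)) + K * (1 / W)"
    proof -
      have "b1 n + b2 n = of_real (norm (of_real (W ^ k) * Q (g n)) + K * (1 / W))"
        by (simp only: b1_def b2_def W_def of_real_add of_real_mult)
      also have "norm \<dots> = norm (of_real (W ^ k) * Q (g n)) + K * (1 / W)"
        unfolding norm_of_real using K W by (intro abs_of_nonneg add_nonneg_nonneg mult_nonneg_nonneg) auto
      finally show ?thesis using W by (simp add: norm_mult norm_power)
    qed
    show "norm (of_real (wt n ^ k) * (if P n then q n else 0)) \<le> norm (2 ^ k * (b1 n + b2 n))"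
    proof (cases "P n")
      case True
      have "norm (q n) \<le> norm (Q (g n)) + K / W ^ (k + 1)"
        using approx[OF True] norm_triangle_ineq2[of "q n" "Q (g n)"] by (simp add: W_def)
      then have "wt n ^ k * norm (q n) \<le> (2 * W) ^ k * (norm (Q (g n)) + K / W ^ (k + 1))"
        using wt[OF True] by (intro mult_mono power_mono) (use K W in \<open>auto simp: W_def\<close>)
      also have "\<dots> = 2 ^ k * (W ^ k * norm (Q (g n)) + K * (1 / W))"
        using W by (simp add: distrib_left power_mult_distrib)
      finally show ?thesis using True unfolding norm_mult[of "2 ^ k"] nb by (simp add: norm_mult norm_power)
    qed simp
  qed simp
  then show ?thesis by (auto simp: sob_def)
qed

section \<open>The potential for negative n\<close>

context reflection
begin

text \<open>u (1 - |R|^2) = 1 inverts the passage from (f, g) to (x, e): f = u (x - R e) and g = u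
  (e - Rc x). That f has no negative and g no nonnegative frequencies then becomes the pair of
  equations for u x and u e.\<close>

lemma negative_functions:
  assumes row: "rh_row N 1 0 f g"
    and e_def: "e = (\<lambda>\<theta>. g \<theta> + Rc N \<theta> * f \<theta>)" and x_def: "x = (\<lambda>\<theta>. f \<theta> + R N \<theta> * g \<theta>)"
  shows "sq_int e" "sq_int x"
    and "m < 0 \<Longrightarrow> fc e m = 0"
    and "fc e 1 = fc (\<lambda>\<theta>. Rc N \<theta> * f \<theta>) 1"
    and "0 \<le> m \<Longrightarrow> fc x m = delta m"
    and "m < 0 \<Longrightarrow> fc (\<lambda>\<theta>. u \<theta> * x \<theta>) m = fc (\<lambda>\<theta>. u \<theta> * R N \<theta> * e \<theta>) m"
    and "0 \<le> m \<Longrightarrow> fc (\<lambda>\<theta>. u \<theta> * e \<theta>) m = fc (\<lambda>\<theta>. u \<theta> * Rc N \<theta> * x \<theta>) m"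
proof -
  have sq: "sq_int f" "sq_int g"
    and f: "\<And>m. fc f m = (if 0 \<le> m then delta m - fc (\<lambda>\<theta>. R N \<theta> * g \<theta>) m else 0)"
    and g: "\<And>m. fc g m = (if 0 \<le> m then 0 else - fc (\<lambda>\<theta>. Rc N \<theta> * f \<theta>) m)"
    using row unfolding rh_row_def by auto
  have sR: "sq_int (\<lambda>\<theta>. R N \<theta> * g \<theta>)" and sRc: "sq_int (\<lambda>\<theta>. Rc N \<theta> * f \<theta>)"
    by (rule sq_int_bounded_mult[OF sq(2) bounded_R], rule sq_int_bounded_mult[OF sq(1) bounded_Rc])
  show e: "sq_int e" and x: "sq_int x"
    unfolding e_def x_def by (intro sq_int_add sq sR sRc)+
  have fe: "fc e m = fc g m + fc (\<lambda>\<theta>. Rc N \<theta> * f \<theta>) m" for m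
    unfolding e_def by (rule fc_add[OF sq_int_integrable[OF sq(2)] sq_int_integrable[OF sRc]])
  have fx: "fc x m = fc f m + fc (\<lambda>\<theta>. R N \<theta> * g \<theta>) m" for m
    unfolding x_def by (rule fc_add[OF sq_int_integrable[OF sq(1)] sq_int_integrable[OF sR]])
  show "m < 0 \<Longrightarrow> fc e m = 0" by (simp add: fe g)
  show "fc e 1 = fc (\<lambda>\<theta>. Rc N \<theta> * f \<theta>) 1" by (simp add: fe g)
  show "0 \<le> m \<Longrightarrow> fc x m = delta m" by (simp add: fx f)
  have ub: "u \<theta> * (1 - R N \<theta> * Rc N \<theta>) = 1" for \<theta>
  proof -
    have "R N \<theta> * Rc N \<theta> = b \<theta>"
      unfolding Rc_def b_def complex_norm_square[symmetric] R_norm ..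
    then have "u \<theta> * (1 - R N \<theta> * Rc N \<theta>) = u \<theta> - b \<theta> * u \<theta>"
      by (simp only: right_diff_distrib mult.commute mult_1_left)
    also have "\<dots> = 1" unfolding diff_eq_eq by (rule u_eq)
    finally show ?thesis .
  qed
  have uR: "bounded_meas (\<lambda>\<theta>. u \<theta> * R N \<theta>) (U * \<kappa>)" "bounded_meas (\<lambda>\<theta>. u \<theta> * Rc N \<theta>) (U * \<kappa>)"
    by (intro bounded_meas_mult bounded_u bounded_R bounded_Rc)+
  have i1: "integrable arc (\<lambda>\<theta>. u \<theta> * x \<theta>)" "integrable arc (\<lambda>\<theta>. u \<theta> * e \<theta>)"
    by (rule sq_int_integrable[OF sq_int_bounded_mult[OF x bounded_u]],
        rule sq_int_integrable[OF sq_int_bounded_mult[OF e bounded_u]])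
  have i2: "integrable arc (\<lambda>\<theta>. u \<theta> * R N \<theta> * e \<theta>)" "integrable arc (\<lambda>\<theta>. u \<theta> * Rc N \<theta> * x \<theta>)"
    by (rule sq_int_integrable[OF sq_int_bounded_mult[OF e uR(1)]],
        rule sq_int_integrable[OF sq_int_bounded_mult[OF x uR(2)]])
  have f_eq: "f = (\<lambda>\<theta>. u \<theta> * x \<theta> - u \<theta> * R N \<theta> * e \<theta>)"
  proof
    fix \<theta>
    have "u \<theta> * x \<theta> - u \<theta> * R N \<theta> * e \<theta> = u \<theta> * (1 - R N \<theta> * Rc N \<theta>) * f \<theta>"
      by (simp add: x_def e_def algebra_simps)
    then show "f \<theta> = u \<theta> * x \<theta> - u \<theta> * R N \<theta> * e \<theta>" by (simp add: ub)
  qed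
  have g_eq: "g = (\<lambda>\<theta>. u \<theta> * e \<theta> - u \<theta> * Rc N \<theta> * x \<theta>)"
  proof
    fix \<theta>
    have "u \<theta> * e \<theta> - u \<theta> * Rc N \<theta> * x \<theta> = u \<theta> * (1 - R N \<theta> * Rc N \<theta>) * g \<theta>"
      by (simp add: x_def e_def algebra_simps)
    then show "g \<theta> = u \<theta> * e \<theta> - u \<theta> * Rc N \<theta> * x \<theta>" by (simp add: ub)
  qed
  show "fc (\<lambda>\<theta>. u \<theta> * x \<theta>) m = fc (\<lambda>\<theta>. u \<theta> * R N \<theta> * e \<theta>) m" if "m < 0"
    using f[of m] that fc_diff[OF i1(1) i2(1), of m] f_eq by simp
  show "fc (\<lambda>\<theta>. u \<theta> * e \<theta>) m = fc (\<lambda>\<theta>. u \<theta> * Rc N \<theta> * x \<theta>) m" if "0 \<le> m"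
    using g[of m] that fc_diff[OF i1(2) i2(2), of m] g_eq by simp
qed

lemma fc_uRc: "fc (\<lambda>\<theta>. u \<theta> * Rc N \<theta>) m = fc s (m - 2 * N)"
proof -
  have "u \<theta> * Rc N \<theta> = cis (of_int (2 * N) * \<theta>) * s \<theta>" for \<theta>
    by (simp add: Rc_def R_def s_def cis_cnj)
  then show ?thesis by (simp only: fc_shift)
qed

lemma fc_uR: "fc (\<lambda>\<theta>. u \<theta> * R N \<theta>) m = cnj (fc s (- m - 2 * N))"
proof -
  have "u \<theta> * R N \<theta> = cnj (u \<theta> * Rc N \<theta>)" for \<theta>
    by (simp add: Rc_def u_def)
  then show ?thesis by (simp only: fc_cnj fc_uRc)
qed

text \<open>\<open>Q\<close> and \<open>C\<close> are fixed before \<open>L\<close>: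
  \<open>v\<close> and \<open>y\<close> depend on r alone, and the solution itself enters through
  the uniform bound \<open>X\<close>. For N = -L the couplings between the half-lines involve
  coefficients of \<open>s\<close> from M = 2 L on, which makes them small.\<close>

lemma potential_negative:
  obtains Q C where "sob k Q" "\<And>L f g. rh_row (- int L) 1 0 f g \<Longrightarrow>
      norm (fc (\<lambda>\<theta>. Rc (- int L) \<theta> * f \<theta>) 1 - Q (2 * int L)) \<le> C / (1 + real (2 * L)) ^ (k + 1)"
proof -
  define \<sigma> where "\<sigma> = fc s"
  have \<sigma>: "sob k \<sigma>" unfolding \<sigma>_def by (rule sob_s)
  obtain C\<sigma> where C\<sigma>: "l2_le (\<lambda>m. of_real (wt m) * \<sigma> m) C\<sigma>" using sob_ex_wt[OF \<sigma> k] by blast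
  obtain Ck where Ck: "l2_le (\<lambda>m. of_real (wt m ^ k) * \<sigma> m) Ck" using \<sigma> by (auto simp: sob_def)
  obtain A\<sigma> where A\<sigma>: "l1_le \<sigma> A\<sigma>" using sob_l1[OF \<sigma> k] by blast
  obtain C\<rho> where C\<rho>: "l2_le (fc \<rho>) C\<rho>" using sob_l2[OF sob_\<rho>] by blast
  obtain Au where Au: "l1_le (fc u) Au" using sob_l1[OF sob_u k] by blast
  obtain v where v: "sob 1 v" "\<And>m. \<not> 0 \<le> m \<Longrightarrow> v m = 0"
    "\<And>m. 0 \<le> m \<Longrightarrow> conv (fc u) v m = (if m = 1 then 1 else 0)"
    using toeplitz_solution[OF sob_finite_support[of "{1}" "\<lambda>m. if m = 1 then 1 else 0"], of "\<lambda>m. 0 \<le> m"] by auto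
  obtain V where V: "l1_le v V" using sob_l1[OF v(1)] by auto
  have u': "sob k (\<lambda>m. - fc u m)" by (rule sob_mono_norm[OF sob_u]) simp
  \<comment> \<open>\<open>w\<close> corrects the constant 1 so that y = 1 + w satisfies P_-(u y) =
    0; the constant contributes \<open>fc u\<close> itself.\<close>
  obtain w where w: "sob 1 w" "\<And>m. \<not> m < 0 \<Longrightarrow> w m = 0" "\<And>m. m < 0 \<Longrightarrow> conv (fc u) w m = - fc u m"
    using toeplitz_solution[OF u', of "\<lambda>m. m < 0"] by blast
  obtain W where W: "l1_le w W" using sob_l1[OF w(1)] by auto
  define y where "y m = delta m + w m" for m
  have y1: "l1_le y (1 + W)" unfolding y_def[abs_def] by (rule l1_le_add[OF l1_le_delta W])
  have y_supp: "y m = 0" if "0 < m" for m using that w(2)[of m] by (simp add: y_def delta_def)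
  \<comment> \<open>\<open>Q1 (M + j)\<close> will be the coefficient at j of u Rc y, for j \<ge> 0.
    The sum is one-sided because \<open>y\<close> has no positive frequencies; the pairing with
    \<open>v\<close> in \<open>Q\<close> is one-sided as well, so H^k is kept both times.\<close>
  define Q1 where "Q1 i = (if 0 \<le> i then \<Sum>\<^sub>\<infinity>j. y (- j) * \<sigma> (i + j) else 0)" for i
  have Q1: "sob k Q1" unfolding Q1_def[abs_def]
    by (rule sob_half_line_correlation[OF l1_le_reindex[OF y1] _ \<sigma>]) (auto intro: y_supp)
  define Q where "Q i = (if 0 \<le> i then \<Sum>\<^sub>\<infinity>j. cnj (v j) * Q1 (i + j) else 0)" for i
  have V': "l1_le (\<lambda>j. cnj (v j)) V" by (rule l1_le_mono[OF V]) auto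
  have Q: "sob k Q" unfolding Q_def[abs_def]
    by (rule sob_half_line_correlation[OF V' _ Q1]) (simp add: v(2))
  \<comment> \<open>The bound of \<open>rh_row_split\<close> with the full l2 norm of the
    coefficients of r in place of a tail. Then 1 + A0 bounds f and \<kappa> * A0 bounds R g, so
    \<open>X\<close> bounds x = f + R g.\<close>
  define A0 where "A0 = C\<rho> / (1 - \<kappa>)"
  define X where "X = 1 + A0 + \<kappa> * A0"
  \<comment> \<open>V * \<tau> * H^2 * X without its powers of 1 + M: \<open>Ck\<close> stems from
    the l2 tail \<tau> and one \<open>2 * C\<sigma>\<close> from each l1 tail
    \<open>H\<close>.\<close>
  define C where "C = V * (Ck * ((2 * C\<sigma>) * ((2 * C\<sigma>) * X)))"
  have bound: "norm (fc (\<lambda>\<theta>. Rc (- int L) \<theta> * f \<theta>) 1 - Q (2 * int L)) \<le> C / (1 + real (2 * L)) ^ (k + 1)"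
    if row: "rh_row (- int L) 1 0 f g" for L f g
  proof -
    define N where "N = - int L"
    define M where "M = 2 * L"
    have NM: "- (2 * N) = int M" by (simp add: N_def M_def)
    have row: "rh_row N 1 0 f g" using row by (simp add: N_def)
    then have sqf: "sq_int f" and sqg: "sq_int g" by (auto simp: rh_row_def)
    define e where "e = (\<lambda>\<theta>. g \<theta> + Rc N \<theta> * f \<theta>)"
    define x where "x = (\<lambda>\<theta>. f \<theta> + R N \<theta> * g \<theta>)"
    let ?uR = "\<lambda>\<theta>. u \<theta> * R N \<theta>" and ?uRc = "\<lambda>\<theta>. u \<theta> * Rc N \<theta>"
    note nf = negative_functions[OF row e_def x_def]
    define H where "H = 2 / sqrt (1 + real M) * C\<sigma>"
    have tail1: "l1_le (\<lambda>m. if int M \<le> m then \<sigma> m else 0) H"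
      unfolding H_def by (rule l1_le_upper_tail[OF C\<sigma>])
    have uRcl: "l1_le (fc ?uRc) A\<sigma>"
      by (rule l1_le_mono[OF l1_le_reindex[OF A\<sigma>, of "\<lambda>m. m - 2 * N"]]) (auto simp: fc_uRc \<sigma>_def)
    have uRl: "l1_le (fc ?uR) A\<sigma>"
    proof (rule l1_le_mono[OF l1_le_reindex[OF A\<sigma>, of "\<lambda>m. - 2 * N - m"]])
      show "norm (fc ?uR m) \<le> norm (\<sigma> (- 2 * N - m))" for m
      proof -
        have eq: "- m - 2 * N = - 2 * N - m" by simp
        show ?thesis unfolding fc_uR \<sigma>_def eq by (simp only: complex_mod_cnj order_refl)
      qed
    qed auto
    have uR: "bounded_meas ?uR (U * \<kappa>)" "bounded_meas ?uRc (U * \<kappa>)"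
      by (intro bounded_meas_mult bounded_u bounded_R bounded_Rc)+
    \<comment> \<open>a bound on \<open>x\<close> that does not depend on \<open>L\<close>\<close>
    have xX: "l2_le (fc x) X"
    proof -
      have "l2_le (\<lambda>m. if 0 \<le> m then 0 else fc (Rc N) m) C\<rho>"
        by (rule l2_le_mono[OF l2_le_reindex[OF C\<rho>, of "\<lambda>m. 2 * N - m"]]) (auto simp: fc_Rc)
      from rh_row_split[OF row this] obtain a where
        a: "l2_le a A0" "\<And>m. fc f m = delta m + (if 0 \<le> m then a m else 0)" "\<And>m. fc g m = (if 0 \<le> m then 0 else a m)"
        unfolding A0_def by metis
      have "l2_le (\<lambda>m. if 0 \<le> m then a m else 0) A0" by (rule l2_le_mono[OF a(1)]) auto
      from l2_le_add[OF l2_le_delta this] have f: "l2_le (fc f) (1 + A0)"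
        by (rule l2_le_mono) (simp_all add: a(2))
      have "l2_le (fc g) A0" by (rule l2_le_mono[OF a(1)]) (simp_all add: a(3))
      moreover obtain A where "l1_le (fc (R N)) A" using R_l1 .
      ultimately have "l2_le (conv (fc (R N)) (fc g)) (\<kappa> * A0)"
        using conv_multiplier[OF bounded_R] by blast
      from l2_le_add[OF f this] show ?thesis
      proof (rule l2_le_mono)
        fix m
        have "fc x m = fc f m + conv (fc (R N)) (fc g) m"
          unfolding x_def fc_R_mult[OF sqg, symmetric]
          by (rule fc_add[OF sq_int_integrable[OF sqf] sq_int_integrable[OF sq_int_bounded_mult[OF sqg bounded_R]]])
        then show "norm (fc x m) \<le> norm (fc f m + conv (fc (R N)) (fc g) m)" by simp
      qed (simp add: X_def)
    qed
    have e2: "l2_le (fc e) (sqrt (nsq e))" by (rule bessel[OF nf(1)])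
    have ue: "fc (\<lambda>\<theta>. u \<theta> * e \<theta>) m = conv (fc u) (fc e) m" for m
      by (rule fc_mult[OF bounded_u Au sq_int_integrable[OF nf(1)]])
    have ux: "fc (\<lambda>\<theta>. u \<theta> * x \<theta>) m = conv (fc u) (fc x) m" for m
      by (rule fc_mult[OF bounded_u Au sq_int_integrable[OF nf(2)]])
    have uRe: "fc (\<lambda>\<theta>. u \<theta> * R N \<theta> * e \<theta>) m = conv (fc ?uR) (fc e) m" for m
      by (rule fc_mult[OF uR(1) uRl sq_int_integrable[OF nf(1)]])
    have uRcx: "fc (\<lambda>\<theta>. u \<theta> * Rc N \<theta> * x \<theta>) m = conv (fc ?uRc) (fc x) m" for m
      by (rule fc_mult[OF uR(2) uRcl sq_int_integrable[OF nf(2)]])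
    \<comment> \<open>Outputs m \<ge> 0 meet inputs j \<le> 0, as x is 1 plus negative frequencies.
      So the index m - j + M is at least M and only the tail of \<open>\<sigma>\<close>
      acts.\<close>
    have eE: "l2_le (fc e) (H * X)"
    proof (rule toeplitz_bound[where P = "\<lambda>m. 0 \<le> m", OF e2])
      show "fc e m = 0" if "\<not> 0 \<le> m" for m using nf(3)[of m] that by simp
      define t where "t m j = (if 0 \<le> m then \<sigma> (m - j + int M) * fc x j else 0)" for m j
      have "l2_le (\<lambda>m. \<Sum>\<^sub>\<infinity>j. t m j) (H * X)"
      proof (rule young_l1_l2[OF l1_le_reindex[OF tail1, of "\<lambda>i. i + int M"] xX])
        show "norm (t m j) \<le> norm (if int M \<le> m - j + int M then \<sigma> (m - j + int M) else 0) * norm (fc x j)" for m j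
          using nf(5)[of j] by (auto simp: t_def norm_mult delta_def)
      qed simp
      moreover have "(\<Sum>\<^sub>\<infinity>j. t m j) = (if 0 \<le> m then conv (fc u) (fc e) m else 0)" for m
      proof (cases "0 \<le> m")
        case True
        have "conv (fc u) (fc e) m = conv (fc ?uRc) (fc x) m"
          using nf(7)[OF True] unfolding ue uRcx .
        also have "\<dots> = (\<Sum>\<^sub>\<infinity>j. t m j)"
          unfolding conv_def
        proof (rule infsum_cong)
          fix j
          have eq: "m - j - 2 * N = m - j + int M" using NM by simp
          show "fc ?uRc (m - j) * fc x j = t m j"
            unfolding fc_uRc eq t_def \<sigma>_def using True by simp
        qed
        finally show ?thesis using True by simp
      qed (simp add: t_def)
      ultimately show "l2_le (\<lambda>m. if 0 \<le> m then conv (fc u) (fc e) m else 0) (H * X)" by simp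
    qed
    define d where "d m = fc x m - y m" for m
    have d_supp: "d m = 0" if "\<not> m < 0" for m
      using that nf(5)[of m] w(2)[of m] by (simp add: d_def y_def)
    have y2: "l2_le y (1 + W)" by (rule l1_le_imp_l2_le[OF y1])
    have d2: "l2_le d (X + (1 + W))" unfolding d_def[abs_def] by (rule l2_le_diff[OF xX y2])
    have x_eq: "fc x = (\<lambda>m. y m + d m)" by (simp add: d_def)
    \<comment> \<open>Since P_-(u y) = 0, the difference satisfies P_-(u d) = P_-(u R e). Now m < 0
      and j \<ge> 0, which again confines \<open>\<sigma>\<close> to its tail; the size H * X of e
      brings in the second factor \<open>H\<close>.\<close>
    have dD: "l2_le d (H * (H * X))"
    proof (rule toeplitz_bound[where P = "\<lambda>m. m < 0", OF d2 d_supp])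
      define t where "t m j = (if m < 0 then cnj (\<sigma> (int M - (m - j))) * fc e j else 0)" for m j
      have "l2_le (\<lambda>m. \<Sum>\<^sub>\<infinity>j. t m j) (H * (H * X))"
      proof (rule young_l1_l2[OF l1_le_reindex[OF tail1, of "\<lambda>i. int M - i"] eE])
        show "norm (t m j) \<le> norm (if int M \<le> int M - (m - j) then \<sigma> (int M - (m - j)) else 0) * norm (fc e j)" for m j
          using nf(3)[of j] by (auto simp: t_def norm_mult)
      qed simp
      moreover have "(\<Sum>\<^sub>\<infinity>j. t m j) = (if m < 0 then conv (fc u) d m else 0)" for m
      proof (cases "m < 0")
        case True
        have "conv (fc u) (fc x) m = conv (fc u) y m + conv (fc u) d m"
          unfolding x_eq by (rule conv_add[OF Au y2 d2])
        also have "conv (fc u) y m = fc u m + conv (fc u) w m"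
          unfolding y_def[abs_def] by (simp only: conv_add[OF Au l2_le_delta l1_le_imp_l2_le[OF W]] conv_delta)
        also have "\<dots> = 0" using w(3)[OF True] by simp
        finally have "conv (fc u) d m = conv (fc ?uR) (fc e) m"
          using nf(6)[OF True] unfolding ux uRe by simp
        also have "\<dots> = (\<Sum>\<^sub>\<infinity>j. t m j)"
          unfolding conv_def
        proof (rule infsum_cong)
          fix j
          have eq: "- (m - j) - 2 * N = int M - (m - j)" using NM by simp
          show "fc ?uR (m - j) * fc e j = t m j"
            unfolding fc_uR eq t_def \<sigma>_def using True by simp
        qed
        finally show ?thesis using True by simp
      next
        case False
        then show ?thesis by (simp add: t_def)
      qed
      ultimately show "l2_le (\<lambda>m. if m < 0 then conv (fc u) d m else 0) (H * (H * X))" by simp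
    qed
    \<comment> \<open>pair \<open>P\<^sub>+(u e)\<close> with \<open>v\<close>, using that the Toeplitz operator of \<open>u\<close> is symmetric\<close>
    have q: "fc e 1 = (\<Sum>\<^sub>\<infinity>j. cnj (v j) * conv (fc ?uRc) (fc x) j)"
    proof -
      note sv = ser_bounded_meas[OF V]
      have fcv: "fc (ser v) = v" using fc_ser[OF V] by auto
      have iue: "integrable arc (\<lambda>\<theta>. u \<theta> * e \<theta>)"
        by (rule sq_int_integrable[OF sq_int_bounded_mult[OF nf(1) bounded_u]])
      have cv: "fc (\<lambda>\<theta>. cnj (ser v \<theta>)) = (\<lambda>m. cnj (v (- m)))"
        by (rule ext) (simp add: fc_cnj fcv)
      have l1: "l1_le (fc (\<lambda>\<theta>. cnj (ser v \<theta>))) V"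
        unfolding cv by (rule l1_le_mono[OF l1_le_reindex[OF V]]) auto
      have "fc (\<lambda>\<theta>. cnj (ser v \<theta>) * (u \<theta> * e \<theta>)) 0 = conv (\<lambda>m. cnj (v (- m))) (fc (\<lambda>\<theta>. u \<theta> * e \<theta>)) 0"
        using fc_mult[OF bounded_meas_cnj[OF sv] l1 iue, of 0] unfolding cv .
      also have "\<dots> = (\<Sum>\<^sub>\<infinity>j. cnj (v j) * conv (fc ?uRc) (fc x) j)"
        unfolding conv_def[of "\<lambda>m. cnj (v (- m))"]
      proof (rule infsum_cong)
        fix j :: int
        show "cnj (v (- (0 - j))) * fc (\<lambda>\<theta>. u \<theta> * e \<theta>) j = cnj (v j) * conv (fc ?uRc) (fc x) j"
          using nf(7)[of j] v(2)[of j] unfolding uRcx by (cases "0 \<le> j") auto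
      qed
      finally have 1: "fc (\<lambda>\<theta>. cnj (ser v \<theta>) * (u \<theta> * e \<theta>)) 0 =
        (\<Sum>\<^sub>\<infinity>j. cnj (v j) * conv (fc ?uRc) (fc x) j)" .
      have uv: "bounded_meas (\<lambda>\<theta>. u \<theta> * ser v \<theta>) (U * V)"
        by (rule bounded_meas_mult[OF bounded_u sv])
      have fuv: "fc (\<lambda>\<theta>. u \<theta> * ser v \<theta>) = conv (fc u) v"
        using fc_mult[OF bounded_u Au bounded_meas_integrable[OF sv]] unfolding fcv by auto
      have "sob 1 (fc (\<lambda>\<theta>. u \<theta> * ser v \<theta>))"
        unfolding fuv by (rule sob_conv[OF sob_mono[OF sob_u k] v(1)]) simp
      then obtain B where B: "l1_le (fc (\<lambda>\<theta>. u \<theta> * ser v \<theta>)) B" using sob_l1 by blast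
      have c: "fc (\<lambda>\<theta>. cnj (u \<theta> * ser v \<theta>)) = (\<lambda>m. cnj (conv (fc u) v (- m)))"
        by (rule ext) (simp only: fc_cnj fuv)
      have Bc: "l1_le (fc (\<lambda>\<theta>. cnj (u \<theta> * ser v \<theta>))) B"
        unfolding c by (rule l1_le_mono[OF l1_le_reindex[OF B[unfolded fuv]]]) auto
      have "cnj (ser v \<theta>) * (u \<theta> * e \<theta>) = cnj (u \<theta> * ser v \<theta>) * e \<theta>" for \<theta>
        by (simp add: u_def)
      then have "fc (\<lambda>\<theta>. cnj (ser v \<theta>) * (u \<theta> * e \<theta>)) 0 = conv (\<lambda>m. cnj (conv (fc u) v (- m))) (fc e) 0"
        using fc_mult[OF bounded_meas_cnj[OF uv] Bc sq_int_integrable[OF nf(1)], of 0] unfolding c by (simp only:)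
      \<comment> \<open>On nonnegative frequencies u v is z, and e has no other frequencies, so only
        its coefficient at 1 survives.\<close>
      also have "\<dots> = (\<Sum>\<^sub>\<infinity>j::int. (if j = 1 then fc e 1 else 0))"
        unfolding conv_def[of "\<lambda>m. cnj (conv (fc u) v (- m))"]
      proof (rule infsum_cong)
        fix j :: int
        show "cnj (conv (fc u) v (- (0 - j))) * fc e j = (if j = 1 then fc e 1 else 0)"
          using nf(3)[of j] v(3)[of j] by (cases "0 \<le> j") auto
      qed
      also have "\<dots> = fc e 1"
        by (rule infsumI, rule has_sum_finite_neutralI[of "{1}"]) auto
      finally show ?thesis using 1 by simp
    qed
    define \<tau> where "\<tau> = Ck / (1 + real M) ^ k"
    have tail2: "l2_le (\<lambda>m. if int M \<le> m then \<sigma> m else 0) \<tau>"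
      unfolding \<tau>_def by (rule l2_le_upper_tail[OF Ck])
    have cy: "conv (fc ?uRc) y j = Q1 (int M + j)" if "0 \<le> j" for j
    proof -
      have "conv (fc ?uRc) y j = (\<Sum>\<^sub>\<infinity>i. y (- i) * \<sigma> (int M + j + i))"
        unfolding conv_def
      proof (rule infsum_reindex_bij_witness[of _ uminus uminus])
        fix i
        have eq: "int M + j + - i = j - i - 2 * N" using NM by simp
        show "y (- (- i)) * \<sigma> (int M + j + - i) = fc ?uRc (j - i) * y i"
          unfolding eq by (simp only: fc_uRc \<sigma>_def minus_minus mult.commute)
      qed auto
      then show ?thesis using that by (simp add: Q1_def)
    qed
    \<comment> \<open>For j \<ge> 0 and i < 0 the index j + M - i exceeds M, so Cauchy-Schwarz pairs
      d with the l2 tail of \<open>\<sigma>\<close>. Here the full H^k smoothness enters the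
      error.\<close>
    have cd: "norm (conv (fc ?uRc) d j) \<le> \<tau> * (H * (H * X))" if "0 \<le> j" for j
      unfolding conv_def
    proof (rule l1_le_norm_infsum, rule l1_le_mono[OF l2_le_mult[OF l2_le_reindex[OF tail2, of "\<lambda>i. j + int M - i"] dD]])
      fix i
      have eq: "j - i - 2 * N = j + int M - i" using NM by simp
      show "norm (fc ?uRc (j - i) * d i) \<le>
          norm ((if int M \<le> j + int M - i then \<sigma> (j + int M - i) else 0) * d i)"
        using d_supp[of i] that unfolding fc_uRc eq \<sigma>_def by (cases "i < 0") auto
    qed auto
    have split: "cnj (v j) * conv (fc ?uRc) (fc x) j =
        cnj (v j) * Q1 (int M + j) + cnj (v j) * (if 0 \<le> j then conv (fc ?uRc) d j else 0)" for j
    proof (cases "0 \<le> j")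
      case True
      have "conv (fc ?uRc) (fc x) j = Q1 (int M + j) + conv (fc ?uRc) d j"
        unfolding x_eq conv_add[OF uRcl y2 d2] cy[OF True] ..
      then show ?thesis using True by (simp add: distrib_left)
    next
      case False
      then show ?thesis using v(2)[of j] by simp
    qed
    obtain CQ where CQ: "l2_le Q1 CQ" using sob_l2[OF Q1] by blast
    have s1: "l1_le (\<lambda>j. cnj (v j) * Q1 (int M + j)) (V * CQ)"
      by (rule l1_le_mult_bounded[OF V' l2_le_norm[OF CQ]])
    have "0 \<le> \<tau> * (H * (H * X))"
      using cd[of 0] norm_ge_zero order_trans by blast
    then have s2: "l1_le (\<lambda>j. cnj (v j) * (if 0 \<le> j then conv (fc ?uRc) d j else 0)) (V * (\<tau> * (H * (H * X))))"
      by (intro l1_le_mult_bounded[OF V']) (use cd in auto)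
    have "fc e 1 = Q (int M) + (\<Sum>\<^sub>\<infinity>j. cnj (v j) * (if 0 \<le> j then conv (fc ?uRc) d j else 0))"
      unfolding q split Q_def
      using infsum_add[OF abs_summable_summable[OF l1_le_abs_summable[OF s1]] abs_summable_summable[OF l1_le_abs_summable[OF s2]]]
      by simp
    then have "norm (fc e 1 - Q (int M)) \<le> V * (\<tau> * (H * (H * X)))"
      using l1_le_norm_infsum[OF s2] by simp
    also have "V * (\<tau> * (H * (H * X))) = C / (1 + real M) ^ (k + 1)"
    proof -
      have HH: "H * (H * X) = (2 * C\<sigma>) * ((2 * C\<sigma>) * X) / (1 + real M)"
      proof -
        have "H * (H * X) = (2 * C\<sigma>) * ((2 * C\<sigma>) * X) / (sqrt (1 + real M) * sqrt (1 + real M))"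
          unfolding H_def by (simp add: divide_simps)
        then show ?thesis by simp
      qed
      show ?thesis unfolding HH \<tau>_def C_def by (simp add: mult_ac)
    qed
    finally show ?thesis
      unfolding nf(4) by (simp add: N_def M_def)
  qed
  from Q bound show ?thesis by (rule that)
qed

end

section \<open>Both signs of n together, and the theorem\<close>

context circle_reflection
begin

text \<open>The tail of the coefficients of r from 2 n + 1 on has norm of order wt (2 n + 1)^(-k),
  and the error is quadratic in it; k \<ge> 1 gives 2 k \<ge> k + 1.\<close>

lemma sob_potential_positive: "sob k (\<lambda>n. if 0 \<le> n then reconstructed_potential r n else 0)"
proof -
  define c where "c = fc (\<lambda>\<theta>. r (cis \<theta>))"
  obtain C where C: "l2_le (\<lambda>m. of_real (wt m ^ k) * c m) C"
    using sob_\<rho> by (auto simp: sob_def c_def)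
  define K where "K = C\<^sup>2 / (1 - \<kappa>)"
  have K0: "0 \<le> K" using \<kappa> by (simp add: K_def)
  show ?thesis
  proof (rule sob_from_approximation[where Q = "\<lambda>m. cnj (c m)" and g = "\<lambda>n. 2 * n + 1", OF _ _ K0])
    show "sob k (\<lambda>m. cnj (c m))"
      unfolding c_def by (rule sob_mono_norm[OF sob_\<rho>]) simp
    fix n :: int assume n: "0 \<le> n"
    show "wt n \<le> 2 * wt (2 * n + 1)" using n by (simp add: wt_def)
    obtain f g where row: "rh_row (n + 1) 1 0 f g" and q: "reconstructed_potential r n = fc (\<lambda>\<theta>. Rc (n + 1) \<theta> * f \<theta>) 1"
      by (rule reconstructed_potential_rh_row)
    have N: "2 * (n + 1) - 1 = 2 * n + 1" by simp
    have w: "1 + real (nat (2 * n + 1)) = wt (2 * n + 1)" using n by (simp add: wt_def)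
    have \<tau>: "l2_le (\<lambda>m. if 2 * n + 1 \<le> m then c m else 0) (C / wt (2 * n + 1) ^ k)"
      using l2_le_upper_tail[OF C, of "nat (2 * n + 1)"] n unfolding w by simp
    have "norm (reconstructed_potential r n - cnj (c (2 * n + 1))) \<le> (C / wt (2 * n + 1) ^ k)\<^sup>2 / (1 - \<kappa>)"
      using potential_positive[OF row, of "C / wt (2 * n + 1) ^ k"] \<tau> unfolding N q c_def by blast
    also have "\<dots> = K / wt (2 * n + 1) ^ (2 * k)"
      by (simp add: K_def power_divide mult.commute[of 2 k] power_mult)
    also have "\<dots> \<le> K / wt (2 * n + 1) ^ (k + 1)"
      using k by (intro divide_left_mono power_increasing wt_ge_1 K0) auto
    finally show "norm (reconstructed_potential r n - cnj (c (2 * n + 1))) \<le> K / wt (2 * n + 1) ^ (k + 1)" .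
  qed (auto intro: injI)
qed

lemma sob_potential_negative: "sob k (\<lambda>n. if n < 0 then reconstructed_potential r n else 0)"
proof -
  obtain Q C where Q: "sob k Q" and QC: "\<And>L f g. rh_row (- int L) 1 0 f g \<Longrightarrow>
      norm (fc (\<lambda>\<theta>. Rc (- int L) \<theta> * f \<theta>) 1 - Q (2 * int L)) \<le> C / (1 + real (2 * L)) ^ (k + 1)"
    using potential_negative by blast
  show ?thesis
  proof (rule sob_from_approximation[where g = "\<lambda>n. - 2 * n - 2" and K = "\<bar>C\<bar>", OF Q])
    fix n :: int assume n: "n < 0"
    show "wt n \<le> 2 * wt (- 2 * n - 2)" using n by (simp add: wt_def)
    \<comment> \<open>N = n + 1 \<le> 0 is written as -L; n = -1 is the case L = 0, and the leading
      index is 2 L = -2 n - 2.\<close>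
    define L where "L = nat (- n - 1)"
    have L: "n + 1 = - int L" "2 * int L = - 2 * n - 2" using n by (auto simp: L_def)
    obtain f g where row: "rh_row (n + 1) 1 0 f g" and q: "reconstructed_potential r n = fc (\<lambda>\<theta>. Rc (n + 1) \<theta> * f \<theta>) 1"
      by (rule reconstructed_potential_rh_row)
    have "real_of_int (2 * int L) = real_of_int (- 2 * n - 2)" by (simp only: L(2))
    then have w: "1 + real (2 * L) = wt (- 2 * n - 2)" by (simp add: wt_def)
    have "norm (reconstructed_potential r n - Q (- 2 * n - 2)) \<le> C / wt (- 2 * n - 2) ^ (k + 1)"
      using QC[of L f g] row unfolding q L(1) L(2) w by blast
    also have "\<dots> \<le> \<bar>C\<bar> / wt (- 2 * n - 2) ^ (k + 1)"
      by (intro divide_right_mono) auto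
    finally show "norm (reconstructed_potential r n - Q (- 2 * n - 2)) \<le> \<bar>C\<bar> / wt (- 2 * n - 2) ^ (k + 1)" .
  qed (auto intro: injI)
qed

lemma sob_potential: "sob k (reconstructed_potential r)"
  by (rule sob_mono_norm[OF sob_add[OF sob_potential_positive sob_potential_negative]]) simp

end

text \<open>From 1 + n^2 \<le> (1 + |n|)^2.\<close>

lemma sob_imp_weighted_l2:
  assumes "sob k q"
  shows "q \<in> weighted_l2 k"
proof -
  obtain C where C: "l2_le (\<lambda>m. of_real (wt m ^ k) * q m) C" using assms by (auto simp: sob_def)
  have "(\<lambda>n. (1 + (real_of_int n)\<^sup>2) ^ k * (norm (q n))\<^sup>2) summable_on UNIV"
  proof (rule nonneg_bdd_above_summable_on)
    show "bdd_above (sum (\<lambda>n. (1 + (real_of_int n)\<^sup>2) ^ k * (norm (q n))\<^sup>2) ` {F. F \<subseteq> UNIV \<and> finite F})"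
    proof (rule bdd_aboveI2)
      fix F :: "int set" assume F: "F \<in> {F. F \<subseteq> UNIV \<and> finite F}"
      have "(1 + (real_of_int n)\<^sup>2) ^ k * (norm (q n))\<^sup>2 \<le> (norm (of_real (wt n ^ k) * q n))\<^sup>2" for n
      proof -
        have "1 + (real_of_int n)\<^sup>2 \<le> (wt n)\<^sup>2"
          by (simp add: wt_def power2_sum)
        then have "(1 + (real_of_int n)\<^sup>2) ^ k \<le> ((wt n)\<^sup>2) ^ k"
          by (intro power_mono) auto
        then have "(1 + (real_of_int n)\<^sup>2) ^ k * (norm (q n))\<^sup>2 \<le> ((wt n)\<^sup>2) ^ k * (norm (q n))\<^sup>2"
          by (rule mult_right_mono) simp
        then show ?thesis
          by (simp add: norm_mult power_mult_distrib power_mult[symmetric] mult.commute)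
      qed
      then have "(\<Sum>n\<in>F. (1 + (real_of_int n)\<^sup>2) ^ k * (norm (q n))\<^sup>2) \<le> (\<Sum>n\<in>F. (norm (of_real (wt n ^ k) * q n))\<^sup>2)"
        by (rule sum_mono)
      also have "\<dots> \<le> C\<^sup>2" by (rule l2_le_sq_sum[OF C]) (use F in simp)
      finally show "(\<Sum>n\<in>F. (1 + (real_of_int n)\<^sup>2) ^ k * (norm (q n))\<^sup>2) \<le> C\<^sup>2" .
    qed
  qed auto
  then show ?thesis by (simp add: weighted_l2_def)
qed

theorem theorem3p1:
  fixes k :: nat and r :: "complex \<Rightarrow> complex"
  assumes "k \<ge> 1"
    and "r \<in> sobolev_circle k"
    and "(SUP \<theta>\<in>{-pi..pi}. ereal (norm (r (cis \<theta>)))) < 1"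
  shows "reconstructed_potential r \<in> weighted_l2 k"
proof -
  \<comment> \<open>A number strictly between the supremum and 1 serves as the pointwise bound
    \<kappa>; it is finite because it exceeds the norm at \<theta> = 0.\<close>
  obtain c where c: "(SUP \<theta>\<in>{-pi..pi}. ereal (norm (r (cis \<theta>)))) < c" "c < 1"
    using dense[OF assms(3)] by blast
  have le: "ereal (norm (r (cis \<theta>))) < c" if "\<theta> \<in> {-pi..pi}" for \<theta>
    using c(1) SUP_upper[OF that, of "\<lambda>\<theta>. ereal (norm (r (cis \<theta>)))"] by (rule order.strict_trans1[rotated])
  have "0 \<le> norm (r (cis 0))" by simp
  with le[of 0] c(2) obtain \<kappa> where \<kappa>: "c = ereal \<kappa>" "\<kappa> < 1"
    by (cases c) auto
  \<comment> \<open>The supremum runs over [-pi, pi]; the principal argument of cis \<theta> lies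
    there and gives the same point of the circle.\<close>
  have bd: "norm (r (cis \<theta>)) \<le> \<kappa>" for \<theta>
  proof -
    have "cis (Arg (cis \<theta>)) = cis \<theta>" by (subst cis_Arg) (auto simp: sgn_eq)
    moreover have "Arg (cis \<theta>) \<in> {-pi..pi}" using Arg_bounded[of "cis \<theta>"] by auto
    ultimately show ?thesis using le[of "Arg (cis \<theta>)"] by (simp add: \<kappa>(1))
  qed
  have "sq_int (\<lambda>\<theta>. r (cis \<theta>))"
    using assms(2) by (simp add: sobolev_circle_def L2_circle_iff)
  then have "bounded_meas (\<lambda>\<theta>. r (cis \<theta>)) \<kappa>"
    using bd by (simp add: bounded_meas_def sq_int_def)
  then interpret circle_reflection r \<kappa> k
    using assms(1) \<kappa>(2) sobolev_circle_sob[OF assms(2,1)] by unfold_locales auto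
  show ?thesis by (rule sob_imp_weighted_l2[OF sob_potential])
qed

end
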